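(* Let $h\in C^1(\mathbf{T})$ be real-valued and let $\Omega=\{(x,y)\in\mathbf{T}\times\mathbf{R}:\ y<h(x)\}$. Denote by $\kappa$ the curvature of $\partial\Omega$ and by $\theta$ the angle the interface $\partial\Omega$ makes with the $x$-axis, defined by $$\kappa=\partial_x\left(\frac{h_x}{\sqrt{1+h_x^2}}\right),\qquad \theta=\arctan(h_x).$$ Then $$\|G(h)\kappa\|_{H^{-1}}\le 2\,\|\theta_x\|_{L^2},$$ where $G(h)$ is the Dirichlet-to-Neumann operator of $\Omega$.
   Context: $\mathbf{T}$ is the one-dimensional torus and $f_x=\partial_x f$; the norms are over $\mathbf{T}$, and $H^{-1}(\mathbf{T})$ is the dual of $H^1(\mathbf{T})$. For $\zeta\in H^{1/2}(\mathbf{T})$, let $\phi$ be the unique variational solution (with $\nabla_{x,y}\phi\in L^2(\Omega)$) of $$\Delta_{x,y}\phi=0\ \text{ in }\Omega,\qquad \phi(x,h(x))=\zeta(x),\qquad \lim_{y\to-\infty}\sup_{x\in\mathbf{T}}|\nabla_{x,y}\phi(x,y)|=0.$$ The Dirichlet-to-Neumann operator is $G(h)\zeta=(\partial_y\phi-h_x\,\partial_x\phi)|_{y=h}$, where $f|_{y=h}$ denotes the function $x\mapsto f(x,h(x))$. It is self-adjoint for the $L^2$ scalar product, and $G(h)\varphi\in L^2(\mathbf{T})$ for $\varphi\in H^1(\mathbf{T})$; accordingly, the pairing of $G(h)\kappa$ with $\varphi\in H^1(\mathbf{T})$ is $\int_{\mathbf{T}}\kappa\,G(h)\varphi\,dx$.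 The inequality has content when $\theta_x\in L^2(\mathbf{T})$; otherwise its right-hand side is read as $+\infty$. *)

theory Defs
  imports "HOL-Analysis.Analysis"
begin

section \<open>Function spaces on the torus\<close>

text \<open>
  The torus is R / 2 pi Z. A function on it is a 2 pi-periodic function on the line, and integrals
  over the torus are Lebesgue integrals over one period. Elements of \<open>L\<^sup>1\<close> and \<open>L\<^sup>2\<close> are
  represented by Borel functions, so equality of such elements is equality almost everywhere.
\<close>

definition periodic :: "(real \<Rightarrow> 'a) \<Rightarrow> bool" where
  "periodic f \<longleftrightarrow> (\<forall>x. f (x + 2 * pi) = f x)"

definition torus_integral :: "(real \<Rightarrow> real) \<Rightarrow> real" where
  "torus_integral f = (LBINT x:{0..2*pi}. f x)"

definition L1_torus :: "(real \<Rightarrow> real) set" where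
  "L1_torus = {f. periodic f \<and> f \<in> borel_measurable borel \<and> set_integrable lborel {0..2*pi} f}"

definition L2_torus :: "(real \<Rightarrow> real) set" where
  "L2_torus = {f. periodic f \<and> f \<in> borel_measurable borel \<and>
                  set_integrable lborel {0..2*pi} (\<lambda>x. (f x)\<^sup>2)}"

text \<open>The \<open>L\<^sup>2\<close> norm takes the value \<open>\<infinity>\<close> outside \<open>L\<^sup>2\<close>.\<close>

definition L2_norm :: "(real \<Rightarrow> real) \<Rightarrow> ennreal" where
  "L2_norm f = (if f \<in> L2_torus then ennreal (sqrt (torus_integral (\<lambda>x. (f x)\<^sup>2))) else \<infinity>)"

definition test_function :: "(real \<Rightarrow> real) \<Rightarrow> bool" where
  "test_function \<psi> \<longleftrightarrow> periodic \<psi> \<and> (\<forall>n x. (deriv ^^ n) \<psi> field_differentiable (at x))"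

text \<open>\<open>g\<close> is the derivative of \<open>f\<close> in the sense of distributions on the torus.\<close>

definition has_weak_deriv :: "(real \<Rightarrow> real) \<Rightarrow> (real \<Rightarrow> real) \<Rightarrow> bool" where
  "has_weak_deriv f g \<longleftrightarrow> f \<in> L1_torus \<and> g \<in> L1_torus \<and>
     (\<forall>\<psi>. test_function \<psi> \<longrightarrow>
        torus_integral (\<lambda>x. f x * deriv \<psi> x) = - torus_integral (\<lambda>x. g x * \<psi> x))"

text \<open>
  The weak derivative is determined almost everywhere, and \<open>weak_deriv f\<close> is a representative of it.
  It is meaningful only when the distributional derivative of \<open>f\<close> is an integrable function.
\<close>

definition weak_deriv :: "(real \<Rightarrow> real) \<Rightarrow> real \<Rightarrow> real" where
  "weak_deriv f = (SOME g. has_weak_deriv f g)"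

text \<open>The quantity \<open>\<parallel>f\<^sub>x\<parallel>\<close> in \<open>L\<^sup>2\<close>, equal to \<open>\<infinity>\<close> when the distribution \<open>f\<^sub>x\<close> is not in \<open>L\<^sup>2\<close>.\<close>

definition L2_norm_deriv :: "(real \<Rightarrow> real) \<Rightarrow> ennreal" where
  "L2_norm_deriv f = (if \<exists>g. has_weak_deriv f g then L2_norm (weak_deriv f) else \<infinity>)"

definition H1_torus :: "(real \<Rightarrow> real) set" where
  "H1_torus = {f \<in> L2_torus. \<exists>g \<in> L2_torus. has_weak_deriv f g}"

definition H1_norm :: "(real \<Rightarrow> real) \<Rightarrow> real" where
  "H1_norm f = sqrt (torus_integral (\<lambda>x. (f x)\<^sup>2) + torus_integral (\<lambda>x. (weak_deriv f x)\<^sup>2))"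

text \<open>
  The norm of the dual of \<open>H\<^sup>1\<close>, where an element of the dual is given by its values on \<open>H\<^sup>1\<close>.
\<close>

definition Hminus1_norm :: "((real \<Rightarrow> real) \<Rightarrow> real) \<Rightarrow> ennreal" where
  "Hminus1_norm T = (SUP \<phi>\<in>{\<phi> \<in> H1_torus. H1_norm \<phi> \<le> 1}. ennreal \<bar>T \<phi>\<bar>)"


section \<open>The Dirichlet-to-Neumann operator\<close>

definition subgraph :: "(real \<Rightarrow> real) \<Rightarrow> (real \<times> real) set" where
  "subgraph h = {(x, y). y < h x}"

definition pdx :: "(real \<times> real \<Rightarrow> real) \<Rightarrow> real \<times> real \<Rightarrow> real" where
  "pdx f p = deriv (\<lambda>s. f (s, snd p)) (fst p)"

definition pdy :: "(real \<times> real \<Rightarrow> real) \<Rightarrow> real \<times> real \<Rightarrow> real" where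
  "pdy f p = deriv (\<lambda>s. f (fst p, s)) (snd p)"

definition grad :: "(real \<times> real \<Rightarrow> real) \<Rightarrow> real \<times> real \<Rightarrow> real \<times> real" where
  "grad f p = (pdx f p, pdy f p)"

definition C2_on :: "(real \<times> real) set \<Rightarrow> (real \<times> real \<Rightarrow> real) \<Rightarrow> bool" where
  "C2_on S f \<longleftrightarrow> f differentiable_on S \<and> pdx f differentiable_on S \<and> pdy f differentiable_on S \<and>
     continuous_on S (pdx (pdx f)) \<and> continuous_on S (pdy (pdx f)) \<and>
     continuous_on S (pdx (pdy f)) \<and> continuous_on S (pdy (pdy f))"

definition harmonic_on :: "(real \<times> real) set \<Rightarrow> (real \<times> real \<Rightarrow> real) \<Rightarrow> bool" where
  "harmonic_on S f \<longleftrightarrow> C2_on S f \<and> (\<forall>p\<in>S. pdx (pdx f) p + pdy (pdy f) p = 0)"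

text \<open>
  The restriction of a function \<open>F\<close> on the open domain to its boundary \<open>y = h(x)\<close> is the limit in
  \<open>L\<^sup>2\<close> of \<open>x \<mapsto> F(x, h(x) - \<epsilon>)\<close> as \<open>\<epsilon>\<close> decreases to \<open>0\<close>. For a function with square
  integrable gradient this is the Sobolev trace.
\<close>

definition has_boundary_value ::
  "(real \<Rightarrow> real) \<Rightarrow> (real \<times> real \<Rightarrow> real) \<Rightarrow> (real \<Rightarrow> real) \<Rightarrow> bool" where
  "has_boundary_value h F g \<longleftrightarrow> g \<in> L2_torus \<and>
     ((\<lambda>\<epsilon>. L2_norm (\<lambda>x. F (x, h x - \<epsilon>) - g x)) \<longlongrightarrow> 0) (at_right 0)"

definition boundary_value :: "(real \<Rightarrow> real) \<Rightarrow> (real \<times> real \<Rightarrow> real) \<Rightarrow> real \<Rightarrow> real" where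
  "boundary_value h F = (SOME g. has_boundary_value h F g)"

text \<open>
  The variational solution of the Dirichlet problem with data \<open>\<zeta>\<close>. By Weyl's lemma it is a
  classical harmonic function inside the domain. The uniform limit expresses that the supremum
  over \<open>x\<close> of \<open>|\<nabla>\<phi>(x, y)|\<close> tends to \<open>0\<close> as \<open>y\<close> tends to \<open>-\<infinity>\<close>.
\<close>

definition dirichlet_solution ::
  "(real \<Rightarrow> real) \<Rightarrow> (real \<Rightarrow> real) \<Rightarrow> (real \<times> real \<Rightarrow> real) \<Rightarrow> bool" where
  "dirichlet_solution h \<zeta> \<phi> \<longleftrightarrow>
     (\<forall>x y. (x, y) \<in> subgraph h \<longrightarrow> \<phi> (x + 2 * pi, y) = \<phi> (x, y)) \<and>
     harmonic_on (subgraph h) \<phi> \<and>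
     set_integrable lborel (subgraph h \<inter> {0..2*pi} \<times> UNIV) (\<lambda>p. (norm (grad \<phi> p))\<^sup>2) \<and>
     has_boundary_value h \<phi> \<zeta> \<and>
     uniform_limit UNIV (\<lambda>y x. grad \<phi> (x, y)) (\<lambda>x. 0) at_bot"

text \<open>The solution is unique on the domain, and its values elsewhere are irrelevant.\<close>

definition potential :: "(real \<Rightarrow> real) \<Rightarrow> (real \<Rightarrow> real) \<Rightarrow> real \<times> real \<Rightarrow> real" where
  "potential h \<zeta> = (SOME \<phi>. dirichlet_solution h \<zeta> \<phi>)"

definition DN :: "(real \<Rightarrow> real) \<Rightarrow> (real \<Rightarrow> real) \<Rightarrow> real \<Rightarrow> real" where
  "DN h \<zeta> = boundary_value h
     (\<lambda>p. pdy (potential h \<zeta>) p - deriv h (fst p) * pdx (potential h \<zeta>) p)"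

text \<open>
  The extension of \<open>DN h\<close> by self-adjointness: \<open>DN_dual h \<kappa>\<close> is the functional on \<open>H\<^sup>1\<close>
  representing \<open>G(h)\<kappa>\<close>.
\<close>

definition DN_dual :: "(real \<Rightarrow> real) \<Rightarrow> (real \<Rightarrow> real) \<Rightarrow> (real \<Rightarrow> real) \<Rightarrow> real" where
  "DN_dual h \<kappa> \<phi> = torus_integral (\<lambda>x. \<kappa> x * DN h \<phi> x)"


section \<open>Geometry of the interface\<close>

definition curvature :: "(real \<Rightarrow> real) \<Rightarrow> real \<Rightarrow> real" where
  "curvature h = weak_deriv (\<lambda>x. deriv h x / sqrt (1 + (deriv h x)\<^sup>2))"

definition angle :: "(real \<Rightarrow> real) \<Rightarrow> real \<Rightarrow> real" where
  "angle h x = arctan (deriv h x)"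

end

(*
  With w = exp(y - ix) the fluid domain becomes a domain that is starlike about w = 0 (the point
  y = -infinity), bounded by the curve gamma(x) = exp(h(x) - ix), and the translates of the
  interface by -epsilon become the dilates of gamma by exp(-epsilon). A potential phi corresponds to
  the analytic function f = phi_x - i phi_y, and f (1 + i h_x) = psi_x - i G(h)psi on the boundary,
  where psi is the boundary value of phi.

  Integrating f^2 (1 + i h_x) over a period gives 0 by Cauchy's theorem. Its real part is Rellich's
  identity, which implies that G(h)psi / sqrt(1 + h_x^2) is bounded by 2 psi_x in L^2. Since
  kappa = theta_x / sqrt(1 + h_x^2), the pairing of kappa with G(h)psi is at most
  2 |theta_x| |psi_x|.

  Most of the work is to show that G(h)psi exists. The function f on the boundary is found by an
  orthogonal projection in L^2 from Rellich's inequality for polynomials in w. It is extended by its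
  Cauchy integral, whose traces on the dilated curves converge in L^2 because the difference of the
  Cauchy kernels on both sides of a Lipschitz graph is an approximate identity.
*)
theory Submission
  imports Defs "HOL-Complex_Analysis.Complex_Analysis"
begin

text \<open>The weight 1 / sqrt(1 + h_x^2) of the curvature is the one under which Rellich's
  identity controls the normal derivative, so no Lipschitz constant of h enters the bound. The
  identity says that phi_y sqrt(1 + h_x^2) and psi_x have equal L^2 norms. Writing G(h)psi as (1 +
  h_x^2) phi_y - h_x psi_x and squaring this sum of two terms gives 4 = 2 + 2, whose root is the
  factor 2. The operator is encoded by choice: \<open>potential\<close> and
  \<open>boundary_value\<close> select some solution and some trace. Nothing can be said of
  \<open>DN\<close> before existence is known, and the selected solution must then be identified.
  Two solutions differ by a constant, because an analytic function whose real part has zero trace is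
  an imaginary constant. The angle has only a weak derivative, so kappa = theta_x cos(theta) is a
  chain rule for sin(theta), obtained by approximating theta_x in L^1.\<close>

definition circ :: "real measure" where
  "circ = restrict_space lborel {0..2*pi}"

lemma space_circ [simp]: "space circ = {0..2*pi}"
  by (simp add: circ_def space_restrict_space)

lemma emeasure_circ: "emeasure circ (space circ) = ennreal (2*pi)"
  unfolding space_circ by (simp add: circ_def emeasure_restrict_space)

interpretation circ: finite_measure circ
  by standard (simp add: emeasure_circ del: space_circ)

lemma measure_circ [simp]: "measure circ {0..2*pi} = 2*pi"
  using emeasure_circ by (simp add: measure_def)

lemma measurable_circ: "f \<in> borel_measurable borel \<Longrightarrow> f \<in> borel_measurable circ"
  unfolding circ_def by (rule measurable_restrict_space1) simp

lemma id_measurable_circ [measurable]: "(\<lambda>x. x) \<in> borel_measurable circ"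
  by (rule measurable_circ) simp

lemma continuous_measurable_circ:
  "continuous_on {0..2*pi} f \<Longrightarrow> f \<in> borel_measurable circ"
  unfolding circ_def
  using borel_measurable_continuous_on_restrict[of "{0..2*pi}" f]
  by (simp add: measurable_def space_restrict_space sets_restrict_space)

lemma integrable_circ_iff: "integrable circ f \<longleftrightarrow> set_integrable lborel {0..2*pi} f"
  for f :: "real \<Rightarrow> 'a::{banach,second_countable_topology}"
  unfolding circ_def set_integrable_def by (rule integrable_restrict_space) simp

lemma integral_circ_eq: "integral\<^sup>L circ f = (LBINT x:{0..2*pi}. f x)"
  for f :: "real \<Rightarrow> 'a::{banach,second_countable_topology}"
  unfolding circ_def set_lebesgue_integral_def by (rule integral_restrict_space) simp

lemma torus_integral_eq: "torus_integral f = integral\<^sup>L circ f"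
  by (simp add: torus_integral_def integral_circ_eq)

lemma AE_circ_iff: "(AE x in circ. P x) \<longleftrightarrow> (AE x in lborel. x \<in> {0..2*pi} \<longrightarrow> P x)"
  unfolding circ_def by (subst AE_restrict_space_iff) auto

text \<open>The endpoints 0 and 2pi are the same point of the torus. Being a null set, they can be
  ignored when a function is cut off near them or wrapped around the torus.\<close>

lemma AE_circ_interior: "AE x in circ. 0 < x \<and> x < 2*pi"
proof -
  have "AE x in lborel. x \<noteq> (0::real) \<and> x \<noteq> 2*pi"
    using AE_lborel_singleton[of 0] AE_lborel_singleton[of "2*pi"] by eventually_elim auto
  then show ?thesis
    unfolding AE_circ_iff by eventually_elim auto
qed

lemma integrable_circ_bounded:
  fixes f :: "real \<Rightarrow> 'a::{banach,second_countable_topology}"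
  assumes "f \<in> borel_measurable circ" "\<And>x. x \<in> {0..2*pi} \<Longrightarrow> norm (f x) \<le> B"
  shows "integrable circ f"
  by (rule circ.integrable_const_bound[of _ B]) (use assms in auto)

lemma integrable_circ_continuous:
  fixes f :: "real \<Rightarrow> 'a::{banach,second_countable_topology}"
  assumes "continuous_on {0..2*pi} f"
  shows "integrable circ f"
  unfolding integrable_circ_iff set_integrable_def
  by (rule borel_integrable_compact) (use assms in auto)

lemma integral_circ_FTC_upto:
  fixes F :: "real \<Rightarrow> 'a::euclidean_space"
  assumes "\<And>x. x \<in> {0..2*pi} \<Longrightarrow> (F has_vector_derivative f x) (at x within {0..2*pi})"
    and "continuous_on {0..2*pi} f" and x: "x \<in> {0..2*pi}"
  shows "(\<integral>t. indicator {..x} t *\<^sub>R f t \<partial>circ) = F x - F 0"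
proof -
  have "(f has_integral (F x - F 0)) {0..x}"
    by (rule fundamental_theorem_of_calculus)
       (use x in \<open>auto intro!: has_vector_derivative_within_subset[OF assms(1)]\<close>)
  then have "integral {0..x} f = F x - F 0"
    by (rule integral_unique)
  moreover have "set_integrable lborel {0..x} f"
    unfolding set_integrable_def
    by (rule borel_integrable_compact) (use assms(2) x in \<open>auto intro: continuous_on_subset\<close>)
  ultimately have "(LBINT t:{0..x}. f t) = F x - F 0"
    by (simp add: set_borel_integral_eq_integral)
  moreover have "(LBINT t:{0..2*pi}. indicator {..x} t *\<^sub>R f t) = (LBINT t:{0..x}. f t)"
    unfolding set_lebesgue_integral_def
    by (rule Bochner_Integration.integral_cong) (use x in \<open>auto simp: indicator_def\<close>)
  ultimately show ?thesis
    by (simp add: integral_circ_eq)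
qed

lemma integral_circ_FTC:
  fixes F :: "real \<Rightarrow> 'a::euclidean_space"
  assumes "\<And>x. x \<in> {0..2*pi} \<Longrightarrow> (F has_vector_derivative f x) (at x within {0..2*pi})"
    and "continuous_on {0..2*pi} f"
  shows "integral\<^sup>L circ f = F (2*pi) - F 0"
proof -
  have "integral\<^sup>L circ f = (\<integral>t. indicator {..2*pi} t *\<^sub>R f t \<partial>circ)"
    by (rule Bochner_Integration.integral_cong) auto
  then show ?thesis
    using integral_circ_FTC_upto[OF assms, of "2*pi"] by simp
qed

subsection \<open>Square integrable functions\<close>

lemma integral_Cauchy_Schwarz:
  fixes f g :: "'a \<Rightarrow> real"
  assumes [measurable]: "f \<in> borel_measurable M" "g \<in> borel_measurable M"
    and f: "integrable M (\<lambda>x. (f x)\<^sup>2)" and g: "integrable M (\<lambda>x. (g x)\<^sup>2)"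
  shows "(\<integral>x. \<bar>f x * g x\<bar> \<partial>M)\<^sup>2 \<le> (\<integral>x. (f x)\<^sup>2 \<partial>M) * (\<integral>x. (g x)\<^sup>2 \<partial>M)"
proof -
  have "integrable M (\<lambda>x. (f x)\<^sup>2 + (g x)\<^sup>2)"
    using f g by auto
  then have "integrable M (\<lambda>x. f x * g x)"
  proof (rule Bochner_Integration.integrable_bound)
    show "AE x in M. norm (f x * g x) \<le> norm ((f x)\<^sup>2 + (g x)\<^sup>2)"
    proof (rule AE_I2)
      fix x
      have "2 * (\<bar>f x\<bar> * \<bar>g x\<bar>) \<le> (f x)\<^sup>2 + (g x)\<^sup>2"
        using sum_squares_bound[of "\<bar>f x\<bar>" "\<bar>g x\<bar>"] by simp
      moreover have "0 \<le> \<bar>f x\<bar> * \<bar>g x\<bar>" by simp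
      ultimately show "norm (f x * g x) \<le> norm ((f x)\<^sup>2 + (g x)\<^sup>2)"
        unfolding real_norm_def abs_mult by linarith
    qed
  qed simp
  then have i: "integrable M (\<lambda>x. \<bar>f x * g x\<bar>)" by simp
  have "(\<integral>\<^sup>+x. ennreal \<bar>f x\<bar> * ennreal \<bar>g x\<bar> \<partial>M)\<^sup>2 \<le>
      (\<integral>\<^sup>+x. ennreal \<bar>f x\<bar> ^ 2 \<partial>M) * (\<integral>\<^sup>+x. ennreal \<bar>g x\<bar> ^ 2 \<partial>M)"
    by (rule Cauchy_Schwarz_nn_integral) auto
  then have "(\<integral>\<^sup>+x. ennreal \<bar>f x * g x\<bar> \<partial>M)\<^sup>2 \<le>
      (\<integral>\<^sup>+x. ennreal ((f x)\<^sup>2) \<partial>M) * (\<integral>\<^sup>+x. ennreal ((g x)\<^sup>2) \<partial>M)"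
    by (simp add: ennreal_mult[symmetric] ennreal_power abs_mult)
  then have "ennreal ((\<integral>x. \<bar>f x * g x\<bar> \<partial>M)\<^sup>2) \<le>
      ennreal ((\<integral>x. (f x)\<^sup>2 \<partial>M) * (\<integral>x. (g x)\<^sup>2 \<partial>M))"
    by (subst (asm) (1 2 3) nn_integral_eq_integral)
       (use i f g in \<open>auto simp: ennreal_mult ennreal_power\<close>)
  then show ?thesis
    by (subst (asm) ennreal_le_iff) (auto intro!: mult_nonneg_nonneg)
qed

text \<open>Square integrability over one period, for real or complex values and without
  periodicity. Limits are constructed on \<open>circ\<close> alone; a periodic Borel representative
  is restored by \<open>exists_L2_torus_representative\<close> when a trace is needed.\<close>

definition sqint :: "(real \<Rightarrow> 'a::{real_normed_field,banach,second_countable_topology}) \<Rightarrow> bool" where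
  "sqint u \<longleftrightarrow> u \<in> borel_measurable circ \<and> integrable circ (\<lambda>x. (norm (u x))\<^sup>2)"

definition nsq :: "(real \<Rightarrow> 'a::{real_normed_field,banach,second_countable_topology}) \<Rightarrow> real" where
  "nsq u = (\<integral>x. (norm (u x))\<^sup>2 \<partial>circ)"

lemma sqint_measurable: "sqint u \<Longrightarrow> u \<in> borel_measurable circ"
  by (simp add: sqint_def)

lemma nsq_nonneg [simp]: "0 \<le> nsq u"
  by (simp add: nsq_def)

lemma sqint_bounded:
  assumes "f \<in> borel_measurable circ" "\<And>x. x \<in> {0..2*pi} \<Longrightarrow> norm (f x) \<le> B"
  shows "sqint f"
  unfolding sqint_def
proof
  show "integrable circ (\<lambda>x. (norm (f x))\<^sup>2)"
    by (rule integrable_circ_bounded[where B="B\<^sup>2"])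
       (use assms in \<open>auto intro!: power_mono\<close>)
qed fact

lemma nsq_bounded:
  assumes "f \<in> borel_measurable circ" "\<And>x. x \<in> {0..2*pi} \<Longrightarrow> norm (f x) \<le> B"
  shows "nsq f \<le> 2*pi*B\<^sup>2"
proof -
  have "nsq f \<le> (\<integral>x. B\<^sup>2 \<partial>circ)"
    unfolding nsq_def
    by (rule integral_mono) (use assms sqint_bounded[OF assms] in \<open>auto simp: sqint_def intro!: power_mono\<close>)
  then show ?thesis by simp
qed

lemma sqint_continuous:
  assumes "continuous_on {0..2*pi} f"
  shows "sqint f"
  unfolding sqint_def
  using continuous_measurable_circ[OF assms]
  by (auto intro!: integrable_circ_continuous continuous_intros assms)

lemma sqint_dominated:
  assumes "f \<in> borel_measurable circ" "sqint g" "AE x in circ. norm (f x) \<le> B * norm (g x)"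
  shows "sqint f" "nsq f \<le> B\<^sup>2 * nsq g"
proof -
  have i: "integrable circ (\<lambda>x. B\<^sup>2 * (norm (g x))\<^sup>2)"
    using assms(2) by (simp add: sqint_def)
  have ae: "AE x in circ. (norm (f x))\<^sup>2 \<le> B\<^sup>2 * (norm (g x))\<^sup>2"
    using assms(3)
  proof eventually_elim
    case (elim x)
    then have "(norm (f x))\<^sup>2 \<le> (B * norm (g x))\<^sup>2" by (intro power_mono) auto
    then show ?case by (simp add: power_mult_distrib)
  qed
  show s: "sqint f"
    unfolding sqint_def
  proof (intro conjI Bochner_Integration.integrable_bound[OF i])
    show "AE x in circ. norm ((norm (f x))\<^sup>2) \<le> norm (B\<^sup>2 * (norm (g x))\<^sup>2)"
      using ae by eventually_elim auto
  qed (use assms(1) in auto)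
  have "nsq f \<le> (\<integral>x. B\<^sup>2 * (norm (g x))\<^sup>2 \<partial>circ)"
    unfolding nsq_def using ae s i by (intro integral_mono_AE) (auto simp: sqint_def)
  then show "nsq f \<le> B\<^sup>2 * nsq g" by (simp add: nsq_def)
qed

lemma sqint_mult_bounded:
  assumes "c \<in> borel_measurable circ" "sqint u" "\<And>x. x \<in> {0..2*pi} \<Longrightarrow> norm (c x) \<le> B"
  shows "sqint (\<lambda>x. c x * u x)" "nsq (\<lambda>x. c x * u x) \<le> B\<^sup>2 * nsq u"
proof -
  have *: "(\<lambda>x. c x * u x) \<in> borel_measurable circ"
    using assms by (auto simp: sqint_def)
  have **: "AE x in circ. norm (c x * u x) \<le> B * norm (u x)"
    by (rule AE_I2) (use assms(3) in \<open>auto simp: norm_mult intro!: mult_right_mono\<close>)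
  show "sqint (\<lambda>x. c x * u x)" "nsq (\<lambda>x. c x * u x) \<le> B\<^sup>2 * nsq u"
    using sqint_dominated[OF * assms(2) **] by auto
qed

lemma sqint_cmult: "sqint u \<Longrightarrow> sqint (\<lambda>x. c * u x)"
  by (rule sqint_mult_bounded(1)[where B="norm c"]) auto

text \<open>The substitute for the triangle inequality when norms are kept squared. In
  \<open>Rellich_pointwise\<close> the loss of 2 contributes to the final constant; elsewhere it is
  immaterial.\<close>

lemma norm_add_sq_le: "(norm (a + b))\<^sup>2 \<le> 2 * (norm a)\<^sup>2 + 2 * (norm b)\<^sup>2"
  for a b :: "'a::real_normed_vector"
proof -
  have "(norm (a + b))\<^sup>2 \<le> (norm a + norm b)\<^sup>2"
    by (intro power_mono norm_triangle_ineq) auto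
  also have "\<dots> \<le> 2 * (norm a)\<^sup>2 + 2 * (norm b)\<^sup>2"
    using sum_squares_bound[of "norm a" "norm b"] by (simp add: power2_sum)
  finally show ?thesis .
qed

lemma sqint_add:
  assumes "sqint u" "sqint v"
  shows "sqint (\<lambda>x. u x + v x)" "nsq (\<lambda>x. u x + v x) \<le> 2 * nsq u + 2 * nsq v"
proof -
  have [measurable]: "u \<in> borel_measurable circ" "v \<in> borel_measurable circ"
    using assms by (auto simp: sqint_def)
  have i: "integrable circ (\<lambda>x. 2 * (norm (u x))\<^sup>2 + 2 * (norm (v x))\<^sup>2)"
    using assms by (simp add: sqint_def)
  show s: "sqint (\<lambda>x. u x + v x)"
    unfolding sqint_def
  proof (intro conjI Bochner_Integration.integrable_bound[OF i] AE_I2)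
    fix x
    show "norm ((norm (u x + v x))\<^sup>2) \<le> norm (2 * (norm (u x))\<^sup>2 + 2 * (norm (v x))\<^sup>2)"
      using norm_add_sq_le[of "u x" "v x"] by simp
  qed auto
  have "nsq (\<lambda>x. u x + v x) \<le> (\<integral>x. 2 * (norm (u x))\<^sup>2 + 2 * (norm (v x))\<^sup>2 \<partial>circ)"
    unfolding nsq_def using s i norm_add_sq_le by (intro integral_mono) (auto simp: sqint_def)
  also have "\<dots> = 2 * nsq u + 2 * nsq v"
    using assms by (simp add: sqint_def nsq_def)
  finally show "nsq (\<lambda>x. u x + v x) \<le> 2 * nsq u + 2 * nsq v" .
qed

lemma sqint_uminus: "sqint u \<Longrightarrow> sqint (\<lambda>x. - u x)"
  using sqint_cmult[of u "-1"] by simp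

lemma nsq_uminus [simp]: "nsq (\<lambda>x. - u x) = nsq u"
  by (simp add: nsq_def)

lemma sqint_diff:
  assumes "sqint u" "sqint v"
  shows "sqint (\<lambda>x. u x - v x)" "nsq (\<lambda>x. u x - v x) \<le> 2 * nsq u + 2 * nsq v"
  using sqint_add[OF assms(1) sqint_uminus[OF assms(2)]] by auto

lemma nsq_triangle:
  assumes "sqint (\<lambda>x. u x - v x)" "sqint (\<lambda>x. v x - w x)"
  shows "nsq (\<lambda>x. u x - w x) \<le> 2 * nsq (\<lambda>x. u x - v x) + 2 * nsq (\<lambda>x. v x - w x)"
  using sqint_add(2)[OF assms] by simp

lemma sqint_AE_cong:
  assumes "sqint u" "v \<in> borel_measurable circ" "AE x in circ. u x = v x"
  shows "sqint v" "nsq v = nsq u"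
proof -
  have *: "AE x in circ. (norm (u x))\<^sup>2 = (norm (v x))\<^sup>2"
    using assms(3) by eventually_elim auto
  show "sqint v"
    unfolding sqint_def
  proof (rule conjI)
    show "integrable circ (\<lambda>x. (norm (v x))\<^sup>2)"
    proof (rule integrable_cong_AE_imp)
      show "AE x in circ. (norm (u x))\<^sup>2 = (norm (v x))\<^sup>2"
        by (rule *)
    qed (use assms in \<open>auto simp: sqint_def\<close>)
  qed (rule assms(2))
  show "nsq v = nsq u"
    unfolding nsq_def by (rule integral_cong_AE) (use assms * in \<open>auto simp: sqint_def\<close>)
qed

lemma sqint_mult:
  assumes "sqint u" "sqint v"
  shows "integrable circ (\<lambda>x. u x * v x)"
    and "norm (\<integral>x. u x * v x \<partial>circ) \<le> sqrt (nsq u * nsq v)"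
    and "(\<integral>x. norm (u x * v x) \<partial>circ) \<le> sqrt (nsq u * nsq v)"
proof -
  have [measurable]: "u \<in> borel_measurable circ" "v \<in> borel_measurable circ"
    using assms by (auto simp: sqint_def)
  have "integrable circ (\<lambda>x. (norm (u x))\<^sup>2 + (norm (v x))\<^sup>2)"
    using assms by (simp add: sqint_def)
  then show i: "integrable circ (\<lambda>x. u x * v x)"
  proof (rule Bochner_Integration.integrable_bound)
    show "AE x in circ. norm (u x * v x) \<le> norm ((norm (u x))\<^sup>2 + (norm (v x))\<^sup>2)"
    proof (rule AE_I2)
      fix x
      have "2 * (norm (u x) * norm (v x)) \<le> (norm (u x))\<^sup>2 + (norm (v x))\<^sup>2"
        using sum_squares_bound[of "norm (u x)" "norm (v x)"] by simp
      moreover have "0 \<le> norm (u x) * norm (v x)" by simp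
      ultimately show "norm (u x * v x) \<le> norm ((norm (u x))\<^sup>2 + (norm (v x))\<^sup>2)"
        unfolding real_norm_def norm_mult by linarith
    qed
  qed simp
  have "(\<integral>x. norm (u x * v x) \<partial>circ)\<^sup>2 \<le> nsq u * nsq v"
    using integral_Cauchy_Schwarz[of "\<lambda>x. norm (u x)" circ "\<lambda>x. norm (v x)"] assms
    by (simp add: sqint_def nsq_def norm_mult)
  then show *: "(\<integral>x. norm (u x * v x) \<partial>circ) \<le> sqrt (nsq u * nsq v)"
    by (intro real_le_rsqrt) 
  show "norm (\<integral>x. u x * v x \<partial>circ) \<le> sqrt (nsq u * nsq v)"
    using integral_norm_bound[of circ "\<lambda>x. u x * v x"] * by linarith
qed

lemma sqint_const [simp]: "sqint (\<lambda>x. c)"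
  by (rule sqint_bounded[of _ "norm c"]) auto

lemma nsq_const: "nsq (\<lambda>x. c) = 2*pi*(norm c)\<^sup>2"
  by (simp add: nsq_def)

lemma sqint_L1:
  assumes "sqint u"
  shows "integrable circ u" "(\<integral>x. norm (u x) \<partial>circ) \<le> sqrt (2*pi * nsq u)"
  using sqint_mult[OF assms sqint_const[of 1]] by (auto simp: nsq_const mult.commute)

lemma sqint_of_real: "sqint (\<lambda>x. of_real (u x) :: complex) \<longleftrightarrow> sqint u"
proof -
  have "u \<in> borel_measurable circ" if "(\<lambda>x. of_real (u x) :: complex) \<in> borel_measurable circ"
    using measurable_compose[OF that borel_measurable_Re] by simp
  moreover have "(\<lambda>x. of_real (u x) :: complex) \<in> borel_measurable circ" if "u \<in> borel_measurable circ"
    using that by simp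
  ultimately show ?thesis
    unfolding sqint_def norm_of_real real_norm_def by blast
qed

lemma nsq_of_real: "nsq (\<lambda>x. of_real (u x) :: complex) = nsq u"
  by (simp add: nsq_def)

lemma sqint_Re:
  assumes "sqint u"
  shows "sqint (\<lambda>x. Re (u x))" "nsq (\<lambda>x. Re (u x)) \<le> nsq u"
proof -
  have "(\<lambda>x. Re (u x)) \<in> borel_measurable circ"
    using assms by (auto simp: sqint_def)
  from sqint_dominated[OF this assms, of 1] 
  show "sqint (\<lambda>x. Re (u x))" "nsq (\<lambda>x. Re (u x)) \<le> nsq u"
    by (auto simp: abs_Re_le_cmod)
qed

lemma sqint_Im:
  assumes "sqint u"
  shows "sqint (\<lambda>x. Im (u x))" "nsq (\<lambda>x. Im (u x)) \<le> nsq u"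
proof -
  have "(\<lambda>x. Im (u x)) \<in> borel_measurable circ"
    using assms by (auto simp: sqint_def)
  from sqint_dominated[OF this assms, of 1] 
  show "sqint (\<lambda>x. Im (u x))" "nsq (\<lambda>x. Im (u x)) \<le> nsq u"
    by (auto simp: abs_Im_le_cmod)
qed

lemma nsq_Re_Im:
  assumes "sqint u"
  shows "nsq u = nsq (\<lambda>x. Re (u x)) + nsq (\<lambda>x. Im (u x))"
  using sqint_Re(1)[OF assms] sqint_Im(1)[OF assms]
  by (simp add: nsq_def cmod_power2 sqint_def)

lemma nsq_eq_0_AE:
  assumes "sqint u" "nsq u \<le> 0"
  shows "AE x in circ. u x = 0"
proof -
  have "nsq u = 0" using assms(2) nsq_nonneg[of u] by linarith
  then have "AE x in circ. (norm (u x))\<^sup>2 = 0"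
    using assms(1) unfolding nsq_def sqint_def
    by (subst (asm) integral_nonneg_eq_0_iff_AE) auto
  then show ?thesis by eventually_elim auto
qed

lemma tendsto_integral_mult:
  assumes "\<forall>\<^sub>F n in F. sqint (u n)" "sqint w" "sqint v"
    and "((\<lambda>n. nsq (\<lambda>x. u n x - w x)) \<longlongrightarrow> 0) F"
  shows "((\<lambda>n. \<integral>x. u n x * v x \<partial>circ) \<longlongrightarrow> (\<integral>x. w x * v x \<partial>circ)) F"
proof -
  have "((\<lambda>n. (\<integral>x. u n x * v x \<partial>circ) - (\<integral>x. w x * v x \<partial>circ)) \<longlongrightarrow> 0) F"
  proof (rule Lim_null_comparison)
    show "((\<lambda>n. sqrt (nsq (\<lambda>x. u n x - w x) * nsq v)) \<longlongrightarrow> 0) F"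
      using tendsto_real_sqrt[OF tendsto_mult_left_zero[OF assms(4)]] by simp
    show "\<forall>\<^sub>F n in F. norm ((\<integral>x. u n x * v x \<partial>circ) - (\<integral>x. w x * v x \<partial>circ))
        \<le> sqrt (nsq (\<lambda>x. u n x - w x) * nsq v)"
      using assms(1)
    proof eventually_elim
      case (elim n)
      have "(\<integral>x. u n x * v x \<partial>circ) - (\<integral>x. w x * v x \<partial>circ) = (\<integral>x. (u n x - w x) * v x \<partial>circ)"
        using sqint_mult(1)[OF elim assms(3)] sqint_mult(1)[OF assms(2,3)]
        by (simp add: left_diff_distrib)
      then show ?case
        using sqint_mult(2)[OF sqint_diff(1)[OF elim assms(2)] assms(3)] by simp
    qed
  qed
  then show ?thesis
    by (rule LIM_zero_cancel)
qed

lemma tendsto_nsq: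
  assumes "\<forall>\<^sub>F n in F. sqint (u n)" "sqint w"
    and "((\<lambda>n. nsq (\<lambda>x. u n x - w x)) \<longlongrightarrow> 0) F"
  shows "\<forall>\<^sub>F n in F. nsq (u n) \<le> 2 + 2 * nsq w"
proof -
  have "\<forall>\<^sub>F n in F. nsq (\<lambda>x. u n x - w x) < 1"
    using assms(3) by (rule order_tendstoD) simp
  then show ?thesis
    using assms(1)
  proof eventually_elim
    case (elim n)
    have "nsq (\<lambda>x. (u n x - w x) + w x) \<le> 2 * nsq (\<lambda>x. u n x - w x) + 2 * nsq w"
      by (rule sqint_add(2)[OF sqint_diff(1)[OF elim(2) assms(2)] assms(2)])
    then show ?case using elim by simp
  qed
qed

text \<open>In the factorisation u_n^2 - w^2 = (u_n - w)(u_n + w) the first factor tends to 0 and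
  the second stays bounded by \<open>tendsto_nsq\<close>. This carries the Cauchy identity for F^2
  from the levels to the boundary.\<close>

lemma tendsto_integral_square:
  assumes "\<forall>\<^sub>F n in F. sqint (u n)" "sqint w"
    and c: "c \<in> borel_measurable circ" "\<And>x. x \<in> {0..2*pi} \<Longrightarrow> norm (c x) \<le> B"
    and lim: "((\<lambda>n. nsq (\<lambda>x. u n x - w x)) \<longlongrightarrow> 0) F"
  shows "((\<lambda>n. \<integral>x. (u n x)\<^sup>2 * c x \<partial>circ) \<longlongrightarrow> (\<integral>x. (w x)\<^sup>2 * c x \<partial>circ)) F"
proof -
  have cu: "sqint (\<lambda>x. c x * v x)" if "sqint v" for v
    using sqint_mult_bounded(1)[OF c(1) that c(2)] .
  have "((\<lambda>n. (\<integral>x. (u n x)\<^sup>2 * c x \<partial>circ) - (\<integral>x. (w x)\<^sup>2 * c x \<partial>circ)) \<longlongrightarrow> 0) F"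
  proof (rule Lim_null_comparison)
    let ?d = "\<lambda>n. nsq (\<lambda>x. u n x - w x)"
    show "((\<lambda>n. sqrt (?d n * (B\<^sup>2 * (2 * (2 + 2 * nsq w) + 2 * nsq w)))) \<longlongrightarrow> 0) F"
      using tendsto_real_sqrt[OF tendsto_mult_left_zero[OF lim]] by simp
    show "\<forall>\<^sub>F n in F. norm ((\<integral>x. (u n x)\<^sup>2 * c x \<partial>circ) - (\<integral>x. (w x)\<^sup>2 * c x \<partial>circ))
        \<le> sqrt (?d n * (B\<^sup>2 * (2 * (2 + 2 * nsq w) + 2 * nsq w)))"
      using assms(1) tendsto_nsq[OF assms(1,2) lim]
    proof eventually_elim
      case (elim n)
      have sq: "integrable circ (\<lambda>x. (v x)\<^sup>2 * c x)" if "sqint v" for v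
        using sqint_mult(1)[OF that cu[OF that]] by (simp add: power2_eq_square mult_ac)
      have "(\<integral>x. (u n x)\<^sup>2 * c x \<partial>circ) - (\<integral>x. (w x)\<^sup>2 * c x \<partial>circ)
          = (\<integral>x. (u n x)\<^sup>2 * c x - (w x)\<^sup>2 * c x \<partial>circ)"
        using sq[OF elim(1)] sq[OF assms(2)] by simp
      also have "\<dots> = (\<integral>x. (u n x - w x) * (c x * (u n x + w x)) \<partial>circ)"
        by (rule Bochner_Integration.integral_cong) (auto simp: algebra_simps power2_eq_square)
      finally have "norm ((\<integral>x. (u n x)\<^sup>2 * c x \<partial>circ) - (\<integral>x. (w x)\<^sup>2 * c x \<partial>circ))
          \<le> sqrt (?d n * nsq (\<lambda>x. c x * (u n x + w x)))"
        using sqint_mult(2)[OF sqint_diff(1)[OF elim(1) assms(2)] cu[OF sqint_add(1)[OF elim(1) assms(2)]]]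
        by simp
      also have "\<dots> \<le> sqrt (?d n * (B\<^sup>2 * (2 * (2 + 2 * nsq w) + 2 * nsq w)))"
      proof (intro real_sqrt_le_mono mult_left_mono)
        have "nsq (\<lambda>x. c x * (u n x + w x)) \<le> B\<^sup>2 * nsq (\<lambda>x. u n x + w x)"
          by (rule sqint_mult_bounded(2)[OF c(1) sqint_add(1)[OF elim(1) assms(2)] c(2)])
        also have "\<dots> \<le> B\<^sup>2 * (2 * (2 + 2 * nsq w) + 2 * nsq w)"
          using sqint_add(2)[OF elim(1) assms(2)] elim(2) by (intro mult_left_mono) auto
        finally show "nsq (\<lambda>x. c x * (u n x + w x)) \<le> B\<^sup>2 * (2 * (2 + 2 * nsq w) + 2 * nsq w)" .
      qed simp
      finally show ?case .
    qed
  qed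
  then show ?thesis
    by (rule LIM_zero_cancel)
qed

text \<open>The rate (1/4)^n of the squared distances makes the distances of consecutive terms
  summable like 2^(-n), so the sequence itself converges almost everywhere and no subsequence is
  extracted.\<close>

lemma Riesz_Fischer:
  fixes v :: "nat \<Rightarrow> real \<Rightarrow> 'a::{real_normed_field,banach,second_countable_topology}"
  assumes v: "\<And>n. sqint (v n)" and C: "0 \<le> C"
    and cauchy: "\<And>n m. nsq (\<lambda>x. v n x - v m x) \<le> C * ((1/4)^n + (1/4)^m)"
  obtains u where "sqint u" "(\<lambda>n. nsq (\<lambda>x. v n x - u x)) \<longlonglongrightarrow> 0"
proof -
  have [measurable]: "v n \<in> borel_measurable circ" for n
    using v by (simp add: sqint_def)
  define d where "d n x = norm (v (Suc n) x - v n x)" for n x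
  have [measurable]: "d n \<in> borel_measurable circ" for n
    unfolding d_def by measurable
  define K where "K = sqrt (2*pi * (C * 2))"
  have d_bound: "(\<integral>x. d n x \<partial>circ) \<le> K * (1/2)^n" for n
  proof -
    have "(\<integral>x. d n x \<partial>circ) \<le> sqrt (2*pi * nsq (\<lambda>x. v (Suc n) x - v n x))"
      unfolding d_def by (rule sqint_L1(2)[OF sqint_diff(1)[OF v v]])
    also have "\<dots> \<le> sqrt (2*pi * (C * (2 * (1/4)^n)))"
    proof (intro real_sqrt_le_mono mult_left_mono)
      have "C * ((1/4)^Suc n + (1/4)^n) \<le> C * (2 * (1/4)^n)"
        by (rule mult_left_mono[OF _ C]) simp
      then show "nsq (\<lambda>x. v (Suc n) x - v n x) \<le> C * (2 * (1/4)^n)"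
        using cauchy[of "Suc n" n] by linarith
    qed simp
    also have "\<dots> = K * sqrt ((1/4)^n)"
      unfolding K_def by (simp add: real_sqrt_mult[symmetric] mult_ac)
    also have "sqrt ((1/4)^n) = (1/2::real)^n"
      by (simp add: real_sqrt_power real_sqrt_divide)
    finally show ?thesis .
  qed
  have d_int: "integrable circ (d n)" for n
    unfolding d_def using sqint_L1(1)[OF sqint_diff(1)[OF v v]] by (rule integrable_norm)
  have "(\<integral>\<^sup>+x. (\<Sum>n. ennreal (d n x)) \<partial>circ) = (\<Sum>n. \<integral>\<^sup>+x. ennreal (d n x) \<partial>circ)"
    by (rule nn_integral_suminf) simp
  also have "\<dots> \<le> (\<Sum>n. ennreal (K * (1/2)^n))"
  proof (rule suminf_le)
    fix n
    have "(\<integral>\<^sup>+x. ennreal (d n x) \<partial>circ) = ennreal (\<integral>x. d n x \<partial>circ)"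
      by (rule nn_integral_eq_integral[OF d_int]) (simp add: d_def)
    then show "(\<integral>\<^sup>+x. ennreal (d n x) \<partial>circ) \<le> ennreal (K * (1/2)^n)"
      using d_bound[of n] by (simp add: ennreal_leI)
  qed auto
  also have "\<dots> = ennreal (\<Sum>n. K * (1/2)^n)"
    by (rule suminf_ennreal2) (auto simp: K_def C intro!: summable_mult summable_geometric mult_nonneg_nonneg)
  also have "\<dots> < \<infinity>" by simp
  finally have "AE x in circ. (\<Sum>n. ennreal (d n x)) \<noteq> \<infinity>"
    by (intro nn_integral_PInf_AE) (auto simp: less_top)
  then have conv: "AE x in circ. convergent (\<lambda>n. v n x)"
  proof eventually_elim
    case (elim x)
    have "summable (\<lambda>n. d n x)"
      by (rule summable_suminf_not_top) (use elim in \<open>auto simp: d_def\<close>)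
    then have "summable (\<lambda>n. v (Suc n) x - v n x)"
      unfolding d_def by (rule summable_norm_cancel)
    then have "convergent (\<lambda>n. \<Sum>i<n. v (Suc i) x - v i x)"
      by (simp add: summable_iff_convergent)
    then have "convergent (\<lambda>n. v n x - v 0 x)"
      using sum_lessThan_telescope[of "\<lambda>i. v i x"] by simp
    then show ?case
      by (simp add: convergent_diff_const_right_iff)
  qed
  define u where "u x = lim (\<lambda>n. v n x)" for x
  have [measurable]: "u \<in> borel_measurable circ"
    unfolding u_def by (rule borel_measurable_lim_metric) simp
  have lim: "AE x in circ. (\<lambda>n. v n x) \<longlonglongrightarrow> u x"
    using conv by eventually_elim (simp add: u_def convergent_LIMSEQ_iff)
  \<comment> \<open>Convergence almost everywhere becomes convergence in L^2 by Fatou's lemma in the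
    second index of the Cauchy estimate.\<close>
  have fatou: "(\<integral>\<^sup>+x. ennreal ((norm (v n x - u x))\<^sup>2) \<partial>circ) \<le> ennreal (C * (1/4)^n)" for n
  proof -
    have "(\<integral>\<^sup>+x. ennreal ((norm (v n x - u x))\<^sup>2) \<partial>circ)
        = (\<integral>\<^sup>+x. liminf (\<lambda>m. ennreal ((norm (v n x - v m x))\<^sup>2)) \<partial>circ)"
    proof (rule nn_integral_cong_AE)
      show "AE x in circ. ennreal ((norm (v n x - u x))\<^sup>2) = liminf (\<lambda>m. ennreal ((norm (v n x - v m x))\<^sup>2))"
        using lim
      proof eventually_elim
        case (elim x)
        have "(\<lambda>m. ennreal ((norm (v n x - v m x))\<^sup>2)) \<longlonglongrightarrow> ennreal ((norm (v n x - u x))\<^sup>2)"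
          by (intro tendsto_ennrealI tendsto_intros elim)
        from lim_imp_Liminf[OF _ this] show ?case
          by simp
      qed
    qed
    also have "\<dots> \<le> liminf (\<lambda>m. \<integral>\<^sup>+x. ennreal ((norm (v n x - v m x))\<^sup>2) \<partial>circ)"
      by (rule nn_integral_liminf) simp
    also have "\<dots> \<le> liminf (\<lambda>m. ennreal (C * ((1/4)^n + (1/4)^m)))"
    proof (intro Liminf_mono always_eventually allI)
      fix m
      have "(\<integral>\<^sup>+x. ennreal ((norm (v n x - v m x))\<^sup>2) \<partial>circ) = ennreal (nsq (\<lambda>x. v n x - v m x))"
        unfolding nsq_def
        by (rule nn_integral_eq_integral) (use sqint_diff(1)[OF v v] in \<open>auto simp: sqint_def\<close>)
      then show "(\<integral>\<^sup>+x. ennreal ((norm (v n x - v m x))\<^sup>2) \<partial>circ) \<le> ennreal (C * ((1/4)^n + (1/4)^m))"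
        using cauchy by (simp add: ennreal_leI)
    qed
    also have "\<dots> = ennreal (C * ((1/4)^n + 0))"
      by (intro lim_imp_Liminf tendsto_ennrealI tendsto_intros LIMSEQ_realpow_zero) auto
    finally show ?thesis by simp
  qed
  have diff: "sqint (\<lambda>x. v n x - u x)" for n
    unfolding sqint_def
  proof
    show "integrable circ (\<lambda>x. (norm (v n x - u x))\<^sup>2)"
      by (rule integrableI_bounded) (use le_less_trans[OF fatou[of n] ennreal_less_top] in auto)
  qed simp
  have "sqint (\<lambda>x. v 0 x - (v 0 x - u x))"
    by (rule sqint_diff(1)[OF v diff])
  then have u: "sqint u" by simp
  have bound: "nsq (\<lambda>x. v n x - u x) \<le> C * (1/4)^n" for n
  proof -
    have "ennreal (nsq (\<lambda>x. v n x - u x)) \<le> ennreal (C * (1/4)^n)"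
      unfolding nsq_def
      by (subst nn_integral_eq_integral[symmetric])
         (use fatou[of n] diff[of n] in \<open>auto simp: sqint_def\<close>)
    then show ?thesis
      using C by (subst (asm) ennreal_le_iff) auto
  qed
  have "(\<lambda>n. nsq (\<lambda>x. v n x - u x)) \<longlonglongrightarrow> 0"
  proof (rule tendsto_sandwich[of "\<lambda>_. 0" _ _ "\<lambda>n. C * (1/4)^n"])
    show "(\<lambda>n. C * (1/4)^n) \<longlonglongrightarrow> 0"
      using tendsto_mult_right_zero[OF LIMSEQ_realpow_zero[of "1/4"], of C] by simp
  qed (use bound in auto)
  with u show thesis by (rule that)
qed

subsection \<open>Density of continuous functions on the circle\<close>

text \<open>\<open>Arg2pi\<close> jumps at 1, so composing with it is not visibly continuous. The
  homotopy of the loop with itself is invoked because it yields continuity of the induced map on the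
  circle.\<close>

lemma continuous_on_loop_circle:
  fixes w :: "real \<Rightarrow> 'a::real_normed_vector"
  assumes w: "continuous_on {0..2*pi} w" "w 0 = w (2*pi)"
  obtains V where "continuous_on (sphere 0 1) V" "\<And>x. x \<in> {0..2*pi} \<Longrightarrow> V (cis x) = w x"
proof -
  define p where "p t = w (2*pi*t)" for t
  have cp: "continuous_on {0..1} p"
    unfolding p_def
    by (rule continuous_on_compose2[OF w(1)]) (auto intro!: continuous_intros mult_left_le)
  have "homotopic_loops UNIV p p"
    using cp w(2) by (simp add: homotopic_loops_refl path_def pathfinish_def pathstart_def p_def)
  then have "continuous_on (sphere 0 1) (p \<circ> (\<lambda>z. Arg2pi z / (2*pi)))"
    using homotopic_loops_imp_homotopic_circlemaps homotopic_with_imp_continuous by blast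
  moreover have "(p \<circ> (\<lambda>z. Arg2pi z / (2*pi))) (cis x) = w x" if x: "x \<in> {0..2*pi}" for x
  proof (cases "x = 2*pi")
    case True
    \<comment> \<open>\<open>Arg2pi\<close> sends 1 to 0 and not to 2pi, so here the equality of the
      end values enters.\<close>
    then show ?thesis using w(2) by (simp add: p_def Arg2pi_of_real[of 1, simplified])
  next
    case False
    then have "Arg2pi (cis x) = x"
      using x by (intro Arg2pi_unique[of 1]) (auto simp: cis_conv_exp)
    then show ?thesis by (simp add: p_def)
  qed
  ultimately show thesis by (rule that)
qed

lemma tendsto_nsq_dominated:
  fixes w :: "nat \<Rightarrow> real \<Rightarrow> real"
  assumes [measurable]: "\<And>n. w n \<in> borel_measurable circ" "u \<in> borel_measurable circ"
    and g: "sqint g" and lim: "AE x in circ. (\<lambda>n. w n x) \<longlonglongrightarrow> u x"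
    and bound: "\<And>n. AE x in circ. \<bar>w n x - u x\<bar> \<le> \<bar>g x\<bar>"
  shows "(\<lambda>n. nsq (\<lambda>x. u x - w n x)) \<longlonglongrightarrow> 0"
proof -
  have "(\<lambda>n. \<integral>x. (w n x - u x)\<^sup>2 \<partial>circ) \<longlonglongrightarrow> (\<integral>x. 0 \<partial>circ)"
  proof (rule integral_dominated_convergence[where w="\<lambda>x. (g x)\<^sup>2"])
    show "integrable circ (\<lambda>x. (g x)\<^sup>2)" using g by (simp add: sqint_def)
    show "AE x in circ. (\<lambda>n. (w n x - u x)\<^sup>2) \<longlonglongrightarrow> 0"
      using lim
    proof eventually_elim
      case (elim x)
      show ?case using tendsto_power[OF LIM_zero[OF elim], of 2] by simp
    qed
    show "AE x in circ. norm ((w n x - u x)\<^sup>2) \<le> (g x)\<^sup>2" for n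
      using bound[of n] by eventually_elim (simp add: abs_le_square_iff)
  qed auto
  then show ?thesis
    by (simp add: nsq_def power2_commute)
qed

lemma circle_dense_real:
  fixes u :: "real \<Rightarrow> real"
  assumes u: "sqint u" and e: "e > 0"
  obtains V :: "complex \<Rightarrow> real" where "continuous_on (sphere 0 1) V" "nsq (\<lambda>x. u x - V (cis x)) < e"
proof -
  have [measurable]: "u \<in> borel_measurable circ" using u by (rule sqint_measurable)
  define uN where "uN n x = (if \<bar>u x\<bar> \<le> real n then u x else 0)" for n x
  have [measurable]: "uN n \<in> borel_measurable circ" for n
    unfolding uN_def by measurable
  have "(\<lambda>n. nsq (\<lambda>x. u x - uN n x)) \<longlonglongrightarrow> 0"
  proof (rule tendsto_nsq_dominated[OF _ _ u])
    show "AE x in circ. (\<lambda>n. uN n x) \<longlonglongrightarrow> u x"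
    proof (rule AE_I2)
      fix x
      obtain k where "\<bar>u x\<bar> \<le> real k" using real_arch_simple by blast
      then have "\<forall>\<^sub>F n in sequentially. uN n x = u x"
        unfolding eventually_sequentially uN_def by (intro exI[of _ k]) auto
      then show "(\<lambda>n. uN n x) \<longlonglongrightarrow> u x" by (rule tendsto_eventually)
    qed
  qed (auto simp: uN_def)
  then have "\<forall>\<^sub>F n in sequentially. nsq (\<lambda>x. u x - uN n x) < e/4"
    using e by (intro order_tendstoD(2)) auto
  then obtain N where N: "nsq (\<lambda>x. u x - uN N x) < e/4"
    by (meson eventually_sequentially order_refl)
  \<comment> \<open>Extended by 0 to the line, the truncation is Lebesgue measurable, hence a
    pointwise limit of continuous functions off a negligible set.\<close>
  define U where "U x = indicator {0..2*pi} x *\<^sub>R uN N x" for x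
  have "uN N \<in> borel_measurable (restrict_space lborel {0..2*pi})"
    using \<open>uN N \<in> borel_measurable circ\<close> by (simp add: circ_def)
  then have "U \<in> borel_measurable lborel"
    unfolding U_def by (subst (asm) borel_measurable_restrict_space_iff) auto
  then have "U \<in> borel_measurable lebesgue"
    by (rule measurable_completion)
  then have "U measurable_on UNIV"
    by (intro lebesgue_measurable_imp_measurable_on_real) auto
  then obtain Z g where Z: "negligible Z" and g: "\<And>n::nat. continuous_on UNIV (g n)"
    and lim: "\<And>x. x \<notin> Z \<Longrightarrow> (\<lambda>n. g n x) \<longlonglongrightarrow> U x"
    unfolding measurable_on_def by auto
  \<comment> \<open>Clipping to [-N, N] supplies the dominating constant. The factor vanishing at 0
    and 2pi makes w n a loop, and at every interior point it is eventually 1.\<close>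
  define w where "w n x = max (- real N) (min (real N) (g n x)) * max 0 (min 1 (real n * min x (2*pi - x)))" for n x
  have cw: "continuous_on UNIV (w n)" for n
    unfolding w_def by (intro continuous_intros g) 
  have w0: "w n 0 = 0" "w n (2*pi) = 0" for n
    by (auto simp: w_def)
  have [measurable]: "w n \<in> borel_measurable circ" for n
    using cw by (intro continuous_measurable_circ) (rule continuous_on_subset, auto)
  have "(\<lambda>n. nsq (\<lambda>x. uN N x - w n x)) \<longlonglongrightarrow> 0"
  proof (rule tendsto_nsq_dominated[OF _ _ sqint_const])
    have "AE x in lebesgue. x \<notin> Z"
      using Z by (auto simp: eventually_ae_filter_negligible)
    then have "AE x in lborel. x \<notin> Z"
      using AE_completion_iff by auto
    then have "AE x in circ. x \<notin> Z"
      unfolding AE_circ_iff by eventually_elim auto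
    then show "AE x in circ. (\<lambda>n. w n x) \<longlonglongrightarrow> uN N x"
      using AE_circ_interior AE_space
    proof eventually_elim
      case (elim x)
      have Ux: "U x = uN N x" using elim by (simp add: U_def)
      have bd: "\<bar>uN N x\<bar> \<le> real N" by (simp add: uN_def)
      have 1: "(\<lambda>n. max (- real N) (min (real N) (g n x))) \<longlonglongrightarrow> max (- real N) (min (real N) (U x))"
        by (intro tendsto_intros lim) (use elim in auto)
      have m: "min x (2*pi - x) > 0" using elim by auto
      obtain k where k: "1 / min x (2*pi - x) \<le> real k" using real_arch_simple by blast
      have "\<forall>\<^sub>F n in sequentially. max 0 (min 1 (real n * min x (2*pi - x))) = 1"
        unfolding eventually_sequentially
      proof (intro exI allI impI)
        fix n assume "k \<le> n"
        then have "1 / min x (2*pi - x) \<le> real n" using k by linarith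
        then have "1 \<le> real n * min x (2*pi - x)"
          using m by (simp add: field_simps)
        then show "max 0 (min 1 (real n * min x (2*pi - x))) = 1" by linarith
      qed
      then have "(\<lambda>n. max 0 (min 1 (real n * min x (2*pi - x)))) \<longlonglongrightarrow> 1"
        by (rule tendsto_eventually)
      from tendsto_mult[OF 1 this] show ?case
        using bd by (simp add: w_def Ux)
    qed
    show "AE x in circ. \<bar>w n x - uN N x\<bar> \<le> \<bar>2 * real N\<bar>" for n
    proof (rule AE_I2)
      fix x
      have "\<bar>w n x\<bar> \<le> real N * 1"
        unfolding w_def abs_mult by (intro mult_mono) auto
      moreover have "\<bar>uN N x\<bar> \<le> real N" by (simp add: uN_def)
      ultimately show "\<bar>w n x - uN N x\<bar> \<le> \<bar>2 * real N\<bar>" by linarith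
    qed
  qed auto
  then have "\<forall>\<^sub>F n in sequentially. nsq (\<lambda>x. uN N x - w n x) < e/4"
    using e by (intro order_tendstoD(2)) auto
  then obtain n where n: "nsq (\<lambda>x. uN N x - w n x) < e/4"
    by (meson eventually_sequentially order_refl)
  have "continuous_on {0..2*pi} (w n)" using cw continuous_on_subset by blast
  with w0 obtain V where V: "continuous_on (sphere 0 1) V" "\<And>x. x \<in> {0..2*pi} \<Longrightarrow> V (cis x) = w n x"
    using continuous_on_loop_circle[of "w n"] by metis
  have suN: "sqint (uN N)"
    by (rule sqint_bounded[of _ "real N"]) (auto simp: uN_def)
  have sw: "sqint (w n)"
    using \<open>continuous_on {0..2*pi} (w n)\<close> by (rule sqint_continuous)
  have "nsq (\<lambda>x. u x - w n x) \<le> 2 * nsq (\<lambda>x. u x - uN N x) + 2 * nsq (\<lambda>x. uN N x - w n x)"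
    by (rule nsq_triangle[OF sqint_diff(1)[OF u suN] sqint_diff(1)[OF suN sw]])
  also have "\<dots> < e" using N n by linarith
  also have "nsq (\<lambda>x. u x - w n x) = nsq (\<lambda>x. u x - V (cis x))"
    unfolding nsq_def by (rule Bochner_Integration.integral_cong) (auto simp: V(2))
  finally show thesis using V(1) that by blast
qed

lemma continuous_on_circle_cis:
  assumes "continuous_on (sphere 0 1) V"
  shows "continuous_on S (\<lambda>x. V (cis x))"
  by (rule continuous_on_compose2[OF assms]) (auto simp: cis_conv_exp intro!: continuous_intros)

lemma sqint_circle:
  assumes "continuous_on (sphere 0 1) V"
  shows "sqint (\<lambda>x. V (cis x))"
  by (rule sqint_continuous[OF continuous_on_circle_cis[OF assms]])

lemma circle_dense_complex:
  fixes u :: "real \<Rightarrow> complex"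
  assumes u: "sqint u" and e: "e > 0"
  obtains V :: "complex \<Rightarrow> complex" where "continuous_on (sphere 0 1) V" "nsq (\<lambda>x. u x - V (cis x)) < e"
proof -
  obtain A where A: "continuous_on (sphere 0 1) A" "nsq (\<lambda>x. Re (u x) - A (cis x)) < e/2"
    using circle_dense_real[OF sqint_Re(1)[OF u], of "e/2"] e by auto
  obtain B where B: "continuous_on (sphere 0 1) B" "nsq (\<lambda>x. Im (u x) - B (cis x)) < e/2"
    using circle_dense_real[OF sqint_Im(1)[OF u], of "e/2"] e by auto
  define V where "V z = Complex (A z) (B z)" for z
  have V: "continuous_on (sphere 0 1) V"
    unfolding V_def Complex_eq by (intro continuous_intros A B)
  have "nsq (\<lambda>x. u x - V (cis x)) = nsq (\<lambda>x. Re (u x) - A (cis x)) + nsq (\<lambda>x. Im (u x) - B (cis x))"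
    using nsq_Re_Im[OF sqint_diff(1)[OF u sqint_circle[OF V]]] by (simp add: V_def)
  with A B V show thesis by (intro that) auto
qed

lemma circle_dense_L1:
  fixes u :: "real \<Rightarrow> real"
  assumes u: "integrable circ u" and e: "e > 0"
  obtains V :: "complex \<Rightarrow> real" where "continuous_on (sphere 0 1) V"
    "(\<integral>x. \<bar>u x - V (cis x)\<bar> \<partial>circ) < e"
proof -
  have [measurable]: "u \<in> borel_measurable circ" using u by auto
  define uN where "uN n x = (if \<bar>u x\<bar> \<le> real n then u x else 0)" for n x
  have [measurable]: "uN n \<in> borel_measurable circ" for n
    unfolding uN_def by measurable
  have suN: "sqint (uN n)" for n
    by (rule sqint_bounded[of _ "real n"]) (auto simp: uN_def)
  have "(\<lambda>n. \<integral>x. \<bar>u x - uN n x\<bar> \<partial>circ) \<longlonglongrightarrow> (\<integral>x. 0 \<partial>circ)"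
  proof (rule integral_dominated_convergence[where w="\<lambda>x. \<bar>u x\<bar>"])
    show "AE x in circ. (\<lambda>n. \<bar>u x - uN n x\<bar>) \<longlonglongrightarrow> 0"
    proof (rule AE_I2)
      fix x
      obtain k where "\<bar>u x\<bar> \<le> real k" using real_arch_simple by blast
      then have "\<forall>\<^sub>F n in sequentially. \<bar>u x - uN n x\<bar> = 0"
        unfolding eventually_sequentially uN_def by (intro exI[of _ k]) auto
      then show "(\<lambda>n. \<bar>u x - uN n x\<bar>) \<longlonglongrightarrow> 0" by (rule tendsto_eventually)
    qed
  qed (use u in \<open>auto simp: uN_def\<close>)
  then have "\<forall>\<^sub>F n in sequentially. (\<integral>x. \<bar>u x - uN n x\<bar> \<partial>circ) < e/2"
    using e by (intro order_tendstoD(2)) auto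
  then obtain N where N: "(\<integral>x. \<bar>u x - uN N x\<bar> \<partial>circ) < e/2"
    by (meson eventually_sequentially order_refl)
  have "(e/2)\<^sup>2 / (2*pi) > 0" using e by simp
  from circle_dense_real[OF suN this]
  obtain V where V: "continuous_on (sphere 0 1) V" "nsq (\<lambda>x. uN N x - V (cis x)) < (e/2)\<^sup>2 / (2*pi)"
    by blast
  have d: "sqint (\<lambda>x. uN N x - V (cis x))"
    by (rule sqint_diff(1)[OF suN sqint_circle[OF V(1)]])
  have "(\<integral>x. \<bar>uN N x - V (cis x)\<bar> \<partial>circ) \<le> sqrt (2*pi * nsq (\<lambda>x. uN N x - V (cis x)))"
    using sqint_L1(2)[OF d] by simp
  also have "\<dots> < sqrt ((e/2)\<^sup>2)"
    using V(2) by (intro real_sqrt_less_mono) (simp add: field_simps)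
  also have "\<dots> = e/2" using e by (simp add: real_sqrt_abs)
  finally have 2: "(\<integral>x. \<bar>uN N x - V (cis x)\<bar> \<partial>circ) < e/2" .
  have i: "integrable circ (uN N)" "integrable circ (\<lambda>x. V (cis x))"
    using sqint_L1(1)[OF suN] sqint_L1(1)[OF sqint_circle[OF V(1)]] by auto
  have "(\<integral>x. \<bar>u x - V (cis x)\<bar> \<partial>circ) \<le> (\<integral>x. \<bar>u x - uN N x\<bar> + \<bar>uN N x - V (cis x)\<bar> \<partial>circ)"
    by (rule integral_mono) (use u i in auto)
  also have "\<dots> = (\<integral>x. \<bar>u x - uN N x\<bar> \<partial>circ) + (\<integral>x. \<bar>uN N x - V (cis x)\<bar> \<partial>circ)"
    using u i by simp
  finally show thesis using N 2 V(1) by (intro that) auto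
qed

subsection \<open>Test functions\<close>

text \<open>\<open>test_function\<close> demands all orders at once, a condition on which induction
  has no hold. Bounding the order gives an induction in which the derivative of a product loses one
  order.\<close>

definition smooth_upto :: "nat \<Rightarrow> (real \<Rightarrow> real) \<Rightarrow> bool" where
  "smooth_upto n f \<longleftrightarrow> (\<forall>k\<le>n. \<forall>x. (deriv ^^ k) f field_differentiable (at x))"

lemma smooth_upto_0: "smooth_upto 0 f \<longleftrightarrow> (\<forall>x. f field_differentiable (at x))"
  by (simp add: smooth_upto_def)

lemma smooth_upto_Suc:
  "smooth_upto (Suc n) f \<longleftrightarrow> (\<forall>x. f field_differentiable (at x)) \<and> smooth_upto n (deriv f)"
proof -
  have "(\<forall>k\<le>Suc n. P k) \<longleftrightarrow> P 0 \<and> (\<forall>k\<le>n. P (Suc k))" for P :: "nat \<Rightarrow> bool"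
    by (metis Suc_le_mono le0 not0_implies_Suc)
  from this[of "\<lambda>k. \<forall>x. (deriv ^^ k) f field_differentiable (at x)"] show ?thesis
    unfolding smooth_upto_def by (simp add: funpow_swap1)
qed

lemma smooth_upto_D: "smooth_upto n f \<Longrightarrow> f field_differentiable (at x)"
  unfolding smooth_upto_def by (auto dest: spec[of _ 0])

lemma smooth_upto_mono: "smooth_upto n f \<Longrightarrow> m \<le> n \<Longrightarrow> smooth_upto m f"
  unfolding smooth_upto_def by (meson le_trans)

lemma smooth_upto_add:
  assumes "smooth_upto n f" "smooth_upto n g"
  shows "smooth_upto n (\<lambda>x. f x + g x)"
  using assms
proof (induction n arbitrary: f g)
  case 0
  then show ?case by (auto simp: smooth_upto_0 intro: field_differentiable_add)
next
  case (Suc n)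
  then have fd: "f field_differentiable (at x)" "g field_differentiable (at x)" for x
    by (auto simp: smooth_upto_Suc)
  have "deriv (\<lambda>x. f x + g x) = (\<lambda>x. deriv f x + deriv g x)"
    using fd by (intro ext deriv_add)
  then show ?case
    using Suc fd by (auto simp: smooth_upto_Suc intro: field_differentiable_add)
qed

lemma smooth_upto_mult:
  assumes "smooth_upto n f" "smooth_upto n g"
  shows "smooth_upto n (\<lambda>x. f x * g x)"
  using assms
proof (induction n arbitrary: f g)
  case 0
  then show ?case by (auto simp: smooth_upto_0 intro: field_differentiable_mult)
next
  case (Suc n)
  then have fd: "f field_differentiable (at x)" "g field_differentiable (at x)" for x
    by (auto simp: smooth_upto_Suc)
  have "deriv (\<lambda>x. f x * g x) = (\<lambda>x. f x * deriv g x + deriv f x * g x)"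
    using fd by (intro ext deriv_mult)
  moreover have "smooth_upto n (\<lambda>x. f x * deriv g x + deriv f x * g x)"
    using Suc smooth_upto_mono[of "Suc n" f n] smooth_upto_mono[of "Suc n" g n]
    by (intro smooth_upto_add Suc.IH) (auto simp: smooth_upto_Suc)
  ultimately show ?case
    using fd by (auto simp: smooth_upto_Suc intro: field_differentiable_mult)
qed

lemma smooth_upto_cos_sin: "smooth_upto n (\<lambda>x. a * cos x + b * sin x)"
proof (induction n arbitrary: a b)
  have D: "((\<lambda>x. a * cos x + b * sin x) has_field_derivative (b * cos x + (- a) * sin x)) (at x)" for a b x :: real
    by (auto intro!: derivative_eq_intros)
  then have fd: "(\<lambda>x. a * cos x + b * sin x) field_differentiable (at x)" for a b x :: real
    unfolding field_differentiable_def by blast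
  {
    case 0
    show ?case using fd by (simp add: smooth_upto_0)
  next
    case (Suc n)
    have "deriv (\<lambda>x. a * cos x + b * sin x) = (\<lambda>x. b * cos x + (- a) * sin x)"
      using D by (intro ext DERIV_imp_deriv)
    then show ?case using fd Suc by (simp only: smooth_upto_Suc) blast
  }
qed

lemma smooth_upto_const: "smooth_upto n (\<lambda>x. c)"
  by (induction n arbitrary: c) (auto simp: smooth_upto_0 smooth_upto_Suc)

lemma test_function_iff: "test_function \<psi> \<longleftrightarrow> periodic \<psi> \<and> (\<forall>n. smooth_upto n \<psi>)"
  unfolding test_function_def smooth_upto_def by auto

lemma cis_add_2pi: "cis (x + 2*pi) = cis x"
  by (simp add: complex_eq_iff)

text \<open>Linear functionals become a cos x + b sin x on the circle, so polynomials restricted to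
  it are trigonometric polynomials. Stone-Weierstrass thereby supplies test functions.\<close>

lemma smooth_upto_polynomial_circle:
  "real_polynomial_function g \<Longrightarrow> smooth_upto n (\<lambda>x. g (cis x))"
proof (induction arbitrary: n rule: real_polynomial_function.induct)
  case (linear f)
  then interpret bounded_linear f .
  have "f (cis x) = f 1 * cos x + f \<i> * sin x" for x
  proof -
    have "cis x = cos x *\<^sub>R 1 + sin x *\<^sub>R \<i>" by (simp add: complex_eq_iff)
    then show ?thesis by (simp only: add scale) simp
  qed
  then show ?case using smooth_upto_cos_sin by simp
qed (auto intro: smooth_upto_const smooth_upto_add smooth_upto_mult)

lemma test_function_polynomial:
  "real_polynomial_function g \<Longrightarrow> test_function (\<lambda>x. g (cis x))"
  unfolding test_function_iff periodic_def cis_add_2pi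
  by (auto intro: smooth_upto_polynomial_circle)

lemma test_function_const: "test_function (\<lambda>x. c)"
  by (simp add: test_function_iff periodic_def smooth_upto_const)

lemma test_function_add:
  "test_function f \<Longrightarrow> test_function g \<Longrightarrow> test_function (\<lambda>x. f x + g x)"
  by (simp add: test_function_iff periodic_def smooth_upto_add)

lemma test_function_DERIV:
  assumes "test_function \<psi>"
  shows "(\<psi> has_real_derivative deriv \<psi> x) (at x)"
  using assms smooth_upto_D by (auto simp: test_function_iff intro: DERIV_deriv_iff_field_differentiable[THEN iffD2])

lemma continuous_test_function: "test_function \<psi> \<Longrightarrow> continuous_on S \<psi>"
  by (rule DERIV_continuous_on) (use test_function_DERIV DERIV_subset in blast)

lemma continuous_deriv_test_function:
  assumes "test_function \<psi>"
  shows "continuous_on S (deriv \<psi>)"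
proof -
  have "smooth_upto (Suc 0) \<psi>" using assms by (simp add: test_function_iff)
  then have "deriv \<psi> field_differentiable (at x)" for x
    by (simp add: smooth_upto_Suc smooth_upto_0)
  then show ?thesis
    by (meson continuous_at_imp_continuous_on field_differentiable_imp_continuous_at)
qed

lemma periodic_bounds: "periodic f \<Longrightarrow> f (2*pi) = f 0"
  unfolding periodic_def by (metis add_0)

lemma continuous_circ_bound:
  fixes f :: "real \<Rightarrow> 'a::real_normed_vector"
  assumes "continuous_on {0..2*pi} f"
  obtains B where "B > 0" "\<And>x. x \<in> {0..2*pi} \<Longrightarrow> norm (f x) \<le> B"
proof -
  have "bounded (f ` {0..2*pi})"
    using assms compact_continuous_image compact_imp_bounded by blast
  then show thesis
    using that unfolding bounded_pos by auto
qed

lemma integrable_circ_mult_continuous: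
  fixes f c :: "real \<Rightarrow> 'a::{real_normed_field,banach,second_countable_topology}"
  assumes "integrable circ f" "continuous_on {0..2*pi} c"
  shows "integrable circ (\<lambda>x. f x * c x)"
proof -
  obtain B where B: "B > 0" "\<And>x. x \<in> {0..2*pi} \<Longrightarrow> norm (c x) \<le> B"
    using continuous_circ_bound[OF assms(2)] by blast
  have [measurable]: "f \<in> borel_measurable circ" "c \<in> borel_measurable circ"
    using assms continuous_measurable_circ by auto
  have i: "integrable circ (\<lambda>x. B * norm (f x))" using assms(1) by simp
  show ?thesis
  proof (rule Bochner_Integration.integrable_bound[OF i])
    show "AE x in circ. norm (f x * c x) \<le> norm (B * norm (f x))"
      by (rule AE_I2) (use B in \<open>auto simp: norm_mult mult.commute[of _ "norm (c _)"] intro!: mult_right_mono\<close>)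
  qed simp
qed

text \<open>Stone-Weierstrass extends orthogonality from trigonometric polynomials to all continuous
  functions on the circle. Testing with a continuous approximation of the sign of u then shows that
  the integral of |u| vanishes.\<close>

lemma test_function_orthogonal_imp_zero:
  assumes u: "integrable circ u" and orth: "\<And>\<psi>. test_function \<psi> \<Longrightarrow> (\<integral>x. u x * \<psi> x \<partial>circ) = 0"
  shows "AE x in circ. u x = 0"
proof -
  define I where "I = (\<integral>x. \<bar>u x\<bar> \<partial>circ)"
  have I0: "0 \<le> I" by (simp add: I_def)
  have ortV: "(\<integral>x. u x * V (cis x) \<partial>circ) = 0" if V: "continuous_on (sphere 0 1) V" for V :: "complex \<Rightarrow> real"
  proof -
    have iV: "integrable circ (\<lambda>x. u x * V (cis x))"
      by (rule integrable_circ_mult_continuous[OF u continuous_on_circle_cis[OF V]])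
    have "\<bar>\<integral>x. u x * V (cis x) \<partial>circ\<bar> \<le> 0 + e" if e: "e > 0" for e
    proof -
      define d where "d = e / (I + 1)"
      have d: "d > 0" using e I0 by (simp add: d_def)
      obtain g where g: "real_polynomial_function g" "\<And>z. z \<in> sphere 0 1 \<Longrightarrow> \<bar>V z - g z\<bar> < d"
        using Stone_Weierstrass_real_polynomial_function[OF compact_sphere V d] by blast
      have tf: "test_function (\<lambda>x. g (cis x))" by (rule test_function_polynomial[OF g(1)])
      have ig: "integrable circ (\<lambda>x. u x * g (cis x))"
        by (rule integrable_circ_mult_continuous[OF u continuous_test_function[OF tf]])
      have "(\<integral>x. u x * V (cis x) \<partial>circ) = (\<integral>x. u x * V (cis x) - u x * g (cis x) \<partial>circ)"
        using iV ig orth[OF tf] by simp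
      also have "\<bar>\<dots>\<bar> \<le> (\<integral>x. \<bar>u x * V (cis x) - u x * g (cis x)\<bar> \<partial>circ)"
        by (rule integral_abs_bound)
      also have "\<dots> \<le> (\<integral>x. \<bar>u x\<bar> * d \<partial>circ)"
      proof (rule integral_mono)
        fix x
        have "\<bar>V (cis x) - g (cis x)\<bar> \<le> d" using g(2)[of "cis x"] by simp
        then show "\<bar>u x * V (cis x) - u x * g (cis x)\<bar> \<le> \<bar>u x\<bar> * d"
          by (simp add: abs_mult mult_left_mono flip: right_diff_distrib)
      qed (use u iV ig in auto)
      also have "\<dots> = I * d" using u by (simp add: I_def)
      also have "\<dots> \<le> (I + 1) * d" using d by (intro mult_right_mono) auto
      also have "\<dots> = e" using I0 by (simp add: d_def)
      finally show ?thesis by simp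
    qed
    then have "\<bar>\<integral>x. u x * V (cis x) \<partial>circ\<bar> \<le> 0"
      by (rule field_le_epsilon)
    then show ?thesis by simp
  qed
  have "I \<le> 0 + e" if "e > 0" for e
  proof -
    \<comment> \<open>The L^1 distance between u and V is paid twice, and the regularisation of the
      sign costs d per unit length.\<close>
    define d where "d = e / (2 + 2*pi)"
    have d: "d > 0" unfolding d_def using that pi_gt_zero by (intro divide_pos_pos) linarith+
    obtain V where V: "continuous_on (sphere 0 1) V" "(\<integral>x. \<bar>u x - V (cis x)\<bar> \<partial>circ) < d"
      using circle_dense_L1[OF u d] by blast
    \<comment> \<open>A continuous version of the sign of V: adding d avoids division by zero and
      still keeps V v above |V| - d.\<close>
    define v where "v z = V z / (\<bar>V z\<bar> + d)" for z
    have cv: "continuous_on (sphere 0 1) v"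
      unfolding v_def using d
      by (intro continuous_intros V) (metis abs_ge_zero add_nonneg_pos less_irrefl)
    have v1: "\<bar>v z\<bar> \<le> 1" for z
      using d by (simp add: v_def)
    have cV: "continuous_on {0..2*pi} (\<lambda>x. V (cis x))" "continuous_on {0..2*pi} (\<lambda>x. v (cis x))"
      by (auto intro: continuous_on_circle_cis V cv)
    have iV: "integrable circ (\<lambda>x. V (cis x))" by (rule integrable_circ_continuous[OF cV(1)])
    have iVv: "integrable circ (\<lambda>x. V (cis x) * v (cis x))"
      by (intro integrable_circ_continuous continuous_intros cV)
    have iuv: "integrable circ (\<lambda>x. u x * v (cis x))"
      by (rule integrable_circ_mult_continuous[OF u cV(2)])
    have "(\<integral>x. \<bar>V (cis x)\<bar> - d \<partial>circ) \<le> (\<integral>x. V (cis x) * v (cis x) \<partial>circ)"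
    proof (rule integral_mono)
      fix x
      have pos: "\<bar>V (cis x)\<bar> + d > 0" using d by linarith
      have "(\<bar>V (cis x)\<bar> - d) * (\<bar>V (cis x)\<bar> + d) \<le> V (cis x) * V (cis x)"
        by (simp add: algebra_simps)
      then show "\<bar>V (cis x)\<bar> - d \<le> V (cis x) * v (cis x)"
        using pos by (simp add: v_def pos_le_divide_eq)
    qed (use iV iVv in auto)
    also have "\<dots> = (\<integral>x. V (cis x) * v (cis x) - u x * v (cis x) \<partial>circ)"
      using iVv iuv ortV[OF cv] by simp
    also have "\<dots> \<le> (\<integral>x. \<bar>u x - V (cis x)\<bar> \<partial>circ)"
    proof (rule integral_mono)
      fix x
      have "(V (cis x) - u x) * v (cis x) \<le> \<bar>V (cis x) - u x\<bar> * \<bar>v (cis x)\<bar>"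
        by (metis abs_ge_self abs_mult)
      also have "\<dots> \<le> \<bar>V (cis x) - u x\<bar>"
        using v1[of "cis x"] by (simp add: mult_left_le)
      finally show "V (cis x) * v (cis x) - u x * v (cis x) \<le> \<bar>u x - V (cis x)\<bar>"
        by (simp add: algebra_simps abs_minus_commute)
    qed (use u iV iVv iuv in auto)
    also have "\<dots> \<le> d" using V by simp
    finally have "(\<integral>x. \<bar>V (cis x)\<bar> - d \<partial>circ) \<le> d" .
    then have 1: "(\<integral>x. \<bar>V (cis x)\<bar> \<partial>circ) \<le> d + 2*pi*d"
      using iV by simp
    have "I \<le> (\<integral>x. \<bar>u x - V (cis x)\<bar> + \<bar>V (cis x)\<bar> \<partial>circ)"
      unfolding I_def by (rule integral_mono) (use u iV in auto)
    also have "\<dots> = (\<integral>x. \<bar>u x - V (cis x)\<bar> \<partial>circ) + (\<integral>x. \<bar>V (cis x)\<bar> \<partial>circ)"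
      using u iV by simp
    also have "\<dots> \<le> (2 + 2*pi) * d" using 1 V(2) by (simp add: algebra_simps)
    also have "\<dots> = e"
    proof -
      have "2 + 2*pi \<noteq> 0" using pi_gt_zero by linarith
      then show ?thesis by (simp add: d_def)
    qed
    finally show ?thesis by simp
  qed
  then have "I \<le> 0" by (rule field_le_epsilon)
  then have "(\<integral>x. \<bar>u x\<bar> \<partial>circ) = 0" using I0 unfolding I_def by linarith
  then have "AE x in circ. \<bar>u x\<bar> = 0"
    using u by (subst (asm) integral_nonneg_eq_0_iff_AE) auto
  then show ?thesis by eventually_elim simp
qed

subsection \<open>Weak derivatives\<close>

lemma L1_torus_integrable: "f \<in> L1_torus \<Longrightarrow> integrable circ f"
  by (simp add: L1_torus_def integrable_circ_iff)

lemma L2_torus_sqint: "f \<in> L2_torus \<Longrightarrow> sqint f"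
  by (simp add: L2_torus_def sqint_def integrable_circ_iff measurable_circ)

lemma L2_torus_iff: "f \<in> L2_torus \<longleftrightarrow> periodic f \<and> f \<in> borel_measurable borel \<and> sqint f"
  by (auto simp: L2_torus_def sqint_def integrable_circ_iff measurable_circ)

lemma L1_torus_iff: "f \<in> L1_torus \<longleftrightarrow> periodic f \<and> f \<in> borel_measurable borel \<and> integrable circ f"
  by (simp add: L1_torus_def integrable_circ_iff)

lemma L2_norm_eq: "f \<in> L2_torus \<Longrightarrow> L2_norm f = ennreal (sqrt (nsq f))"
  by (simp add: L2_norm_def torus_integral_eq nsq_def)

lemma has_weak_derivD:
  assumes "has_weak_deriv f g"
  shows "integrable circ f" "integrable circ g"
    and "test_function \<psi> \<Longrightarrow> (\<integral>x. f x * deriv \<psi> x \<partial>circ) = - (\<integral>x. g x * \<psi> x \<partial>circ)"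
  using assms by (auto simp: has_weak_deriv_def torus_integral_eq L1_torus_integrable)

lemma has_weak_deriv_unique:
  assumes "has_weak_deriv f g" "has_weak_deriv f g'"
  shows "AE x in circ. g x = g' x"
proof -
  note g = has_weak_derivD[OF assms(1)] and g' = has_weak_derivD[OF assms(2)]
  have "AE x in circ. g x - g' x = 0"
  proof (rule test_function_orthogonal_imp_zero)
    fix \<psi> assume \<psi>: "test_function \<psi>"
    have "integrable circ (\<lambda>x. g x * \<psi> x)" "integrable circ (\<lambda>x. g' x * \<psi> x)"
      by (rule integrable_circ_mult_continuous[OF _ continuous_test_function[OF \<psi>]], fact)+
    then show "(\<integral>x. (g x - g' x) * \<psi> x \<partial>circ) = 0"
      using g(3)[OF \<psi>] g'(3)[OF \<psi>] by (simp add: left_diff_distrib)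
  qed (use g g' in auto)
  then show ?thesis by eventually_elim simp
qed

lemma has_weak_deriv_weak_deriv:
  assumes "has_weak_deriv f g"
  shows "has_weak_deriv f (weak_deriv f)" "AE x in circ. weak_deriv f x = g x"
proof -
  show w: "has_weak_deriv f (weak_deriv f)"
    unfolding weak_deriv_def by (rule someI[of "has_weak_deriv f", OF assms])
  show "AE x in circ. weak_deriv f x = g x"
    using has_weak_deriv_unique[OF w assms] .
qed

lemma has_weak_deriv_mean_zero:
  assumes "has_weak_deriv f g"
  shows "(\<integral>x. g x \<partial>circ) = 0"
  using has_weak_derivD(3)[OF assms test_function_const[of 1]] by simp

text \<open>Cutting off by an indicator instead of changing the interval keeps all integrals over
  \<open>circ\<close>; measurability in x is then that of a parametric integral.\<close>

definition primitive :: "(real \<Rightarrow> 'a::{banach,second_countable_topology}) \<Rightarrow> real \<Rightarrow> 'a" where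
  "primitive f x = (\<integral>t. indicator {..x} t *\<^sub>R f t \<partial>circ)"

lemma integrable_indicator_circ:
  fixes f :: "real \<Rightarrow> 'a::{banach,second_countable_topology}"
  assumes "integrable circ f"
  shows "integrable circ (\<lambda>t. indicator {..x} t *\<^sub>R f t)"
proof (rule Bochner_Integration.integrable_bound[OF assms])
  have "(\<lambda>t. indicat_real {..x} t) \<in> borel_measurable circ"
    by (rule measurable_circ) simp
  then show "(\<lambda>t. indicator {..x} t *\<^sub>R f t) \<in> borel_measurable circ"
    using assms by measurable
qed (auto simp: indicator_def)

lemma primitive_diff:
  fixes f :: "real \<Rightarrow> 'a::{banach,second_countable_topology}"
  assumes "integrable circ f" "integrable circ g"
  shows "primitive (\<lambda>t. f t - g t) x = primitive f x - primitive g x"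
  unfolding primitive_def
  using integrable_indicator_circ[OF assms(1)] integrable_indicator_circ[OF assms(2)]
  by (simp add: scaleR_diff_right)

lemma norm_primitive_le:
  fixes f :: "real \<Rightarrow> 'a::{banach,second_countable_topology}"
  assumes "integrable circ f"
  shows "norm (primitive f x) \<le> (\<integral>t. norm (f t) \<partial>circ)"
proof -
  have "norm (primitive f x) \<le> (\<integral>t. norm (indicator {..x} t *\<^sub>R f t) \<partial>circ)"
    unfolding primitive_def by (rule integral_norm_bound)
  also have "\<dots> \<le> (\<integral>t. norm (f t) \<partial>circ)"
    by (rule integral_mono)
       (use assms integrable_norm[OF integrable_indicator_circ[OF assms]] in \<open>auto simp: indicator_def\<close>)
  finally show ?thesis .
qed

lemma primitive_measurable:
  fixes f :: "real \<Rightarrow> 'a::{banach,second_countable_topology}"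
  assumes [measurable]: "f \<in> borel_measurable circ"
  shows "primitive f \<in> borel_measurable circ"
proof -
  have [measurable]: "(\<lambda>p. indicat_real {..fst p} (snd p)) \<in> borel_measurable (circ \<Otimes>\<^sub>M circ)"
  proof -
    have "(\<lambda>p. if snd p \<le> fst p then 1 else 0 :: real) \<in> borel_measurable (circ \<Otimes>\<^sub>M circ)"
      using measurable_compose[OF measurable_fst id_measurable_circ]
        measurable_compose[OF measurable_snd id_measurable_circ] by measurable
    then show ?thesis
      by (simp add: indicator_def)
  qed
  have "(\<lambda>x. \<integral>t. indicat_real {..x} t *\<^sub>R f t \<partial>circ) \<in> borel_measurable circ"
    by (rule circ.borel_measurable_lebesgue_integral) (simp add: split_beta)
  then show ?thesis by (simp add: primitive_def[abs_def])
qed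

lemma continuous_has_primitive:
  fixes f :: "real \<Rightarrow> real"
  assumes "continuous_on UNIV f"
  obtains F where "\<And>x. (F has_real_derivative f x) (at x)"
proof -
  define F where "F u = (LBINT y=ereal 0..ereal u. f y)" for u
  have "(F has_real_derivative f x) (at x)" for x
  proof -
    define b where "b = \<bar>x\<bar> + 1"
    have "((\<lambda>u. LBINT y=ereal 0..ereal u. f y) has_vector_derivative f x) (at x within {-b..b})"
      by (rule interval_integral_FTC2) (use assms continuous_on_subset in \<open>auto simp: b_def\<close>)
    moreover have "at x within {-b..b} = at x"
      by (rule at_within_interior) (auto simp: b_def)
    ultimately show ?thesis
      unfolding F_def by (simp add: has_real_derivative_iff_has_vector_derivative)
  qed
  then show thesis by (rule that)
qed

text \<open>A vanishing mean is exactly what makes the primitive periodic.\<close>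

lemma test_function_has_primitive:
  assumes "test_function \<eta>" and mean: "(\<integral>x. \<eta> x \<partial>circ) = 0"
  obtains \<psi> where "test_function \<psi>" "deriv \<psi> = \<eta>"
proof -
  obtain F where F: "\<And>x. (F has_real_derivative \<eta> x) (at x)"
    using continuous_has_primitive[OF continuous_test_function[OF assms(1)]] by blast
  have dF: "deriv F = \<eta>" using F by (intro ext DERIV_imp_deriv)
  have per: "\<eta> (x + 2*pi) = \<eta> x" for x
    using assms(1) by (simp add: test_function_def periodic_def)
  have "((\<lambda>x. F (x + 2*pi) - F x) has_real_derivative 0) (at x)" for x
    using DERIV_diff[OF DERIV_shift[THEN iffD1, OF F[of "x + 2*pi"]] F[of x]] per by simp
  then have "F (x + 2*pi) - F x = F (0 + 2*pi) - F 0" for x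
    by (intro DERIV_isconst_all) auto
  moreover have "F (2*pi) - F 0 = 0"
    using integral_circ_FTC[of F \<eta>] F mean continuous_test_function[OF assms(1)]
    by (auto simp: has_real_derivative_iff_has_vector_derivative[symmetric] intro: DERIV_subset)
  ultimately have "periodic F" unfolding periodic_def by simp
  moreover have "smooth_upto n F" for n
  proof (cases n)
    case 0
    then show ?thesis using F by (auto simp: smooth_upto_0 field_differentiable_def)
  next
    case (Suc k)
    then show ?thesis
      using F assms(1) by (auto simp: smooth_upto_Suc field_differentiable_def dF test_function_iff)
  qed
  ultimately show thesis
    using that dF by (auto simp: test_function_iff)
qed

text \<open>The lemma of du Bois-Reymond: a test function minus its mean is the derivative of a test
  function, so w minus its mean is orthogonal to every test function.\<close>

lemma deriv_orthogonal_imp_const: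
  assumes w: "integrable circ w"
    and orth: "\<And>\<psi>. test_function \<psi> \<Longrightarrow> (\<integral>x. w x * deriv \<psi> x \<partial>circ) = 0"
  shows "\<exists>c. AE x in circ. w x = c"
proof -
  define c where "c = (\<integral>x. w x \<partial>circ) / (2*pi)"
  have "AE x in circ. w x - c = 0"
  proof (rule test_function_orthogonal_imp_zero)
    fix \<eta> assume \<eta>: "test_function \<eta>"
    define m where "m = (\<integral>x. \<eta> x \<partial>circ) / (2*pi)"
    have i\<eta>: "integrable circ \<eta>"
      by (rule integrable_circ_continuous[OF continuous_test_function[OF \<eta>]])
    have iw: "integrable circ (\<lambda>x. w x * \<eta> x)"
      by (rule integrable_circ_mult_continuous[OF w continuous_test_function[OF \<eta>]])
    have "test_function (\<lambda>x. \<eta> x + (- m))"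
      by (rule test_function_add[OF \<eta> test_function_const])
    moreover have "(\<integral>x. \<eta> x + (- m) \<partial>circ) = 0"
      using i\<eta> by (simp add: m_def)
    ultimately obtain \<psi> where "test_function \<psi>" "deriv \<psi> = (\<lambda>x. \<eta> x + (- m))"
      by (rule test_function_has_primitive)
    from orth[OF this(1)] this(2) have "(\<integral>x. w x * (\<eta> x - m) \<partial>circ) = 0" by simp
    then have "(\<integral>x. w x * \<eta> x \<partial>circ) = m * (\<integral>x. w x \<partial>circ)"
      using iw w by (simp add: right_diff_distrib mult.commute)
    then show "(\<integral>x. (w x - c) * \<eta> x \<partial>circ) = 0"
      using iw i\<eta> by (simp add: left_diff_distrib c_def m_def)
  qed (use w in simp)
  then have "AE x in circ. w x = c" by eventually_elim simp
  then show ?thesis by blast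
qed

text \<open>S serves two purposes: the identity gives integration by parts for primitives, the sine
  gives the chain rule for the curvature. For continuous q the claim is the fundamental theorem of
  calculus; the Lipschitz bounds on S and S' allow q to be approximated in L^1.\<close>

lemma integral_by_parts_primitive:
  fixes q S S' \<psi> :: "real \<Rightarrow> real"
  assumes q: "integrable circ q" "(\<integral>x. q x \<partial>circ) = 0"
    and S: "\<And>x. (S has_real_derivative S' x) (at x)"
    and lip: "\<And>x y. \<bar>S x - S y\<bar> \<le> \<bar>x - y\<bar>" "\<And>x y. \<bar>S' x - S' y\<bar> \<le> \<bar>x - y\<bar>" "\<And>x. \<bar>S' x\<bar> \<le> 1"
    and \<psi>: "test_function \<psi>"
  shows "(\<integral>x. S (c + primitive q x) * deriv \<psi> x \<partial>circ) = - (\<integral>x. S' (c + primitive q x) * q x * \<psi> x \<partial>circ)"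
proof -
  define \<theta> where "\<theta> x = c + primitive q x" for x
  have [measurable]: "q \<in> borel_measurable circ" using q by auto
  have [measurable]: "\<theta> \<in> borel_measurable circ"
    using primitive_measurable[of q] by (simp add: \<theta>_def[abs_def])
  have cS: "continuous_on UNIV S" using S by (meson DERIV_continuous_on DERIV_subset subset_UNIV)
  have cS': "continuous_on UNIV S'"
    by (rule continuous_onI[of _ S']) (metis lip(2) dist_real_def le_less_trans less_imp_le order_refl)
  have [measurable]: "S \<in> borel_measurable borel" "S' \<in> borel_measurable borel"
    using cS cS' by (auto intro: borel_measurable_continuous_onI)
  note c\<psi> = continuous_test_function[OF \<psi>] and c\<psi>' = continuous_deriv_test_function[OF \<psi>]
  have [measurable]: "\<psi> \<in> borel_measurable circ" "deriv \<psi> \<in> borel_measurable circ"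
    using c\<psi> c\<psi>' continuous_measurable_circ by auto
  obtain B1 where B1: "B1 > 0" "\<And>x. x \<in> {0..2*pi} \<Longrightarrow> \<bar>\<psi> x\<bar> \<le> B1"
    using continuous_circ_bound[OF c\<psi>] by (auto simp: real_norm_def)
  obtain B2 where B2: "B2 > 0" "\<And>x. x \<in> {0..2*pi} \<Longrightarrow> \<bar>deriv \<psi> x\<bar> \<le> B2"
    using continuous_circ_bound[OF c\<psi>'] by (auto simp: real_norm_def)
  define Q where "Q = (\<integral>x. \<bar>q x\<bar> \<partial>circ)"
  have Q0: "0 \<le> Q" by (simp add: Q_def)
  have S\<theta>_int: "integrable circ (\<lambda>x. S (\<theta> x) * deriv \<psi> x)"
  proof (rule integrable_circ_bounded)
    fix x assume x: "x \<in> {0..2*pi}"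
    have "\<bar>\<theta> x\<bar> \<le> \<bar>c\<bar> + Q"
      using norm_primitive_le[OF q(1), of x] by (auto simp: \<theta>_def Q_def)
    then have "\<bar>S (\<theta> x)\<bar> \<le> \<bar>S 0\<bar> + (\<bar>c\<bar> + Q)"
      using lip(1)[of "\<theta> x" 0] by linarith
    then show "norm (S (\<theta> x) * deriv \<psi> x) \<le> (\<bar>S 0\<bar> + (\<bar>c\<bar> + Q)) * B2"
      using B2(2)[OF x] Q0 by (auto simp: abs_mult intro!: mult_mono)
  qed measurable
  have S'\<theta>_int: "integrable circ (\<lambda>x. S' (\<theta> x) * q x * \<psi> x)"
  proof (rule Bochner_Integration.integrable_bound[of _ "\<lambda>x. B1 * \<bar>q x\<bar>"])
    show "AE x in circ. norm (S' (\<theta> x) * q x * \<psi> x) \<le> norm (B1 * \<bar>q x\<bar>)"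
    proof (rule AE_I2)
      fix x assume "x \<in> space circ"
      then have "\<bar>S' (\<theta> x)\<bar> * \<bar>q x\<bar> * \<bar>\<psi> x\<bar> \<le> 1 * \<bar>q x\<bar> * B1"
        using B1(2)[of x] lip(3)[of "\<theta> x"] by (intro mult_mono) auto
      then show "norm (S' (\<theta> x) * q x * \<psi> x) \<le> norm (B1 * \<bar>q x\<bar>)"
        using B1(1) by (simp add: abs_mult mult.commute)
    qed
  qed (use q in auto)
  define D where "D = (\<integral>x. S (\<theta> x) * deriv \<psi> x \<partial>circ) + (\<integral>x. S' (\<theta> x) * q x * \<psi> x \<partial>circ)"
  \<comment> \<open>The errors per unit of d: the first summand comes from the change of S, the
    second from that of q and the third from that of S'.\<close>
  define K where "K = 2*pi * 2*B2 + 2*B1 + B1 * Q * 2"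
  have K: "K > 0" using B1 B2 Q0 by (simp add: K_def add_pos_nonneg)
  have "\<bar>D\<bar> \<le> 0 + e" if e: "e > 0" for e
  proof -
    define d where "d = e / K"
    have d: "d > 0" using e K by (simp add: d_def)
    obtain V where V: "continuous_on (sphere 0 1) V" "(\<integral>x. \<bar>q x - V (cis x)\<bar> \<partial>circ) < d"
      using circle_dense_L1[OF q(1) d] by blast
    \<comment> \<open>Subtracting the mean of V makes the primitive of r periodic, so the boundary
      terms cancel. Since q has mean zero, this costs at most another d.\<close>
    define m where "m = (\<integral>x. V (cis x) \<partial>circ) / (2*pi)"
    define r where "r x = V (cis x) - m" for x
    have cV: "continuous_on T (\<lambda>x. V (cis x))" for T by (rule continuous_on_circle_cis[OF V(1)])
    have iV: "integrable circ (\<lambda>x. V (cis x))" by (rule integrable_circ_continuous[OF cV])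
    have cr: "continuous_on T r" for T unfolding r_def by (intro continuous_intros cV)
    have ir: "integrable circ r" by (rule integrable_circ_continuous[OF cr])
    have mr: "(\<integral>x. r x \<partial>circ) = 0" using iV by (simp add: r_def m_def)
    have "\<bar>\<integral>x. q x - V (cis x) \<partial>circ\<bar> \<le> (\<integral>x. \<bar>q x - V (cis x)\<bar> \<partial>circ)"
      by (rule integral_abs_bound)
    then have m_le: "\<bar>2*pi*m\<bar> \<le> d"
      using V(2) q iV by (simp add: m_def)
    have qr: "(\<integral>x. \<bar>q x - r x\<bar> \<partial>circ) \<le> 2 * d"
    proof -
      have "(\<integral>x. \<bar>q x - r x\<bar> \<partial>circ) \<le> (\<integral>x. \<bar>q x - V (cis x)\<bar> + \<bar>m\<bar> \<partial>circ)"
        by (rule integral_mono) (use q iV ir in \<open>auto simp: r_def\<close>)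
      also have "\<dots> = (\<integral>x. \<bar>q x - V (cis x)\<bar> \<partial>circ) + 2*pi*\<bar>m\<bar>"
        using q iV by simp
      also have "\<dots> \<le> 2 * d" using V(2) m_le by (simp add: abs_mult)
      finally show ?thesis .
    qed
    obtain F0 where F0: "\<And>x. (F0 has_real_derivative r x) (at x)"
      using continuous_has_primitive[OF cr] by blast
    define F where "F x = F0 x + (c - F0 0)" for x
    have F: "(F has_real_derivative r x) (at x)" for x
      unfolding F_def by (auto intro!: derivative_eq_intros F0)
    have Fw: "(F has_vector_derivative r x) (at x within T)" for x T
      using DERIV_subset[OF F[of x] subset_UNIV]
      by (simp add: has_real_derivative_iff_has_vector_derivative)
    have F_eq: "F x = c + primitive r x" if "x \<in> {0..2*pi}" for x
      using integral_circ_FTC_upto[OF Fw cr that] by (simp add: primitive_def F_def)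
    have cF: "continuous_on T F" for T
      using F by (meson DERIV_continuous_on DERIV_subset subset_UNIV)
    have close: "\<bar>F x - \<theta> x\<bar> \<le> 2 * d" if "x \<in> {0..2*pi}" for x
    proof -
      have "F x - \<theta> x = primitive (\<lambda>t. r t - q t) x"
        using F_eq[OF that] primitive_diff[OF ir q(1)] by (simp add: \<theta>_def)
      also have "\<bar>\<dots>\<bar> \<le> (\<integral>t. \<bar>r t - q t\<bar> \<partial>circ)"
        using norm_primitive_le[of "\<lambda>t. r t - q t" x] ir q(1) by simp
      also have "\<dots> \<le> 2 * d" using qr by (simp add: abs_minus_commute)
      finally show ?thesis .
    qed
    have cSF: "continuous_on {0..2*pi} (\<lambda>x. S (F x))" "continuous_on {0..2*pi} (\<lambda>x. S' (F x))"
      by (rule continuous_on_compose2[OF cS cF] continuous_on_compose2[OF cS' cF]; simp)+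
    have SF_int: "integrable circ (\<lambda>x. S (F x) * deriv \<psi> x)" "integrable circ (\<lambda>x. S' (F x) * r x * \<psi> x)"
      by (intro integrable_circ_continuous continuous_intros cSF cr c\<psi> c\<psi>')+
    have F_per: "F (2*pi) = F 0"
      using integral_circ_FTC[OF Fw cr] mr by simp
    have "(\<integral>x. S' (F x) * r x * \<psi> x + S (F x) * deriv \<psi> x \<partial>circ) = S (F (2*pi)) * \<psi> (2*pi) - S (F 0) * \<psi> 0"
    proof (rule integral_circ_FTC)
      fix x
      have "((\<lambda>x. S (F x) * \<psi> x) has_real_derivative (S' (F x) * r x * \<psi> x + S (F x) * deriv \<psi> x)) (at x)"
        using DERIV_mult[OF DERIV_chain2[OF S F] test_function_DERIV[OF \<psi>]] by (simp add: mult_ac add.commute)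
      then show "((\<lambda>x. S (F x) * \<psi> x) has_vector_derivative (S' (F x) * r x * \<psi> x + S (F x) * deriv \<psi> x)) (at x within {0..2*pi})"
        unfolding has_real_derivative_iff_has_vector_derivative[symmetric]
        by (rule DERIV_subset) simp
    qed (intro continuous_intros cSF cr c\<psi> c\<psi>')
    also have "\<dots> = 0"
      using F_per periodic_bounds[of \<psi>] \<psi> by (simp add: test_function_def)
    finally have parts: "(\<integral>x. S (F x) * deriv \<psi> x \<partial>circ) + (\<integral>x. S' (F x) * r x * \<psi> x \<partial>circ) = 0"
      using SF_int by (simp add: add.commute)
    have 1: "\<bar>(\<integral>x. S (\<theta> x) * deriv \<psi> x \<partial>circ) - (\<integral>x. S (F x) * deriv \<psi> x \<partial>circ)\<bar> \<le> 2*pi * (2 * d * B2)"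
    proof -
      have "\<bar>\<integral>x. S (\<theta> x) * deriv \<psi> x - S (F x) * deriv \<psi> x \<partial>circ\<bar>
          \<le> (\<integral>x. \<bar>S (\<theta> x) * deriv \<psi> x - S (F x) * deriv \<psi> x\<bar> \<partial>circ)"
        by (rule integral_abs_bound)
      also have "\<dots> \<le> (\<integral>x. 2 * d * B2 \<partial>circ)"
      proof (rule integral_mono)
        fix x assume "x \<in> space circ"
        then have x: "x \<in> {0..2*pi}" by simp
        have "\<bar>S (\<theta> x) - S (F x)\<bar> * \<bar>deriv \<psi> x\<bar> \<le> 2 * d * B2"
          using lip(1)[of "\<theta> x" "F x"] close[OF x] B2(2)[OF x] d by (intro mult_mono) auto
        then show "\<bar>S (\<theta> x) * deriv \<psi> x - S (F x) * deriv \<psi> x\<bar> \<le> 2 * d * B2"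
          by (simp add: abs_mult flip: left_diff_distrib)
      qed (use S\<theta>_int SF_int in auto)
      finally show ?thesis using S\<theta>_int SF_int by simp
    qed
    have 2: "\<bar>(\<integral>x. S' (\<theta> x) * q x * \<psi> x \<partial>circ) - (\<integral>x. S' (F x) * r x * \<psi> x \<partial>circ)\<bar> \<le> 2 * d * B1 * Q + B1 * (2 * d)"
    proof -
      have "\<bar>\<integral>x. S' (\<theta> x) * q x * \<psi> x - S' (F x) * r x * \<psi> x \<partial>circ\<bar>
          \<le> (\<integral>x. \<bar>S' (\<theta> x) * q x * \<psi> x - S' (F x) * r x * \<psi> x\<bar> \<partial>circ)"
        by (rule integral_abs_bound)
      also have "\<dots> \<le> (\<integral>x. 2 * d * B1 * \<bar>q x\<bar> + B1 * \<bar>q x - r x\<bar> \<partial>circ)"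
      proof (rule integral_mono)
        fix x assume "x \<in> space circ"
        then have x: "x \<in> {0..2*pi}" by simp
        have "S' (\<theta> x) * q x * \<psi> x - S' (F x) * r x * \<psi> x
            = (S' (\<theta> x) - S' (F x)) * \<psi> x * q x + S' (F x) * \<psi> x * (q x - r x)"
          by (simp add: algebra_simps)
        also have "\<bar>\<dots>\<bar> \<le> \<bar>S' (\<theta> x) - S' (F x)\<bar> * \<bar>\<psi> x\<bar> * \<bar>q x\<bar> + \<bar>S' (F x)\<bar> * \<bar>\<psi> x\<bar> * \<bar>q x - r x\<bar>"
          by (metis abs_mult abs_triangle_ineq)
        also have "\<dots> \<le> 2 * d * B1 * \<bar>q x\<bar> + 1 * B1 * \<bar>q x - r x\<bar>"
          using lip(2)[of "\<theta> x" "F x"] lip(3)[of "F x"] close[OF x] B1(2)[OF x] d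
          by (intro add_mono mult_mono) auto
        finally show "\<bar>S' (\<theta> x) * q x * \<psi> x - S' (F x) * r x * \<psi> x\<bar> \<le> 2 * d * B1 * \<bar>q x\<bar> + B1 * \<bar>q x - r x\<bar>"
          by simp
      qed (use S'\<theta>_int SF_int q ir in auto)
      also have "\<dots> = 2 * d * B1 * Q + B1 * (\<integral>x. \<bar>q x - r x\<bar> \<partial>circ)"
        using q ir by (simp add: Q_def)
      also have "\<dots> \<le> 2 * d * B1 * Q + B1 * (2 * d)"
        using qr B1 by (intro add_left_mono mult_left_mono) auto
      finally show ?thesis using S'\<theta>_int SF_int by simp
    qed
    have "\<bar>D\<bar> \<le> 2*pi * (2 * d * B2) + (2 * d * B1 * Q + B1 * (2 * d))"
      using 1 2 parts unfolding D_def by linarith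
    also have "\<dots> = K * d" by (simp add: K_def algebra_simps)
    also have "\<dots> = e" using K by (simp add: d_def)
    finally show ?thesis by simp
  qed
  then have "\<bar>D\<bar> \<le> 0" by (rule field_le_epsilon)
  then show ?thesis by (simp add: D_def \<theta>_def)
qed

text \<open>Integration by parts with S the identity shows that the primitive of q has weak
  derivative q, so its difference from f is constant.\<close>

lemma has_weak_deriv_primitive:
  assumes "has_weak_deriv f q"
  obtains c where "AE x in circ. f x = c + primitive q x"
proof -
  note q = has_weak_derivD[OF assms] and q0 = has_weak_deriv_mean_zero[OF assms]
  have ip: "integrable circ (primitive q)"
  proof (rule integrable_circ_bounded)
    show "primitive q \<in> borel_measurable circ"
      by (rule primitive_measurable) (use q in auto)
  qed (rule norm_primitive_le[OF q(2)])
  have "\<exists>c. AE x in circ. f x - primitive q x = c"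
  proof (rule deriv_orthogonal_imp_const)
    fix \<psi> assume \<psi>: "test_function \<psi>"
    have "integrable circ (\<lambda>x. f x * deriv \<psi> x)" "integrable circ (\<lambda>x. primitive q x * deriv \<psi> x)"
      by (rule integrable_circ_mult_continuous[OF _ continuous_deriv_test_function[OF \<psi>]], fact)+
    moreover have "(\<integral>x. primitive q x * deriv \<psi> x \<partial>circ) = - (\<integral>x. q x * \<psi> x \<partial>circ)"
      using integral_by_parts_primitive[OF q(2) q0, of "\<lambda>x. x" "\<lambda>_. 1" \<psi> 0] \<psi> by simp
    ultimately show "(\<integral>x. (f x - primitive q x) * deriv \<psi> x \<partial>circ) = 0"
      using q(3)[OF \<psi>] by (simp add: left_diff_distrib)
  qed (use q ip in auto)
  then obtain c where "AE x in circ. f x - primitive q x = c" by blast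
  then have "AE x in circ. f x = c + primitive q x" by eventually_elim simp
  then show thesis by (rule that)
qed

text \<open>The lack of a classical derivative is overcome here: f is replaced by an absolutely
  continuous representative, and S is the sine.\<close>

lemma has_weak_deriv_sin:
  assumes w: "has_weak_deriv f q"
  shows "has_weak_deriv (\<lambda>x. sin (f x)) (\<lambda>x. cos (f x) * q x)"
proof -
  note q = has_weak_derivD[OF w] and q0 = has_weak_deriv_mean_zero[OF w]
  have per: "periodic f" "periodic q" and [measurable]: "f \<in> borel_measurable borel" "q \<in> borel_measurable borel"
    using w by (auto simp: has_weak_deriv_def L1_torus_def)
  have [measurable]: "f \<in> borel_measurable circ" "q \<in> borel_measurable circ"
    by (simp_all add: measurable_circ)
  obtain c where c: "AE x in circ. f x = c + primitive q x"
    using has_weak_deriv_primitive[OF w] .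
  have [measurable]: "primitive q \<in> borel_measurable circ" by (rule primitive_measurable) simp
  have "(\<lambda>x. sin (f x)) \<in> L1_torus"
    using per unfolding L1_torus_iff periodic_def
    by (auto intro!: integrable_circ_bounded[of _ 1])
  moreover have "(\<lambda>x. cos (f x) * q x) \<in> L1_torus"
    unfolding L1_torus_iff
  proof (intro conjI)
    show "integrable circ (\<lambda>x. cos (f x) * q x)"
      by (rule Bochner_Integration.integrable_bound[OF q(2)])
         (auto simp: abs_mult intro!: mult_left_le_one_le)
  qed (use per in \<open>auto simp: periodic_def\<close>)
  moreover have "(\<integral>x. sin (f x) * deriv \<psi> x \<partial>circ) = - (\<integral>x. cos (f x) * q x * \<psi> x \<partial>circ)"
    if \<psi>: "test_function \<psi>" for \<psi>
  proof -
    have [measurable]: "\<psi> \<in> borel_measurable circ" "deriv \<psi> \<in> borel_measurable circ"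
      using continuous_test_function[OF \<psi>] continuous_deriv_test_function[OF \<psi>] continuous_measurable_circ by auto
    have sin_lip: "\<bar>sin x - sin y\<bar> \<le> \<bar>x - y\<bar>" and cos_lip: "\<bar>cos x - cos y\<bar> \<le> \<bar>x - y\<bar>" for x y :: real
      using field_differentiable_bound[of UNIV sin cos 1 x y]
        field_differentiable_bound[of UNIV cos "\<lambda>x. - sin x" 1 x y]
      by (auto intro!: DERIV_sin DERIV_cos simp: abs_minus_commute)
    have "(\<integral>x. sin (f x) * deriv \<psi> x \<partial>circ) = (\<integral>x. sin (c + primitive q x) * deriv \<psi> x \<partial>circ)"
      by (rule integral_cong_AE) (use c in \<open>auto elim: eventually_mono\<close>)
    also have "\<dots> = - (\<integral>x. cos (c + primitive q x) * q x * \<psi> x \<partial>circ)"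
      by (rule integral_by_parts_primitive[OF q(2) q0 _ _ _ _ \<psi>])
         (auto intro: DERIV_sin sin_lip cos_lip)
    also have "(\<integral>x. cos (c + primitive q x) * q x * \<psi> x \<partial>circ) = (\<integral>x. cos (f x) * q x * \<psi> x \<partial>circ)"
      by (rule integral_cong_AE) (use c in \<open>auto elim: eventually_mono\<close>)
    finally show ?thesis .
  qed
  ultimately show ?thesis
    by (auto simp: has_weak_deriv_def torus_integral_eq)
qed

subsection \<open>An approximate identity on the circle\<close>

text \<open>The difference of two points of [0, 2pi] lies in [-2pi, 2pi]. Translation by at most one
  period brings it into [-pi, pi], where the sine of the half angle is bounded below
  linearly.\<close>

lemma sin_half_ge:
  fixes t :: real
  assumes "\<bar>t\<bar> \<le> 2*pi"
  shows "\<exists>k\<in>{-1,0,1}. (t + 2*pi*k)\<^sup>2 / 36 \<le> (sin (t/2))\<^sup>2"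
proof -
  have base: "\<bar>t\<bar> / 6 \<le> \<bar>sin (t/2)\<bar>" if "\<bar>t\<bar> \<le> pi" for t :: real
  proof -
    define v where "v = t/2"
    have v: "\<bar>v\<bar> \<le> 2" using that pi_less_4 by (simp add: v_def)
    \<comment> \<open>Since pi < 4, |v| is at most 2 and the cubic remainder is at most 2|v|/3. What
      remains is |v|/3 = |t|/6, the origin of the constant 36.\<close>
    have "\<bar>sin v - v\<bar> \<le> \<bar>v\<bar>^3 / 6"
    proof -
      have "(\<Sum>m<3. sin_coeff m * v ^ m) = v" by (simp add: numeral_3_eq_3 sin_coeff_def)
      moreover have "fact 3 = (6::real)" by (simp add: fact_numeral)
      ultimately show ?thesis
        using Maclaurin_sin_bound[of v 3] by (simp only: divide_inverse mult.commute)
    qed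
    also have "\<dots> \<le> \<bar>v\<bar> * (2/3)"
    proof -
      have "\<bar>v\<bar> * \<bar>v\<bar> \<le> 2 * 2" using v by (intro mult_mono) auto
      from mult_left_mono[OF this, of "\<bar>v\<bar>"] show ?thesis by (simp add: eval_nat_numeral)
    qed
    finally have "\<bar>v\<bar> / 3 \<le> \<bar>sin v\<bar>" by linarith
    then show ?thesis by (simp add: v_def)
  qed
  have sq: "s\<^sup>2 / 36 \<le> (sin (s/2))\<^sup>2" if "\<bar>s\<bar> \<le> pi" for s :: real
  proof -
    have "(\<bar>s\<bar>/6)\<^sup>2 \<le> \<bar>sin (s/2)\<bar>\<^sup>2"
      using base[OF that] by (intro power_mono) auto
    then show ?thesis by (simp add: power_divide)
  qed
  have shift: "(sin ((t + 2*pi*k)/2))\<^sup>2 = (sin (t/2))\<^sup>2" if "k \<in> {-1,0,1}" for k :: real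
  proof -
    have "sin ((t + 2*pi)/2) = - sin (t/2)" "sin ((t - 2*pi)/2) = - sin (t/2)"
      by (simp_all add: add_divide_distrib diff_divide_distrib sin_add sin_diff)
    then show ?thesis using that by auto
  qed
  consider "\<bar>t\<bar> \<le> pi" | "t > pi" | "t < - pi" by linarith
  then show ?thesis
  proof cases
    case 1
    then show ?thesis using sq[of t] by (intro bexI[of _ 0]) auto
  next
    case 2
    then show ?thesis using sq[of "t + 2*pi*(-1)"] shift[of "-1"] assms by (intro bexI[of _ "-1"]) auto
  next
    case 3
    then show ?thesis using sq[of "t + 2*pi*1"] shift[of 1] assms by (intro bexI[of _ 1]) auto
  qed
qed

text \<open>A periodic substitute for the Poisson kernel at height \<epsilon>; the sine of the half
  angle measures the distance on the circle.\<close>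

definition kernel_majorant :: "real \<Rightarrow> real \<Rightarrow> real \<Rightarrow> real" where
  "kernel_majorant \<epsilon> x y = \<epsilon> / (\<epsilon>\<^sup>2 + (sin ((x - y)/2))\<^sup>2)"

lemma kernel_majorant_commute: "kernel_majorant \<epsilon> x y = kernel_majorant \<epsilon> y x"
proof -
  have "sin ((x - y)/2) = - sin ((y - x)/2)"
    by (metis minus_diff_eq minus_divide_left sin_minus)
  then show ?thesis by (simp add: kernel_majorant_def)
qed

lemma kernel_majorant_pos: "\<epsilon> > 0 \<Longrightarrow> kernel_majorant \<epsilon> x y > 0"
  by (simp add: kernel_majorant_def add_pos_nonneg)

lemma kernel_majorant_le: "\<epsilon> > 0 \<Longrightarrow> kernel_majorant \<epsilon> x y \<le> 1 / \<epsilon>"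
proof -
  assume e: "\<epsilon> > 0"
  have "\<epsilon> / (\<epsilon>\<^sup>2 + (sin ((x - y)/2))\<^sup>2) \<le> \<epsilon> / \<epsilon>\<^sup>2"
    using e by (intro divide_left_mono) (auto intro!: mult_pos_pos add_pos_nonneg)
  also have "\<dots> = 1 / \<epsilon>" using e by (simp add: power2_eq_square)
  finally show ?thesis by (simp add: kernel_majorant_def)
qed

text \<open>Weighted by the squared distance, the kernel is O(\<epsilon>), which disposes of the
  points away from the diagonal. \<open>circle_modulus_of_continuity\<close> is phrased so as to use
  this.\<close>

lemma kernel_majorant_sin:
  assumes "\<epsilon> > 0"
  shows "kernel_majorant \<epsilon> x y * (sin ((x - y)/2))\<^sup>2 \<le> \<epsilon>"
proof -
  have "\<epsilon> * (sin ((x - y)/2))\<^sup>2 \<le> \<epsilon> * (\<epsilon>\<^sup>2 + (sin ((x - y)/2))\<^sup>2)"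
    using assms by simp
  then show ?thesis
    using assms by (simp add: kernel_majorant_def add_pos_nonneg pos_divide_le_eq)
qed

lemma fst_snd_measurable_circ:
  "(\<lambda>p. fst p) \<in> borel_measurable (circ \<Otimes>\<^sub>M circ)" "(\<lambda>p. snd p) \<in> borel_measurable (circ \<Otimes>\<^sub>M circ)"
  using measurable_compose[OF measurable_fst id_measurable_circ]
    measurable_compose[OF measurable_snd id_measurable_circ] by auto

lemma kernel_majorant_measurable [measurable]:
  "(\<lambda>p. kernel_majorant \<epsilon> (fst p) (snd p)) \<in> borel_measurable (circ \<Otimes>\<^sub>M circ)"
  unfolding kernel_majorant_def using fst_snd_measurable_circ by measurable

lemma kernel_majorant_continuous: "\<epsilon> > 0 \<Longrightarrow> continuous_on S (kernel_majorant \<epsilon> x)"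
  unfolding kernel_majorant_def
  by (intro continuous_intros) (auto simp: add_pos_nonneg less_imp_neq[symmetric] sum_power2_eq_zero_iff)

lemma integrable_kernel_majorant: "\<epsilon> > 0 \<Longrightarrow> integrable circ (kernel_majorant \<epsilon> x)"
  by (rule integrable_circ_continuous[OF kernel_majorant_continuous])

text \<open>Three translates of a Cauchy density on the line dominate the kernel. The integral of
  each is a difference of two values of 6 arctan, hence at most 6 pi.\<close>

lemma integral_kernel_majorant_le:
  assumes e: "\<epsilon> > 0" and x: "x \<in> {0..2*pi}"
  shows "(\<integral>y. kernel_majorant \<epsilon> x y \<partial>circ) \<le> 18*pi"
proof -
  define j where "j k y = \<epsilon> / (\<epsilon>\<^sup>2 + ((x - y) + 2*pi*k)\<^sup>2/36)" for k y
  have pos: "\<epsilon>\<^sup>2 + s\<^sup>2/36 > 0" for s using e by (simp add: add_pos_nonneg)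
  have jc: "continuous_on {0..2*pi} (j k)" for k
    unfolding j_def using pos by (intro continuous_intros) (auto simp: less_imp_neq[symmetric])
  then have ji: "integrable circ (j k)" for k by (rule integrable_circ_continuous)
  have j0: "j k y \<ge> 0" for k y using pos e by (simp add: j_def less_imp_le)
  have jint: "(\<integral>y. j k y \<partial>circ) \<le> 6*pi" for k
  proof -
    define F where "F y = - 6 * arctan (((x - y) + 2*pi*k)/(6*\<epsilon>))" for y
    have "(F has_real_derivative j k y) (at y)" for y
    proof -
      have "\<epsilon> / (\<epsilon>\<^sup>2 + s\<^sup>2/36) = 1 / (1 + (s/(6*\<epsilon>))\<^sup>2) / \<epsilon>" for s
      proof -
        have "\<epsilon>\<^sup>2 + s\<^sup>2/36 = \<epsilon>\<^sup>2 * (1 + (s/(6*\<epsilon>))\<^sup>2)"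
          using e by (simp add: field_simps power2_eq_square)
        then show ?thesis using e by (simp add: power2_eq_square)
      qed
      note eq = this[of "(x - y) + 2*pi*k"]
      have "((\<lambda>y. ((x - y) + 2*pi*k)/(6*\<epsilon>)) has_real_derivative (- 1 / (6*\<epsilon>))) (at y)"
        using e by (auto intro!: derivative_eq_intros)
      from DERIV_cmult[OF DERIV_chain2[OF DERIV_arctan this], of "-6"]
      have "(F has_real_derivative - 6 * (inverse (1 + (((x - y) + 2*pi*k)/(6*\<epsilon>))\<^sup>2) * (- 1 / (6*\<epsilon>)))) (at y)"
        by (simp only: F_def[abs_def])
      moreover have "- 6 * (X * (- 1 / (6*\<epsilon>))) = X / \<epsilon>" for X :: real
        using e by (simp add: field_simps)
      ultimately show ?thesis
        by (simp only: j_def eq inverse_eq_divide)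
    qed
    then have "(\<integral>y. j k y \<partial>circ) = F (2*pi) - F 0"
      by (intro integral_circ_FTC jc)
         (auto simp: has_real_derivative_iff_has_vector_derivative[symmetric] intro: DERIV_subset)
    also have "\<dots> \<le> 6*pi"
      unfolding F_def using arctan_bounded[of "((x - 2*pi) + 2*pi*k)/(6*\<epsilon>)"] arctan_bounded[of "((x - 0) + 2*pi*k)/(6*\<epsilon>)"]
      by linarith
    finally show ?thesis .
  qed
  have "(\<integral>y. kernel_majorant \<epsilon> x y \<partial>circ) \<le> (\<integral>y. j (-1) y + j 0 y + j 1 y \<partial>circ)"
  proof (rule integral_mono)
    fix y assume "y \<in> space circ"
    then have "\<bar>x - y\<bar> \<le> 2*pi" using x by auto
    then obtain k where k: "k \<in> {-1,0,1}" "((x - y) + 2*pi*k)\<^sup>2/36 \<le> (sin ((x - y)/2))\<^sup>2"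
      using sin_half_ge by blast
    have "kernel_majorant \<epsilon> x y \<le> j k y"
      unfolding kernel_majorant_def j_def using e k(2) pos
      by (intro divide_left_mono) (auto intro!: mult_pos_pos add_pos_nonneg)
    also have "\<dots> \<le> j (-1) y + j 0 y + j 1 y"
      using k(1) j0[of "-1" y] j0[of 0 y] j0[of 1 y] by auto
    finally show "kernel_majorant \<epsilon> x y \<le> j (-1) y + j 0 y + j 1 y" .
  qed (use ji integrable_kernel_majorant[OF e] in auto)
  also have "\<dots> \<le> 18*pi"
    using ji jint[of "-1"] jint[of 0] jint[of 1] by simp
  finally show ?thesis .
qed

interpretation circ2: pair_sigma_finite circ circ ..

text \<open>This is Schur's test.\<close>

lemma kernel_majorant_L2:
  fixes f :: "real \<Rightarrow> real"
  assumes e: "\<epsilon> > 0" and f: "sqint f"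
  shows "sqint (\<lambda>x. \<integral>y. kernel_majorant \<epsilon> x y * \<bar>f y\<bar> \<partial>circ)"
    and "nsq (\<lambda>x. \<integral>y. kernel_majorant \<epsilon> x y * \<bar>f y\<bar> \<partial>circ) \<le> (18*pi)\<^sup>2 * nsq f"
proof -
  let ?m = "kernel_majorant \<epsilon>"
  have [measurable]: "f \<in> borel_measurable circ" using f by (rule sqint_measurable)
  have [measurable]: "?m x \<in> borel_measurable circ" for x
    using integrable_kernel_majorant[OF e] by auto
  have m0: "0 \<le> ?m x y" for x y using kernel_majorant_pos[OF e] less_imp_le by blast
  define T where "T x = (\<integral>y. ?m x y * \<bar>f y\<bar> \<partial>circ)" for x
  have [measurable]: "T \<in> borel_measurable circ"
    unfolding T_def by (rule circ.borel_measurable_lebesgue_integral) (simp add: split_beta)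
  have if1: "integrable circ (\<lambda>y. ?m x y * (f y)\<^sup>2)" for x
  proof (rule Bochner_Integration.integrable_bound)
    show "integrable circ (\<lambda>y. (1/\<epsilon>) * (f y)\<^sup>2)" using f by (simp add: sqint_def)
    show "AE y in circ. norm (?m x y * (f y)\<^sup>2) \<le> norm ((1/\<epsilon>) * (f y)\<^sup>2)"
    proof (rule AE_I2)
      fix y
      have "?m x y * (f y)\<^sup>2 \<le> (1/\<epsilon>) * (f y)\<^sup>2"
        by (rule mult_right_mono[OF kernel_majorant_le[OF e]]) simp
      then show "norm (?m x y * (f y)\<^sup>2) \<le> norm ((1/\<epsilon>) * (f y)\<^sup>2)"
        using m0[of x y] e by (simp add: abs_mult)
    qed
  qed simp
  have T_sq: "(T x)\<^sup>2 \<le> 18*pi * (\<integral>y. ?m x y * (f y)\<^sup>2 \<partial>circ)" if x: "x \<in> {0..2*pi}" for x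
  proof -
    have "(\<integral>y. \<bar>sqrt (?m x y) * (sqrt (?m x y) * \<bar>f y\<bar>)\<bar> \<partial>circ)\<^sup>2
        \<le> (\<integral>y. (sqrt (?m x y))\<^sup>2 \<partial>circ) * (\<integral>y. (sqrt (?m x y) * \<bar>f y\<bar>)\<^sup>2 \<partial>circ)"
    proof (rule integral_Cauchy_Schwarz)
      show "integrable circ (\<lambda>y. (sqrt (?m x y))\<^sup>2)"
        using integrable_kernel_majorant[OF e] m0 by simp
      show "integrable circ (\<lambda>y. (sqrt (?m x y) * \<bar>f y\<bar>)\<^sup>2)"
        using if1 m0 by (simp add: power_mult_distrib)
    qed simp_all
    moreover have "\<bar>sqrt (?m x y) * (sqrt (?m x y) * \<bar>f y\<bar>)\<bar> = ?m x y * \<bar>f y\<bar>" for y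
      using m0[of x y] by (simp add: abs_mult flip: mult.assoc)
    ultimately have "(T x)\<^sup>2 \<le> (\<integral>y. ?m x y \<partial>circ) * (\<integral>y. ?m x y * (f y)\<^sup>2 \<partial>circ)"
      using m0 by (simp add: T_def power_mult_distrib)
    also have "\<dots> \<le> 18*pi * (\<integral>y. ?m x y * (f y)\<^sup>2 \<partial>circ)"
      using integral_kernel_majorant_le[OF e x] m0
      by (intro mult_right_mono) auto
    finally show ?thesis .
  qed
  have [measurable]: "(\<lambda>p. f (snd p)) \<in> borel_measurable (circ \<Otimes>\<^sub>M circ)"
    by (rule measurable_compose[OF measurable_snd]) simp
  define G where "G x = (\<integral>y. ?m x y * (f y)\<^sup>2 \<partial>circ)" for x
  have [measurable]: "G \<in> borel_measurable circ"
    unfolding G_def by (rule circ.borel_measurable_lebesgue_integral) (simp add: split_beta)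
  have Gi: "integrable circ G"
  proof (rule integrable_circ_bounded)
    fix x
    have "\<bar>G x\<bar> = G x" by (simp add: G_def m0)
    also have "G x \<le> (\<integral>y. (1/\<epsilon>) * (f y)\<^sup>2 \<partial>circ)"
      unfolding G_def
    proof (rule integral_mono[OF if1])
      show "integrable circ (\<lambda>y. (1/\<epsilon>) * (f y)\<^sup>2)" using f by (simp add: sqint_def)
    qed (rule mult_right_mono[OF kernel_majorant_le[OF e] zero_le_power2])
    finally show "norm (G x) \<le> (\<integral>y. (1/\<epsilon>) * (f y)\<^sup>2 \<partial>circ)" by simp
  qed simp
  have prod: "integrable (circ \<Otimes>\<^sub>M circ) (\<lambda>(x, y). ?m x y * (f y)\<^sup>2)"
  proof (rule circ2.Fubini_integrable)
    show "integrable circ (\<lambda>x. \<integral>y. norm (case (x, y) of (x, y) \<Rightarrow> ?m x y * (f y)\<^sup>2) \<partial>circ)"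
      using Gi m0 by (simp add: G_def[abs_def])
    show "AE x in circ. integrable circ (\<lambda>y. case (x, y) of (x, y) \<Rightarrow> ?m x y * (f y)\<^sup>2)"
      using if1 by simp
  qed (simp add: split_beta)
  have "(\<integral>x. G x \<partial>circ) = (\<integral>y. (\<integral>x. ?m x y * (f y)\<^sup>2 \<partial>circ) \<partial>circ)"
    unfolding G_def using circ2.Fubini_integral[OF prod] by simp
  also have "\<dots> \<le> (\<integral>y. 18*pi * (f y)\<^sup>2 \<partial>circ)"
  proof (rule integral_mono)
    show "integrable circ (\<lambda>y. \<integral>x. ?m x y * (f y)\<^sup>2 \<partial>circ)"
      using circ2.integrable_snd[OF prod] by simp
    fix y assume "y \<in> space circ"
    then show "(\<integral>x. ?m x y * (f y)\<^sup>2 \<partial>circ) \<le> 18*pi * (f y)\<^sup>2"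
      using integral_kernel_majorant_le[OF e, of y]
      by (subst kernel_majorant_commute) (auto intro!: mult_right_mono)
  qed (use f in \<open>simp add: sqint_def\<close>)
  also have "\<dots> = 18*pi * nsq f" using f by (simp add: sqint_def nsq_def)
  finally have GI: "(\<integral>x. G x \<partial>circ) \<le> 18*pi * nsq f" .
  have iT: "integrable circ (\<lambda>x. (T x)\<^sup>2)"
  proof (rule Bochner_Integration.integrable_bound)
    show "integrable circ (\<lambda>x. 18*pi * G x)" using Gi by simp
    show "AE x in circ. norm ((T x)\<^sup>2) \<le> norm (18*pi * G x)"
    proof (rule AE_I2)
      fix x assume "x \<in> space circ"
      then have "(T x)\<^sup>2 \<le> 18*pi * G x" using T_sq[of x] by (simp add: G_def)
      then show "norm ((T x)\<^sup>2) \<le> norm (18*pi * G x)" by simp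
    qed
  qed simp
  then show "sqint (\<lambda>x. \<integral>y. kernel_majorant \<epsilon> x y * \<bar>f y\<bar> \<partial>circ)"
    by (simp add: sqint_def T_def[abs_def, symmetric])
  have "(\<integral>x. (T x)\<^sup>2 \<partial>circ) \<le> (\<integral>x. 18*pi * G x \<partial>circ)"
    by (rule integral_mono[OF iT]) (use Gi T_sq[folded G_def] in auto)
  also have "\<dots> \<le> 18*pi * (18*pi * nsq f)"
    using GI by simp
  finally show "nsq (\<lambda>x. \<integral>y. kernel_majorant \<epsilon> x y * \<bar>f y\<bar> \<partial>circ) \<le> (18*pi)\<^sup>2 * nsq f"
    by (simp add: nsq_def T_def[abs_def, symmetric] power2_eq_square)
qed

text \<open>Uniform continuity as a global inequality: for points at distance at least d the bound
  2B is absorbed by a multiple of the squared distance \<open>4 * (sin ((x - y)/2))\<^sup>2\<close>,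
  whence C = 8B/d^2. The quadratic form is dictated by \<open>kernel_majorant_sin\<close>.\<close>

lemma circle_modulus_of_continuity:
  fixes V :: "complex \<Rightarrow> 'a::real_normed_vector"
  assumes V: "continuous_on (sphere 0 1) V" and e: "e > 0"
  obtains C where "C \<ge> 0" "\<And>x y. norm (V (cis y) - V (cis x)) \<le> e + C * (sin ((x - y)/2))\<^sup>2"
proof -
  have "uniformly_continuous_on (sphere 0 1) V"
    by (rule compact_uniformly_continuous[OF V]) simp
  from this[unfolded uniformly_continuous_on_def, rule_format, OF e]
  obtain d where d: "d > 0" "\<forall>z\<in>sphere 0 1. \<forall>w\<in>sphere 0 1. dist w z < d \<longrightarrow> dist (V w) (V z) < e"
    by blast
  have "bounded (V ` sphere 0 1)"
    by (rule compact_imp_bounded[OF compact_continuous_image[OF V compact_sphere]])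
  then obtain B where B: "B > 0" "\<And>z. z \<in> sphere 0 1 \<Longrightarrow> norm (V z) \<le> B"
    unfolding bounded_pos by auto
  show thesis
  proof (rule that)
    show "8 * B / d\<^sup>2 \<ge> 0" using B by simp
    fix x y :: real
    have dist: "(dist (cis y) (cis x))\<^sup>2 = 4 * (sin ((x - y)/2))\<^sup>2"
    proof -
      have "(dist (cis y) (cis x))\<^sup>2 = (cos y - cos x)\<^sup>2 + (sin y - sin x)\<^sup>2"
        by (simp add: dist_norm cmod_power2)
      also have "\<dots> = 2 - 2 * cos (x - y)"
        using sin_cos_squared_add[of x] sin_cos_squared_add[of y]
        by (simp add: cos_diff power2_eq_square algebra_simps)
      also have "cos (x - y) = 1 - 2 * (sin ((x - y)/2))\<^sup>2"
      proof -
        have "2 * ((x - y)/2) = x - y" by simp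
        then show ?thesis using cos_double_sin[of "(x - y)/2"] by (simp only:)
      qed
      finally show ?thesis by simp
    qed
    show "norm (V (cis y) - V (cis x)) \<le> e + 8 * B / d\<^sup>2 * (sin ((x - y)/2))\<^sup>2"
    proof (cases "dist (cis y) (cis x) < d")
      case True
      then have "norm (V (cis y) - V (cis x)) \<le> e"
        using d(2)[rule_format, of "cis x" "cis y"] by (simp add: dist_norm)
      moreover have "0 \<le> 8 * B / d\<^sup>2 * (sin ((x - y)/2))\<^sup>2" using B by simp
      ultimately show ?thesis by linarith
    next
      case False
      then have "d\<^sup>2 \<le> 4 * (sin ((x - y)/2))\<^sup>2"
        unfolding dist[symmetric] using d(1) by (intro power_mono) auto
      then have "2 * B \<le> 8 * B / d\<^sup>2 * (sin ((x - y)/2))\<^sup>2"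
        using d(1) B(1) by (simp add: field_simps)
      moreover have "norm (V (cis y) - V (cis x)) \<le> 2 * B"
        using norm_triangle_ineq4[of "V (cis y)" "V (cis x)"] B(2)[of "cis x"] B(2)[of "cis y"] by simp
      ultimately show ?thesis using e by linarith
    qed
  qed
qed

text \<open>Schur's test bounds the operators on L^2 uniformly in \<epsilon>, so a dense class
  suffices; for continuous functions on the circle the convergence is even uniform. The kernel is
  complex, so its majorant takes the place of positivity.\<close>

lemma approximate_identity:
  fixes k :: "real \<Rightarrow> real \<Rightarrow> real \<Rightarrow> complex" and u :: "real \<Rightarrow> complex"
  assumes k_meas: "\<And>\<epsilon>. (\<lambda>p. k \<epsilon> (fst p) (snd p)) \<in> borel_measurable (circ \<Otimes>\<^sub>M circ)"
    and A: "A > 0"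
    and bound: "\<And>\<epsilon> x y. 0 < \<epsilon> \<Longrightarrow> \<epsilon> < 1 \<Longrightarrow> x \<in> {0..2*pi} \<Longrightarrow> y \<in> {0..2*pi} \<Longrightarrow>
        norm (k \<epsilon> x y) \<le> A * kernel_majorant \<epsilon> x y"
    and one: "\<And>\<epsilon> x. 0 < \<epsilon> \<Longrightarrow> \<epsilon> < 1 \<Longrightarrow> x \<in> {0..2*pi} \<Longrightarrow> (\<integral>y. k \<epsilon> x y \<partial>circ) = 1"
    and u: "sqint u"
  shows "((\<lambda>\<epsilon>. nsq (\<lambda>x. (\<integral>y. k \<epsilon> x y * u y \<partial>circ) - u x)) \<longlongrightarrow> 0) (at_right 0)"
proof -
  have k_meas1: "k \<epsilon> x \<in> borel_measurable circ" if "x \<in> {0..2*pi}" for \<epsilon> x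
  proof -
    have "(\<lambda>y. k \<epsilon> (fst (x, y)) (snd (x, y))) \<in> borel_measurable circ"
      by (rule measurable_compose[OF measurable_Pair1' k_meas]) (use that in simp)
    then show ?thesis by simp
  qed
  define B where "B = 18*pi"
  have B: "B > 0" by (simp add: B_def)
  have dom: "integrable circ (\<lambda>y. k \<epsilon> x y * w y)"
    "norm (\<integral>y. k \<epsilon> x y * w y \<partial>circ) \<le> A * (\<integral>y. kernel_majorant \<epsilon> x y * \<bar>norm (w y)\<bar> \<partial>circ)"
    if e: "0 < \<epsilon>" "\<epsilon> < 1" and x: "x \<in> {0..2*pi}" and w: "sqint w" for \<epsilon> x and w :: "real \<Rightarrow> complex"
  proof -
    have [measurable]: "k \<epsilon> x \<in> borel_measurable circ" "w \<in> borel_measurable circ"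
      using k_meas1[OF x] w by (auto simp: sqint_def)
    have nw: "integrable circ (\<lambda>y. norm (w y))" using sqint_L1(1)[OF w] by simp
    have i: "integrable circ (\<lambda>y. norm (w y) * kernel_majorant \<epsilon> x y)"
      by (rule integrable_circ_mult_continuous[OF nw kernel_majorant_continuous[OF e(1)]])
    then have i: "integrable circ (\<lambda>y. A * (kernel_majorant \<epsilon> x y * \<bar>norm (w y)\<bar>))"
      by (simp add: mult.commute)
    have le: "norm (k \<epsilon> x y * w y) \<le> A * (kernel_majorant \<epsilon> x y * \<bar>norm (w y)\<bar>)" if "y \<in> space circ" for y
      using mult_right_mono[OF bound[OF e x], of y "norm (w y)"] that by (simp add: norm_mult mult.assoc)
    show "integrable circ (\<lambda>y. k \<epsilon> x y * w y)"
    proof (rule Bochner_Integration.integrable_bound[OF i])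
      show "AE y in circ. norm (k \<epsilon> x y * w y) \<le> norm (A * (kernel_majorant \<epsilon> x y * \<bar>norm (w y)\<bar>))"
        unfolding real_norm_def[of "A * _"] by (intro AE_I2 order_trans[OF le abs_ge_self])
    qed simp
    then have "norm (\<integral>y. k \<epsilon> x y * w y \<partial>circ) \<le> (\<integral>y. A * (kernel_majorant \<epsilon> x y * \<bar>norm (w y)\<bar>) \<partial>circ)"
      by (rule Bochner_Integration.integral_norm_bound_integral[OF _ i le])
    then show "norm (\<integral>y. k \<epsilon> x y * w y \<partial>circ) \<le> A * (\<integral>y. kernel_majorant \<epsilon> x y * \<bar>norm (w y)\<bar> \<partial>circ)"
      by simp
  qed
  have K_meas: "(\<lambda>x. \<integral>y. k \<epsilon> x y * w y \<partial>circ) \<in> borel_measurable circ" if "sqint w" for \<epsilon> w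
  proof -
    have [measurable]: "w \<in> borel_measurable circ" using that by (rule sqint_measurable)
    have "(\<lambda>p. w (snd p)) \<in> borel_measurable (circ \<Otimes>\<^sub>M circ)"
      by (rule measurable_compose[OF measurable_snd]) simp
    then show ?thesis
      using k_meas[of \<epsilon>] by (intro circ.borel_measurable_lebesgue_integral) (simp add: split_beta)
  qed
  have op: "sqint (\<lambda>x. \<integral>y. k \<epsilon> x y * w y \<partial>circ)" "nsq (\<lambda>x. \<integral>y. k \<epsilon> x y * w y \<partial>circ) \<le> A\<^sup>2 * (B\<^sup>2 * nsq w)"
    if e: "0 < \<epsilon>" "\<epsilon> < 1" and w: "sqint w" for \<epsilon> w
  proof -
    have nw: "sqint (\<lambda>y. norm (w y))" using w by (auto simp: sqint_def)
    note L2 = kernel_majorant_L2[OF e(1) nw]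
    have ae: "AE x in circ. norm (\<integral>y. k \<epsilon> x y * w y \<partial>circ) \<le> A * norm (\<integral>y. kernel_majorant \<epsilon> x y * \<bar>norm (w y)\<bar> \<partial>circ)"
    proof (rule AE_I2)
      fix x assume "x \<in> space circ"
      then have "norm (\<integral>y. k \<epsilon> x y * w y \<partial>circ) \<le> A * (\<integral>y. kernel_majorant \<epsilon> x y * \<bar>norm (w y)\<bar> \<partial>circ)"
        using dom(2)[OF e _ w] by simp
      also have "\<dots> \<le> A * norm (\<integral>y. kernel_majorant \<epsilon> x y * \<bar>norm (w y)\<bar> \<partial>circ)"
        using A by (intro mult_left_mono) auto
      finally show "norm (\<integral>y. k \<epsilon> x y * w y \<partial>circ) \<le> A * norm (\<integral>y. kernel_majorant \<epsilon> x y * \<bar>norm (w y)\<bar> \<partial>circ)" .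
    qed
    define T where "T x = (\<integral>y. kernel_majorant \<epsilon> x y * \<bar>norm (w y)\<bar> \<partial>circ)" for x
    have sT: "sqint T" "nsq T \<le> B\<^sup>2 * nsq (\<lambda>y. norm (w y))"
      using L2 by (simp_all add: T_def[abs_def] B_def)
    have sT': "sqint (\<lambda>x. of_real (T x) :: complex)" "nsq (\<lambda>x. of_real (T x) :: complex) = nsq T"
      using sT by (simp_all add: sqint_of_real nsq_of_real)
    have ae': "AE x in circ. norm (\<integral>y. k \<epsilon> x y * w y \<partial>circ) \<le> A * norm (of_real (T x) :: complex)"
      using ae by (simp add: T_def)
    show "sqint (\<lambda>x. \<integral>y. k \<epsilon> x y * w y \<partial>circ)"
      by (rule sqint_dominated(1)[OF K_meas[OF w] sT'(1) ae'])
    have "nsq (\<lambda>x. \<integral>y. k \<epsilon> x y * w y \<partial>circ) \<le> A\<^sup>2 * nsq T"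
      using sqint_dominated(2)[OF K_meas[OF w] sT'(1) ae'] sT'(2) by simp
    also have "\<dots> \<le> A\<^sup>2 * (B\<^sup>2 * nsq w)"
      using sT(2) by (intro mult_left_mono) (auto simp: nsq_def)
    finally show "nsq (\<lambda>x. \<integral>y. k \<epsilon> x y * w y \<partial>circ) \<le> A\<^sup>2 * (B\<^sup>2 * nsq w)" .
  qed
  have main: "\<forall>\<^sub>F \<epsilon> in at_right 0. nsq (\<lambda>x. (\<integral>y. k \<epsilon> x y * u y \<partial>circ) - u x) < \<eta>" if \<eta>: "\<eta> > 0" for \<eta>
  proof -
    \<comment> \<open>The remainder r contributes at most 4 (A^2 B^2 + 1) \<open>nsq r\<close>,
      hence less than half of \<eta>.\<close>
    define \<delta> where "\<delta> = \<eta> / (8 * (A\<^sup>2 * B\<^sup>2 + 1))"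
    have AB: "A\<^sup>2 * B\<^sup>2 + 1 > 0" by (simp add: add_nonneg_pos)
    have \<delta>: "\<delta> > 0" using \<eta> AB by (simp add: \<delta>_def)
    obtain V where V: "continuous_on (sphere 0 1) V" "nsq (\<lambda>x. u x - V (cis x)) < \<delta>"
      using circle_dense_complex[OF u \<delta>] by blast
    define r where "r x = u x - V (cis x)" for x
    have sV: "sqint (\<lambda>x. V (cis x))" by (rule sqint_circle[OF V(1)])
    have sr: "sqint r" "nsq r < \<delta>"
      using sqint_diff(1)[OF u sV] V(2) by (simp_all add: r_def[abs_def])
    \<comment> \<open>For the continuous part the pointwise error 2ABe, squared, integrated over the
      period and doubled by \<open>sqint_add\<close>, is c e^2, which is to stay below
      \<eta>/4.\<close>
    define c where "c = 4*pi*(2*A*B)\<^sup>2"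
    have c: "c > 0" using A B by (simp add: c_def)
    \<comment> \<open>The cap by 1 allows e^2 to be bounded by e.\<close>
    define e where "e = min 1 (\<eta> / (4 * c))"
    have e: "e > 0" "e\<^sup>2 \<le> \<eta> / (4 * c)"
    proof -
      show "e > 0" using \<eta> c by (simp add: e_def)
      have "e\<^sup>2 \<le> e * 1" unfolding power2_eq_square using \<open>e > 0\<close> by (intro mult_left_mono) (auto simp: e_def)
      then show "e\<^sup>2 \<le> \<eta> / (4 * c)" by (simp add: e_def)
    qed
    obtain C where C: "C \<ge> 0" "\<And>x y. norm (V (cis y) - V (cis x)) \<le> e + C * (sin ((x - y)/2))\<^sup>2"
      using circle_modulus_of_continuity[OF V(1) e(1)] by blast
    \<comment> \<open>Below this threshold the far contribution 2 pi C \<epsilon> is at most the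
      bound e B of the near one.\<close>
    define \<epsilon>0 where "\<epsilon>0 = min 1 (e * B / (2*pi*C + 1))"
    have \<epsilon>0: "\<epsilon>0 > 0" using e(1) B C(1) by (simp add: \<epsilon>0_def add_nonneg_pos)
    have "nsq (\<lambda>x. (\<integral>y. k \<epsilon> x y * u y \<partial>circ) - u x) < \<eta>" if eps: "0 < \<epsilon>" "\<epsilon> < \<epsilon>0" for \<epsilon>
    proof -
      have eps1: "\<epsilon> < 1" using eps(2) by (simp add: \<epsilon>0_def)
      have "\<epsilon> * (2*pi*C + 1) \<le> e * B"
      proof -
        have "\<epsilon> < e * B / (2*pi*C + 1)" using eps(2) by (simp add: \<epsilon>0_def)
        moreover have "2*pi*C + 1 > 0" using C(1) by (intro add_nonneg_pos) auto
        ultimately show ?thesis by (simp only: pos_less_divide_eq less_imp_le)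
      qed
      then have epsC: "2*pi*C*\<epsilon> \<le> e * B"
        using eps(1) by (simp add: algebra_simps)
      have KV: "norm ((\<integral>y. k \<epsilon> x y * V (cis y) \<partial>circ) - V (cis x)) \<le> 2*A*B*e" if x: "x \<in> {0..2*pi}" for x
      proof -
        have ik: "integrable circ (\<lambda>y. k \<epsilon> x y)"
          using dom(1)[OF eps(1) eps1 x sqint_const[of 1]] by simp
        have ikV: "integrable circ (\<lambda>y. k \<epsilon> x y * V (cis y))"
          by (rule dom(1)[OF eps(1) eps1 x sV])
        have im: "integrable circ (kernel_majorant \<epsilon> x)" by (rule integrable_kernel_majorant[OF eps(1)])
        have "(\<integral>y. k \<epsilon> x y * V (cis y) \<partial>circ) - V (cis x) = (\<integral>y. k \<epsilon> x y * V (cis y) \<partial>circ) - (\<integral>y. k \<epsilon> x y * V (cis x) \<partial>circ)"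
          using one[OF eps(1) eps1 x] by simp
        also have "\<dots> = (\<integral>y. k \<epsilon> x y * (V (cis y) - V (cis x)) \<partial>circ)"
          using ik ikV by (simp add: right_diff_distrib)
        also have "norm \<dots> \<le> (\<integral>y. A * (e * kernel_majorant \<epsilon> x y + C * \<epsilon>) \<partial>circ)"
        proof (rule Bochner_Integration.integral_norm_bound_integral)
          show "integrable circ (\<lambda>y. k \<epsilon> x y * (V (cis y) - V (cis x)))"
            using ik ikV by (simp add: right_diff_distrib)
          show "integrable circ (\<lambda>y. A * (e * kernel_majorant \<epsilon> x y + C * \<epsilon>))"
            using im by simp
          fix y assume "y \<in> space circ"
          then have y: "y \<in> {0..2*pi}" by simp
          have "norm (k \<epsilon> x y * (V (cis y) - V (cis x))) \<le> A * kernel_majorant \<epsilon> x y * (e + C * (sin ((x - y)/2))\<^sup>2)"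
            unfolding norm_mult using bound[OF eps(1) eps1 x y] C A kernel_majorant_pos[OF eps(1), of x y]
            by (intro mult_mono) auto
          also have "\<dots> = A * (e * kernel_majorant \<epsilon> x y + C * (kernel_majorant \<epsilon> x y * (sin ((x - y)/2))\<^sup>2))"
            by (simp add: algebra_simps)
          also have "\<dots> \<le> A * (e * kernel_majorant \<epsilon> x y + C * \<epsilon>)"
            using kernel_majorant_sin[OF eps(1), of x y] A C(1) by (intro mult_left_mono add_left_mono) auto
          finally show "norm (k \<epsilon> x y * (V (cis y) - V (cis x))) \<le> A * (e * kernel_majorant \<epsilon> x y + C * \<epsilon>)" .
        qed
        also have "\<dots> = A * (e * (\<integral>y. kernel_majorant \<epsilon> x y \<partial>circ) + C * \<epsilon> * (2*pi))"
          using im by simp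
        also have "\<dots> = A * (e * (\<integral>y. kernel_majorant \<epsilon> x y \<partial>circ) + 2*pi*C*\<epsilon>)"
          by (simp only: mult_ac)
        also have "\<dots> \<le> A * (e * B + e * B)"
          using integral_kernel_majorant_le[OF eps(1) x] A e(1) epsC
          by (intro mult_left_mono add_mono) (auto simp: B_def)
        finally show ?thesis by (simp add: algebra_simps)
      qed
      define a where "a x = (\<integral>y. k \<epsilon> x y * V (cis y) \<partial>circ) - V (cis x)" for x
      define b where "b x = (\<integral>y. k \<epsilon> x y * r y \<partial>circ)" for x
      have sa: "sqint a" unfolding a_def by (rule sqint_diff(1)[OF op(1)[OF eps(1) eps1 sV] sV])
      have na: "nsq a \<le> 2*pi*(2*A*B*e)\<^sup>2"
        by (rule nsq_bounded) (use sa KV in \<open>auto simp: sqint_def a_def\<close>)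
      have sb: "sqint b" "nsq b \<le> A\<^sup>2 * (B\<^sup>2 * nsq r)"
        unfolding b_def using op[OF eps(1) eps1 sr(1)] by auto
      have eq: "(\<integral>y. k \<epsilon> x y * u y \<partial>circ) - u x = a x + (b x - r x)" if x: "x \<in> {0..2*pi}" for x
      proof -
        have "(\<integral>y. k \<epsilon> x y * u y \<partial>circ) = (\<integral>y. k \<epsilon> x y * V (cis y) + k \<epsilon> x y * r y \<partial>circ)"
          by (rule Bochner_Integration.integral_cong) (auto simp: r_def algebra_simps)
        also have "\<dots> = (\<integral>y. k \<epsilon> x y * V (cis y) \<partial>circ) + b x"
          using dom(1)[OF eps(1) eps1 x sV] dom(1)[OF eps(1) eps1 x sr(1)] by (simp add: b_def)
        finally show ?thesis by (simp add: a_def r_def)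
      qed
      have "nsq (\<lambda>x. (\<integral>y. k \<epsilon> x y * u y \<partial>circ) - u x) = nsq (\<lambda>x. a x + (b x - r x))"
        unfolding nsq_def by (rule Bochner_Integration.integral_cong) (auto simp: eq)
      also have "\<dots> \<le> 2 * nsq a + 2 * nsq (\<lambda>x. b x - r x)"
        by (rule sqint_add(2)[OF sa sqint_diff(1)[OF sb(1) sr(1)]])
      also have "\<dots> \<le> 2 * nsq a + 2 * (2 * nsq b + 2 * nsq r)"
        using sqint_diff(2)[OF sb(1) sr(1)] by simp
      also have "\<dots> \<le> c * e\<^sup>2 + 4 * ((A\<^sup>2 * B\<^sup>2 + 1) * nsq r)"
        using na sb(2) by (simp add: c_def power_mult_distrib algebra_simps)
      also have "\<dots> < c * (\<eta> / (4 * c)) + 4 * ((A\<^sup>2 * B\<^sup>2 + 1) * \<delta>)"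
        using e(2) c sr(2) AB by (intro add_le_less_mono mult_strict_left_mono mult_left_mono) auto
      also have "\<dots> = \<eta>/4 + \<eta>/2" 
      proof -
        have "X * (\<eta> / (8 * X)) = \<eta>/8" if "X > 0" for X :: real using that by simp
        from this[OF AB] show ?thesis using c by (simp only: \<delta>_def[symmetric]) simp
      qed
      also have "\<dots> \<le> \<eta>" using \<eta> by simp
      finally show ?thesis .
    qed
    then show ?thesis
      using \<epsilon>0 by (auto simp: eventually_at_right)
  qed
  show ?thesis
  proof (rule order_tendstoI)
    fix a :: real assume "a < 0"
    then show "\<forall>\<^sub>F \<epsilon> in at_right 0. a < nsq (\<lambda>x. (\<integral>y. k \<epsilon> x y * u y \<partial>circ) - u x)"
      by (intro always_eventually allI) (meson less_le_trans nsq_nonneg)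
  qed (rule main)
qed

subsection \<open>The exponential coordinates\<close>

definition wave :: "real \<Rightarrow> real \<Rightarrow> complex" where
  "wave x y = exp (Complex y (- x))"

lemma norm_wave [simp]: "norm (wave x y) = exp y"
  by (simp add: wave_def norm_exp_eq_Re)

lemma wave_nonzero [simp]: "wave x y \<noteq> 0"
  by (simp add: wave_def)

lemma wave_add: "wave (x + x') (y + y') = wave x y * wave x' y'"
proof -
  have "Complex (y + y') (- (x + x')) = Complex y (- x) + Complex y' (- x')"
    by (simp add: complex_eq_iff)
  then show ?thesis by (simp only: wave_def exp_add)
qed

lemma wave_shift: "wave x (y + s) = of_real (exp s) * wave x y"
proof -
  have "wave 0 s = of_real (exp s)"
    by (simp add: wave_def complex_of_real_def[symmetric] exp_of_real)
  then show ?thesis using wave_add[of x 0 y s] by (simp add: mult.commute)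
qed

lemma wave_eq_imp: 
  assumes "wave x y = wave x' y'"
  shows "y = y'" "\<exists>k::int. x = x' + 2*pi*k"
proof -
  obtain n :: int where n: "Complex y (- x) = Complex y' (- x') + (of_int (2 * n) * pi) * \<i>"
    using assms unfolding wave_def exp_eq by blast
  from arg_cong[OF n, of Re] show "y = y'" by simp
  from arg_cong[OF n, of Im] have "x = x' + 2*pi * of_int (- n)" by (simp add: algebra_simps)
  then show "\<exists>k::int. x = x' + 2*pi*k" by blast
qed

lemma wave_int: "wave (x + 2*pi * of_int k) y = wave x y"
proof -
  have "Complex y (- (x + 2*pi * of_int k)) = Complex y (- x) + (of_int (2 * (- k)) * pi) * \<i>"
    by (simp add: complex_eq_iff)
  then show ?thesis unfolding wave_def exp_eq by blast
qed

lemma wave_2pi [simp]: "wave (x + 2*pi) y = wave x y"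
  using wave_int[of x 1 y] by simp

lemma wave_Ln: "w \<noteq> 0 \<Longrightarrow> wave (- Im (Ln w)) (Re (Ln w)) = w"
  unfolding wave_def minus_minus complex_surj by (rule exp_Ln)

lemma wave_surj:
  assumes "w \<noteq> 0" obtains x y where "w = wave x y" "y = ln (norm w)"
  by (rule that[OF wave_Ln[OF assms, symmetric]]) (simp add: assms)

lemma continuous_on_wave [continuous_intros]:
  assumes "continuous_on S f" "continuous_on S g"
  shows "continuous_on S (\<lambda>x. wave (f x) (g x))"
  unfolding wave_def Complex_eq by (intro continuous_intros assms)

lemma has_vector_derivative_wave:
  assumes "(f has_real_derivative f') (at x)" "(g has_real_derivative g') (at x)"
  shows "((\<lambda>x. wave (f x) (g x)) has_vector_derivative (Complex g' (- f') * wave (f x) (g x))) (at x)"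
proof -
  have "((\<lambda>x. of_real (g x) + \<i> * of_real (- f x)) has_vector_derivative (of_real g' + \<i> * of_real (- f'))) (at x)"
    using assms by (auto intro!: derivative_eq_intros simp: has_real_derivative_iff_has_vector_derivative)
  from field_vector_diff_chain_at[OF this DERIV_exp] show ?thesis
    by (simp add: wave_def Complex_eq o_def)
qed

text \<open>The squared distance to 1 splits into a radial and an angular part, which makes the
  lower bound of \<open>lev_diff_bound\<close> quadratic in both directions.\<close>

lemma wave_minus_1: "(norm (wave t a - 1))\<^sup>2 = (exp a - 1)\<^sup>2 + 4 * exp a * (sin (t/2))\<^sup>2"
proof -
  have w: "wave t a = Complex (exp a * cos t) (- exp a * sin t)"
    unfolding wave_def by (subst exp_eq_polar) (simp add: complex_eq_iff)
  have c: "cos t = 1 - 2 * (sin (t/2))\<^sup>2"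
    using cos_double_sin[of "t/2"] by simp
  have "(norm (wave t a - 1))\<^sup>2 = (exp a * cos t - 1)\<^sup>2 + (exp a * sin t)\<^sup>2"
    by (simp add: w cmod_power2)
  also have "\<dots> = (exp a)\<^sup>2 * ((sin t)\<^sup>2 + (cos t)\<^sup>2) - 2 * exp a * cos t + 1"
    unfolding power2_eq_square by (simp only: algebra_simps)
  also have "\<dots> = (exp a - 1)\<^sup>2 + 4 * exp a * (sin (t/2))\<^sup>2"
    by (simp only: sin_cos_squared_add) (simp add: c power2_eq_square algebra_simps)
  finally show ?thesis .
qed

section \<open>Holomorphy of integrals of Cauchy type\<close>

lemma integrable_circ_mult_bounded:
  fixes f c :: "real \<Rightarrow> 'a::{real_normed_field,banach,second_countable_topology}"
  assumes "integrable circ f" "c \<in> borel_measurable circ" "\<And>x. x \<in> {0..2*pi} \<Longrightarrow> norm (c x) \<le> B"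
  shows "integrable circ (\<lambda>x. f x * c x)"
proof -
  have [measurable]: "f \<in> borel_measurable circ" "c \<in> borel_measurable circ"
    using assms by auto
  have i: "integrable circ (\<lambda>x. norm (f x) * B)" using assms(1) by simp
  show ?thesis
  proof (rule Bochner_Integration.integrable_bound[OF i])
    show "AE x in circ. norm (f x * c x) \<le> norm (norm (f x) * B)"
    proof (rule AE_I2)
      fix x assume "x \<in> space circ"
      then have "norm (f x) * norm (c x) \<le> norm (f x) * B" using assms(3) by (intro mult_left_mono) auto
      then show "norm (f x * c x) \<le> norm (norm (f x) * B)"
        unfolding norm_mult real_norm_def by linarith
    qed
  qed simp
qed

text \<open>The error of the difference quotient has a closed form bounded by a multiple of |w - w0|
  / d^3, so differentiation under the integral is a single estimate. The factor 2 in the hypothesis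
  keeps every w within d of w0 at distance at least d from the values of g.\<close>

lemma Cauchy_type_integral_differentiable:
  fixes f g :: "real \<Rightarrow> complex"
  assumes f: "integrable circ f" and g: "g \<in> borel_measurable circ"
    and d: "d > 0" "\<And>y. y \<in> {0..2*pi} \<Longrightarrow> 2 * d \<le> norm (g y - w0)"
  shows "(\<lambda>w. \<integral>y. f y / (g y - w) \<partial>circ) field_differentiable (at w0)"
proof -
  have [measurable]: "f \<in> borel_measurable circ" "g \<in> borel_measurable circ" using f g by auto
  define F where "F w = (\<integral>y. f y / (g y - w) \<partial>circ)" for w
  define F1 where "F1 = (\<integral>y. f y / (g y - w0)\<^sup>2 \<partial>circ)"
  have near: "d \<le> norm (g y - w)" if "y \<in> {0..2*pi}" "norm (w - w0) < d" for y w
    using d(2)[OF that(1)] that(2) norm_triangle_ineq[of "g y - w" "w - w0"] by simp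
  have i1: "integrable circ (\<lambda>y. f y / (g y - w))" if w: "norm (w - w0) < d" for w
  proof -
    have "integrable circ (\<lambda>y. f y * inverse (g y - w))"
    proof (rule integrable_circ_mult_bounded[OF f])
      fix y :: real assume "y \<in> {0..2*pi}"
      then show "norm (inverse (g y - w)) \<le> inverse d"
        using near[OF _ w] d(1) by (simp add: norm_inverse le_imp_inverse_le)
    qed simp
    then show ?thesis by (simp add: divide_inverse)
  qed
  have i2: "integrable circ (\<lambda>y. f y / (g y - w0)\<^sup>2)"
  proof -
    have "integrable circ (\<lambda>y. f y * inverse ((g y - w0)\<^sup>2))"
    proof (rule integrable_circ_mult_bounded[OF f])
      fix y :: real assume "y \<in> {0..2*pi}"
      then have "d\<^sup>2 \<le> (norm (g y - w0))\<^sup>2" using near[of y w0] d(1) by (intro power_mono) auto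
      then show "norm (inverse ((g y - w0)\<^sup>2)) \<le> inverse (d\<^sup>2)"
        using d(1) by (simp add: norm_inverse norm_power le_imp_inverse_le)
    qed simp
    then show ?thesis by (simp add: divide_inverse)
  qed
  define K where "K = (\<integral>y. norm (f y) \<partial>circ) / d^3"
  have est: "norm ((F w - F w0) / (w - w0) - F1) \<le> K * norm (w - w0)"
    if w: "norm (w - w0) < d" "w \<noteq> w0" for w
  proof -
    have z: "norm (w0 - w0) < d" using d(1) by simp
    have "(F w - F w0) / (w - w0) - F1 = (\<integral>y. (f y / (g y - w) - f y / (g y - w0)) / (w - w0) - f y / (g y - w0)\<^sup>2 \<partial>circ)"
      using i1[OF w(1)] i1[OF z] i2 by (simp add: F_def F1_def)
    also have "norm \<dots> \<le> (\<integral>y. norm (f y) * (norm (w - w0) / d^3) \<partial>circ)"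
    proof (rule Bochner_Integration.integral_norm_bound_integral)
      fix y assume "y \<in> space circ"
      then have y: "y \<in> {0..2*pi}" by simp
      have n1: "d \<le> norm (g y - w)" "d \<le> norm (g y - w0)" using near[OF y w(1)] near[OF y z] by auto
      then have nz: "g y - w \<noteq> 0" "g y - w0 \<noteq> 0" using d(1) by auto
      have "(f y / (g y - w) - f y / (g y - w0)) / (w - w0) - f y / (g y - w0)\<^sup>2
          = f y * ((w - w0) / ((g y - w) * (g y - w0)\<^sup>2))"
      proof -
        have "(f y / a - f y / b) / (b - a) - f y / b\<^sup>2 = f y * ((b - a) / (a * b\<^sup>2))"
          if "a \<noteq> 0" "b \<noteq> 0" "b - a \<noteq> 0" for a b
          using that by (simp add: divide_simps power2_eq_square) (simp add: algebra_simps)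
        from this[of "g y - w" "g y - w0"] nz w(2) show ?thesis by simp
      qed
      also have "norm \<dots> = norm (f y) * (norm (w - w0) / (norm (g y - w) * (norm (g y - w0))\<^sup>2))"
        by (simp add: norm_mult norm_divide norm_power)
      also have "\<dots> \<le> norm (f y) * (norm (w - w0) / d^3)"
      proof (intro mult_left_mono divide_left_mono)
        have "d * d\<^sup>2 \<le> norm (g y - w) * (norm (g y - w0))\<^sup>2"
          using n1 d(1) by (intro mult_mono power_mono) auto
        then show "d^3 \<le> norm (g y - w) * (norm (g y - w0))\<^sup>2"
          by (simp add: power3_eq_cube power2_eq_square)
      qed (use nz d(1) in auto)
      finally show "norm ((f y / (g y - w) - f y / (g y - w0)) / (w - w0) - f y / (g y - w0)\<^sup>2)
          \<le> norm (f y) * (norm (w - w0) / d^3)" .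
    qed (use i1[OF w(1)] i1[OF z] i2 f in auto)
    also have "\<dots> = K * norm (w - w0)" by (simp add: K_def)
    finally show ?thesis .
  qed
  have "((\<lambda>w. (F w - F w0) / (w - w0) - F1) \<longlongrightarrow> 0) (at w0)"
  proof (rule Lim_null_comparison)
    show "\<forall>\<^sub>F w in at w0. norm ((F w - F w0) / (w - w0) - F1) \<le> K * norm (w - w0)"
      unfolding eventually_at using d(1) est by (intro exI[of _ d]) (auto simp: dist_norm)
    have "((\<lambda>w. K * norm (w - w0)) \<longlongrightarrow> K * norm (w0 - w0)) (at w0)"
      by (intro tendsto_intros)
    then show "((\<lambda>w. K * norm (w - w0)) \<longlongrightarrow> 0) (at w0)" by simp
  qed
  then have "(F has_field_derivative F1) (at w0)"
    unfolding has_field_derivative_iff by (rule LIM_zero_cancel)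
  then show ?thesis
    unfolding F_def[abs_def, symmetric] field_differentiable_def by blast
qed

section \<open>The curve of a periodic C1 graph and its dilates\<close>

locale periodic_graph =
  fixes h h' :: "real \<Rightarrow> real"
  assumes per_h: "periodic h"
    and deriv_h: "\<And>x. (h has_real_derivative h' x) (at x)"
    and cont_h': "continuous_on UNIV h'"
begin

lemma cont_h: "continuous_on S h"
  using deriv_h by (meson DERIV_continuous_on DERIV_subset subset_UNIV)

lemma cont_h'_on: "continuous_on S h'"
  using cont_h' continuous_on_subset by blast

lemma h_2pi [simp]: "h (x + 2*pi) = h x"
  using per_h by (simp add: periodic_def)

lemma h_int: "h (x + 2*pi * of_int k) = h x"
proof -
  have nat: "h (x + 2*pi * of_nat n) = h x" for x n
  proof (induction n)
    case (Suc n)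
    have "x + 2*pi * of_nat (Suc n) = (x + 2*pi * of_nat n) + 2*pi" by (simp add: algebra_simps)
    then show ?case using Suc by (metis h_2pi)
  qed simp
  show ?thesis
  proof (cases "k \<ge> 0")
    case True
    then show ?thesis using nat[of x "nat k"] by simp
  next
    case False
    then show ?thesis using nat[of "x + 2*pi * of_int k" "nat (-k)"] by simp
  qed
qed

lemma h'_2pi: "h' (x + 2*pi) = h' x"
proof -
  have "((\<lambda>x. h (x + 2*pi)) has_real_derivative h' (x + 2*pi)) (at x)"
    by (rule DERIV_shift[THEN iffD1, OF deriv_h])
  then show ?thesis using deriv_h[of x] DERIV_unique by (auto simp: h_2pi)
qed

lemma reduce_period: obtains k :: int where "x + 2*pi * of_int k \<in> {0..2*pi}"
proof -
  define k where "k = - \<lfloor>x / (2*pi)\<rfloor>"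
  have "of_int \<lfloor>x / (2*pi)\<rfloor> \<le> x / (2*pi)" "x / (2*pi) \<le> of_int \<lfloor>x / (2*pi)\<rfloor> + 1"
    by linarith+
  then have "of_int \<lfloor>x / (2*pi)\<rfloor> * (2*pi) \<le> x" "x \<le> (of_int \<lfloor>x / (2*pi)\<rfloor> + 1) * (2*pi)"
    using pos_le_divide_eq[of "2*pi" "of_int \<lfloor>x / (2*pi)\<rfloor>" x]
      pos_divide_le_eq[of "2*pi" x "of_int \<lfloor>x / (2*pi)\<rfloor> + 1"] pi_gt_zero by linarith+
  then have "x + 2*pi * of_int k \<in> {0..2*pi}"
    by (simp add: k_def algebra_simps)
  then show thesis by (rule that)
qed

lemma h_bounded: obtains H where "H > 0" "\<And>x. \<bar>h x\<bar> \<le> H"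
proof -
  obtain H where H: "H > 0" "\<And>x. x \<in> {0..2*pi} \<Longrightarrow> \<bar>h x\<bar> \<le> H"
    using continuous_circ_bound[OF cont_h] by (auto simp: real_norm_def)
  have "\<bar>h x\<bar> \<le> H" for x
    using reduce_period[of x] H(2) h_int by metis
  with H show thesis using that by blast
qed

text \<open>The slope bound must be applied to points that are close on the circle rather than on
  the line: x is first moved by the multiple of the period for which \<open>sin_half_ge\<close>
  holds, which leaves h unchanged.\<close>

lemma h_Lipschitz:
  obtains M where "M > 0" "\<And>x y. x \<in> {0..2*pi} \<Longrightarrow> y \<in> {0..2*pi} \<Longrightarrow>
      (h y - h x)\<^sup>2 \<le> M * (sin ((x - y)/2))\<^sup>2"
proof -
  \<comment> \<open>The interval only has to contain y and x moved by one period in either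
    direction.\<close>
  obtain B where B: "B > 0" "\<And>x. x \<in> {-10*pi..10*pi} \<Longrightarrow> \<bar>h' x\<bar> \<le> B"
  proof -
    have "bounded (h' ` {-10*pi..10*pi})"
      by (rule compact_imp_bounded[OF compact_continuous_image[OF cont_h'_on compact_Icc]])
    then show thesis using that unfolding bounded_pos by auto
  qed
  show thesis
  proof (rule that)
    show "36 * B\<^sup>2 > 0" using B(1) by simp
    fix x y :: real assume x: "x \<in> {0..2*pi}" and y: "y \<in> {0..2*pi}"
    then have "\<bar>x - y\<bar> \<le> 2*pi" by auto
    then obtain k :: real where k: "k \<in> {-1,0,1}" "((x - y) + 2*pi*k)\<^sup>2/36 \<le> (sin ((x - y)/2))\<^sup>2"
      using sin_half_ge by blast
    obtain n :: int where n: "k = of_int n" using k(1) by (metis insert_iff of_int_0 of_int_1 of_int_minus singletonD)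
    have "\<bar>h (x + 2*pi*k) - h y\<bar> \<le> B * \<bar>x + 2*pi*k - y\<bar>"
      using field_differentiable_bound[of "{-10*pi..10*pi}" h h' B "x + 2*pi*k" y] x y k(1) B deriv_h
      by (auto simp: has_field_derivative_at_within)
    then have "(h (x + 2*pi*k) - h y)\<^sup>2 \<le> (B * \<bar>x + 2*pi*k - y\<bar>)\<^sup>2"
      by (metis abs_ge_zero abs_le_square_iff abs_of_nonneg order_trans)
    also have "\<dots> = B\<^sup>2 * (x - y + 2*pi*k)\<^sup>2"
      by (simp add: power_mult_distrib algebra_simps)
    also have "\<dots> \<le> B\<^sup>2 * (36 * (sin ((x - y)/2))\<^sup>2)"
      using k(2) by (intro mult_left_mono) auto
    finally show "(h y - h x)\<^sup>2 \<le> 36 * B\<^sup>2 * (sin ((x - y)/2))\<^sup>2"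
      using h_int[of x n] n by (simp add: power2_commute)
  qed
qed

text \<open>This is 1 + i h_x rather than the derivative of the curve. On each level dw = -i
  \<open>tang\<close> w dx, so \<open>tang\<close> dx stands for i dw / w.\<close>

definition tang :: "real \<Rightarrow> complex" where "tang x = Complex 1 (h' x)"

definition lev :: "real \<Rightarrow> real \<Rightarrow> complex" where "lev s x = wave x (h x + s)"

abbreviation curve :: "real \<Rightarrow> complex" where "curve \<equiv> lev 0"

lemma norm_lev: "norm (lev s x) = exp (h x + s)"
  by (simp add: lev_def)

lemma lev_nonzero [simp]: "lev s x \<noteq> 0"
  by (simp add: lev_def)

lemma lev_curve: "lev s x = of_real (exp s) * curve x"
  using wave_shift[of x "h x" s] by (simp add: lev_def)

lemma lev_int: "lev s (x + 2*pi * of_int k) = lev s x"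
  by (simp add: lev_def h_int wave_int)

lemma lev_periodic: "lev s (2*pi) = lev s 0"
  using lev_int[of s 0 1] by simp

lemma cont_tang: "continuous_on S tang"
  unfolding tang_def Complex_eq by (intro continuous_intros cont_h'_on)

lemma cont_lev: "continuous_on S (lev s)"
  unfolding lev_def by (intro continuous_intros cont_h)

lemma tang_nonzero [simp]: "tang x \<noteq> 0"
  by (simp add: tang_def complex_eq_iff)

lemma deriv_lev: "(lev s has_vector_derivative (- \<i> * tang x * lev s x)) (at x)"
proof -
  have "((\<lambda>x. wave x (h x + s)) has_vector_derivative (Complex (h' x) (- 1) * wave x (h x + s))) (at x)"
    by (rule has_vector_derivative_wave) (auto intro!: derivative_eq_intros deriv_h)
  moreover have "Complex (h' x) (- 1) = - \<i> * tang x" by (simp add: tang_def complex_eq_iff)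
  ultimately show ?thesis by (simp add: lev_def[abs_def])
qed

lemma tang_measurable [measurable]: "tang \<in> borel_measurable borel"
  by (rule borel_measurable_continuous_onI[OF cont_tang])

lemma lev_measurable [measurable]: "lev s \<in> borel_measurable borel"
  by (rule borel_measurable_continuous_onI[OF cont_lev])

lemma tang_measurable_circ [measurable]: "tang \<in> borel_measurable circ"
  by (rule measurable_circ) simp

lemma lev_measurable_circ [measurable]: "lev s \<in> borel_measurable circ"
  by (rule measurable_circ) simp

lemma tang_bounded: obtains T where "T > 0" "\<And>x. x \<in> {0..2*pi} \<Longrightarrow> norm (tang x) \<le> T"
  using continuous_circ_bound[OF cont_tang] by blast

lemma integral_tang: "(\<integral>x. tang x \<partial>circ) = 2*pi"
proof -
  define F where "F x = of_real x + \<i> * of_real (h x)" for x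
  have "(F has_vector_derivative tang x) (at x within {0..2*pi})" for x
  proof -
    have "(F has_vector_derivative of_real 1 + \<i> * of_real (h' x)) (at x)"
      unfolding F_def using deriv_h
      by (auto intro!: derivative_eq_intros simp: has_real_derivative_iff_has_vector_derivative)
    then show ?thesis by (simp add: tang_def Complex_eq has_vector_derivative_at_within)
  qed
  from integral_circ_FTC[OF this cont_tang] show ?thesis
    using h_2pi[of 0] by (simp add: F_def)
qed

text \<open>The integral is i times the contour integral of F dw along a closed level, and F has the
  primitive G there.\<close>

lemma integral_level_exact:
  assumes "\<And>x. (G has_field_derivative F (lev s x)) (at (lev s x))"
    and "continuous_on {0..2*pi} (\<lambda>x. F (lev s x))"
  shows "(\<integral>x. F (lev s x) * lev s x * tang x \<partial>circ) = 0"
proof -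
  have "(\<integral>x. (- \<i> * tang x * lev s x) * F (lev s x) \<partial>circ) = (G \<circ> lev s) (2*pi) - (G \<circ> lev s) 0"
  proof (rule integral_circ_FTC)
    show "continuous_on {0..2*pi} (\<lambda>x. (- \<i> * tang x * lev s x) * F (lev s x))"
      by (intro continuous_intros cont_tang cont_lev assms(2))
    show "((G \<circ> lev s) has_vector_derivative (- \<i> * tang x * lev s x) * F (lev s x)) (at x within {0..2*pi})" for x
      by (rule has_vector_derivative_at_within[OF field_vector_diff_chain_at[OF deriv_lev assms(1)]])
  qed
  also have "\<dots> = 0" by (simp add: lev_periodic)
  also have "(\<integral>x. (- \<i> * tang x * lev s x) * F (lev s x) \<partial>circ) = (\<integral>x. - \<i> * (F (lev s x) * lev s x * tang x) \<partial>circ)"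
    by (rule Bochner_Integration.integral_cong) auto
  finally have "- \<i> * (\<integral>x. F (lev s x) * lev s x * tang x \<partial>circ) = 0"
    by (simp only: integral_mult_right_zero)
  then show ?thesis by simp
qed

subsection \<open>The two sides of the curve\<close>

definition below :: "complex set" where
  "below = insert 0 {wave x y | x y. y < h x}"

definition above :: "complex set" where
  "above = {wave x y | x y. h x < y}"

lemma wave_eq_h: "wave x y = wave x' y' \<Longrightarrow> y = y' \<and> h x = h x'"
  using wave_eq_imp h_int by metis

lemma wave_in_below_iff: "wave x y \<in> below \<longleftrightarrow> y < h x"
proof
  assume "wave x y \<in> below"
  then obtain x' y' where "wave x y = wave x' y'" "y' < h x'"
    unfolding below_def insert_iff using wave_nonzero[of x y] by blast
  then show "y < h x" using wave_eq_h[of x y x' y'] by simp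
qed (unfold below_def, blast)

lemma wave_in_above_iff: "wave x y \<in> above \<longleftrightarrow> h x < y"
proof
  assume "wave x y \<in> above"
  then obtain x' y' where "wave x y = wave x' y'" "h x' < y'"
    unfolding above_def by blast
  then show "h x < y" using wave_eq_h[of x y x' y'] by simp
qed (unfold above_def, blast)

lemma lev_in_below_iff: "lev s x \<in> below \<longleftrightarrow> s < 0"
  by (simp add: lev_def wave_in_below_iff)

lemma lev_in_above_iff: "lev s x \<in> above \<longleftrightarrow> s > 0"
  by (simp add: lev_def wave_in_above_iff)

lemma zero_in_below: "0 \<in> below"
  by (simp add: below_def)

lemma below_cases:
  assumes "w \<in> below" obtains "w = 0" | x y where "w = wave x y" "y < h x"
  using assms by (auto simp: below_def)

lemma not_exp_constant: "\<not> (exp :: complex \<Rightarrow> complex) constant_on UNIV"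
proof
  assume "(exp :: complex \<Rightarrow> complex) constant_on UNIV"
  then obtain c where "\<And>z::complex. exp z = c" by (auto simp: constant_on_def)
  then have "exp (0::complex) = exp (\<i> * pi)" by metis
  then show False by (simp add: exp_pi_i')
qed

lemma open_exp_image: "open U \<Longrightarrow> open (exp ` U :: complex set)"
  by (rule open_mapping_thm[of exp UNIV]) (auto simp: not_exp_constant holomorphic_on_exp)

text \<open>The ball fills the hole that the exponential image leaves at 0 in
  \<open>open_below\<close>, and its distance from the levels s \<ge> -1 gives a bounded Cauchy
  kernel in the uniqueness proof.\<close>

lemma ball_below:
  obtains r where "r > 0" "ball 0 r \<subseteq> below" "\<And>s x. s \<ge> -1 \<Longrightarrow> 2 * r \<le> norm (lev s x)"
proof -
  obtain H where H: "H > 0" "\<And>x. \<bar>h x\<bar> \<le> H" using h_bounded by blast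
  show thesis
  proof (rule that)
    show "exp (- H - 2) / 2 > 0" by simp
    show "ball 0 (exp (- H - 2) / 2) \<subseteq> below"
    proof
      fix w :: complex assume w: "w \<in> ball 0 (exp (- H - 2) / 2)"
      show "w \<in> below"
      proof (cases "w = 0")
        case False
        then obtain x y where xy: "w = wave x y" "y = ln (norm w)" by (rule wave_surj)
        have "exp y < exp (- H)"
        proof -
          have "exp y < exp (- H - 2) / 2" using w xy(1) by simp
          also have "\<dots> \<le> exp (- H - 2)" by simp
          also have "\<dots> \<le> exp (- H)" by simp
          finally show ?thesis .
        qed
        then have "y < - H" by simp
        also have "\<dots> \<le> h x" using H(2)[of x] by linarith
        finally show ?thesis using xy(1) wave_in_below_iff by simp
      qed (simp add: zero_in_below)
    qed
    show "2 * (exp (- H - 2) / 2) \<le> norm (lev s x)" if "s \<ge> -1" for s x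
      using H(2)[of x] that by (simp add: norm_lev)
  qed
qed

lemma open_below: "open below"
proof -
  have "open {z. Re z < h (- Im z)}"
    by (intro open_Collect_less continuous_intros continuous_on_compose2[OF cont_h]) auto
  then have o: "open (exp ` {z. Re z < h (- Im z)})" by (rule open_exp_image)
  obtain r where r: "r > 0" "ball 0 r \<subseteq> below" by (rule ball_below)
  have "below = exp ` {z. Re z < h (- Im z)} \<union> ball 0 r"
  proof
    show "below \<subseteq> exp ` {z. Re z < h (- Im z)} \<union> ball 0 r"
    proof
      fix w assume "w \<in> below"
      then show "w \<in> exp ` {z. Re z < h (- Im z)} \<union> ball 0 r"
      proof (cases rule: below_cases)
        case 1
        then show ?thesis using r by simp
      next
        case (2 x y)
        then show ?thesis by (auto simp: wave_def intro!: image_eqI[of _ _ "Complex y (-x)"])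
      qed
    qed
    have "exp z \<in> below" if "Re z < h (- Im z)" for z
    proof -
      have "exp z = wave (- Im z) (Re z)" by (simp add: wave_def)
      then show ?thesis using that wave_in_below_iff by simp
    qed
    with r show "exp ` {z. Re z < h (- Im z)} \<union> ball 0 r \<subseteq> below" by auto
  qed
  then show ?thesis using open_Un[OF o open_ball] by metis
qed

lemma open_above: "open above"
proof -
  have "open {z. h (- Im z) < Re z}"
    by (intro open_Collect_less continuous_intros continuous_on_compose2[OF cont_h]) auto
  then have o: "open (exp ` {z. h (- Im z) < Re z})" by (rule open_exp_image)
  have "above = exp ` {z. h (- Im z) < Re z}"
  proof
    show "above \<subseteq> exp ` {z. h (- Im z) < Re z}"
    proof
      fix w assume "w \<in> above"
      then obtain x y where "w = wave x y" "h x < y" by (auto simp: above_def)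
      then show "w \<in> exp ` {z. h (- Im z) < Re z}"
        by (auto simp: wave_def intro!: image_eqI[of _ _ "Complex y (-x)"])
    qed
    have "exp z \<in> above" if "h (- Im z) < Re z" for z
    proof -
      have "exp z = wave (- Im z) (Re z)" by (simp add: wave_def)
      then show ?thesis using that wave_in_above_iff by simp
    qed
    then show "exp ` {z. h (- Im z) < Re z} \<subseteq> above" by auto
  qed
  then show ?thesis using o by simp
qed

lemma connected_above: "connected above"
proof -
  have "above = (\<lambda>(x, s). wave x (h x + s)) ` (UNIV \<times> {0<..})"
  proof
    show "above \<subseteq> (\<lambda>(x, s). wave x (h x + s)) ` (UNIV \<times> {0<..})"
    proof
      fix w assume "w \<in> above"
      then obtain x y where "w = wave x y" "h x < y" by (auto simp: above_def)
      then show "w \<in> (\<lambda>(x, s). wave x (h x + s)) ` (UNIV \<times> {0<..})"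
        by (intro image_eqI[of _ _ "(x, y - h x)"]) auto
    qed
  qed (auto simp: wave_in_above_iff)
  moreover have "connected ((\<lambda>(x, s). wave x (h x + s)) ` (UNIV \<times> {0<..}))"
  proof (rule connected_continuous_image)
    show "continuous_on (UNIV \<times> {0<..}) (\<lambda>(x, s). wave x (h x + s))"
      unfolding split_beta by (intro continuous_intros continuous_on_compose2[OF cont_h]) auto
    show "connected (UNIV \<times> {0<..} :: (real \<times> real) set)"
      by (intro connected_Times) auto
  qed
  ultimately show ?thesis by simp
qed

lemma scale_below:
  assumes "w \<in> below" "0 \<le> t" "t \<le> 1"
  shows "of_real t * w \<in> below"
  using assms(1)
proof (cases rule: below_cases)
  case (2 x y)
  show ?thesis
  proof (cases "t = 0")
    case False
    then have "of_real t * w = wave x (y + ln t)"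
      using assms(2) 2(1) wave_shift[of x y "ln t"] by simp
    moreover have "y + ln t < h x" using 2(2) False assms(2,3) by (smt (verit) ln_le_zero_iff)
    ultimately show ?thesis by (simp add: wave_in_below_iff)
  qed (simp add: zero_in_below)
qed (simp add: zero_in_below)

lemma starlike_below: "starlike below"
  unfolding starlike_def
proof (intro bexI[of _ 0] ballI subsetI)
  fix x w assume "x \<in> below" "w \<in> closed_segment 0 x"
  then show "w \<in> below" using scale_below by (auto simp: closed_segment_def scaleR_conv_of_real)
qed (rule zero_in_below)

text \<open>Starlikeness replaces every homotopy argument: analytic functions integrate to zero over
  the levels because a primitive exists.\<close>

lemma holomorphic_primitive_below:
  assumes "F holomorphic_on below"
  obtains G where "\<And>w. w \<in> below \<Longrightarrow> (G has_field_derivative F w) (at w)"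
proof -
  have "\<exists>G. \<forall>w\<in>below. (G has_field_derivative F w) (at w)"
    by (rule holomorphic_starlike_primitive[OF holomorphic_on_imp_continuous_on[OF assms] starlike_below open_below finite.emptyI])
       (use holomorphic_on_imp_differentiable_at[OF assms open_below] in simp)
  then show thesis using that by blast
qed

lemma continuous_on_level:
  assumes "F holomorphic_on below" "\<epsilon> > 0"
  shows "continuous_on S (\<lambda>x. F (lev (- \<epsilon>) x))"
  by (rule continuous_on_compose2[OF holomorphic_on_imp_continuous_on[OF assms(1)] cont_lev])
     (use assms(2) in \<open>auto simp: lev_in_below_iff\<close>)

lemma integral_level_zero:
  assumes "F holomorphic_on below" "\<epsilon> > 0"
  shows "(\<integral>x. F (lev (- \<epsilon>) x) * lev (- \<epsilon>) x * tang x \<partial>circ) = 0"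
proof -
  obtain G where "\<And>w. w \<in> below \<Longrightarrow> (G has_field_derivative F w) (at w)"
    using holomorphic_primitive_below[OF assms(1)] by blast
  then show ?thesis
    using assms by (intro integral_level_exact[of G]) (auto simp: lev_in_below_iff intro: continuous_on_level)
qed

text \<open>
  The two winding numbers of the curve: a branch of \<open>Ln (1 - w / curve x)\<close>, respectively of
  \<open>Ln (1 - curve x / w)\<close>, is a periodic primitive of the integrand.
\<close>

lemma winding_below:
  assumes w: "w \<in> below"
  shows "(\<integral>x. tang x * curve x / (curve x - w) \<partial>circ) = 2*pi"
proof -
  \<comment> \<open>On the branch cut w would be a real multiple, by a factor of at least 1, of a
    point of the curve, hence not below it.\<close>
  have nr: "1 - w / curve x \<notin> \<real>\<^sub>\<le>\<^sub>0" for x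
  proof
    assume "1 - w / curve x \<in> \<real>\<^sub>\<le>\<^sub>0"
    then obtain r where r: "r \<le> 0" "1 - w / curve x = of_real r" by (auto elim!: nonpos_Reals_cases)
    then have "w / curve x = of_real (1 - r)" by (simp add: algebra_simps)
    then have "w = of_real (exp (ln (1 - r))) * curve x" using r(1) by (simp add: divide_eq_eq)
    then have "w = lev (ln (1 - r)) x" by (simp only: lev_curve[symmetric])
    then show False using w r(1) by (simp add: lev_in_below_iff)
  qed
  have ne: "curve x - w \<noteq> 0" for x
    using w lev_in_below_iff[of 0 x] by auto
  define L where "L = (\<lambda>z. Ln (1 - w / z))"
  have "(L has_field_derivative (w / (curve x * (curve x - w)))) (at (curve x))" for x
  proof -
    have "((\<lambda>z. 1 - w / z) has_field_derivative (w / (curve x)\<^sup>2)) (at (curve x))"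
      by (auto intro!: derivative_eq_intros simp: power2_eq_square)
    from DERIV_chain2[OF has_field_derivative_Ln[OF nr] this]
    have "(L has_field_derivative inverse (1 - w / curve x) * (w / (curve x)\<^sup>2)) (at (curve x))"
      by (simp add: L_def)
    also have "inverse (1 - w / curve x) * (w / (curve x)\<^sup>2) = w / (curve x * (curve x - w))"
      using ne[of x] by (simp add: field_simps power2_eq_square)
    finally show ?thesis .
  qed
  from integral_level_exact[OF this]
  have "(\<integral>x. w / (curve x * (curve x - w)) * curve x * tang x \<partial>circ) = 0"
    using ne by (simp add: continuous_intros cont_lev)
  then have z: "(\<integral>x. w / (curve x - w) * tang x \<partial>circ) = 0"
    by simp
  have i: "integrable circ (\<lambda>x. w / (curve x - w) * tang x)" "integrable circ tang"
    using ne by (auto intro!: integrable_circ_continuous continuous_intros cont_tang cont_lev)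
  have "(\<integral>x. tang x * curve x / (curve x - w) \<partial>circ) = (\<integral>x. tang x + w / (curve x - w) * tang x \<partial>circ)"
    by (rule Bochner_Integration.integral_cong) (use ne in \<open>auto simp: field_simps\<close>)
  also have "\<dots> = 2*pi" using i z by (simp add: integral_tang)
  finally show ?thesis .
qed

lemma winding_above:
  assumes w: "w \<in> above"
  shows "(\<integral>x. tang x * curve x / (curve x - w) \<partial>circ) = 0"
proof -
  have w0: "w \<noteq> 0" using w by (auto simp: above_def)
  have nr: "1 - curve x / w \<notin> \<real>\<^sub>\<le>\<^sub>0" for x
  proof
    assume "1 - curve x / w \<in> \<real>\<^sub>\<le>\<^sub>0"
    then obtain r where r: "r \<le> 0" "1 - curve x / w = of_real r" by (auto elim!: nonpos_Reals_cases)
    then have "curve x / w = of_real (1 - r)" by (simp add: algebra_simps)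
    then have "curve x = of_real (1 - r) * w" using w0 by (simp add: divide_eq_eq)
    then have "w = of_real (exp (- ln (1 - r))) * curve x" using r(1) by (simp add: exp_minus)
    then have "w = lev (- ln (1 - r)) x" by (simp only: lev_curve[symmetric])
    then show False using w r(1) by (simp add: lev_in_above_iff)
  qed
  have ne: "curve x - w \<noteq> 0" for x
    using w lev_in_above_iff[of 0 x] by auto
  define L where "L = (\<lambda>z. Ln (1 - z / w))"
  have "(L has_field_derivative (1 / (curve x - w))) (at (curve x))" for x
  proof -
    have "((\<lambda>z. 1 - z / w) has_field_derivative (- 1 / w)) (at (curve x))"
      using w0 by (auto intro!: derivative_eq_intros)
    from DERIV_chain2[OF has_field_derivative_Ln[OF nr] this]
    have "(L has_field_derivative inverse (1 - curve x / w) * (- 1 / w)) (at (curve x))"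
      by (simp add: L_def)
    also have "inverse (1 - curve x / w) * (- 1 / w) = 1 / (curve x - w)"
    proof -
      have "1 - curve x / w = (curve x - w) * (- 1 / w)" using w0 by (simp add: field_simps)
      then show ?thesis using w0 ne[of x] by (simp add: inverse_eq_divide)
    qed
    finally show ?thesis .
  qed
  from integral_level_exact[OF this]
  have "(\<integral>x. 1 / (curve x - w) * curve x * tang x \<partial>circ) = 0"
    using ne by (simp add: continuous_intros cont_lev)
  then show ?thesis by (simp add: mult_ac)
qed


text \<open>The squared distance dominates s^2 plus the squared angular distance. Factoring out
  \<open>lev s x\<close> leaves \<open>wave_minus_1\<close> with radial part a = h y - h x - s; the
  Lipschitz bound on h then trades a for s.\<close>

lemma lev_diff_bound:
  obtains c where "c > 0" "\<And>x y s. x \<in> {0..2*pi} \<Longrightarrow> y \<in> {0..2*pi} \<Longrightarrow> \<bar>s\<bar> \<le> 1 \<Longrightarrow>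
      c * (s\<^sup>2 + (sin ((x - y)/2))\<^sup>2) \<le> (norm (curve y - lev s x))\<^sup>2"
proof -
  obtain H where H: "H > 0" "\<And>x. \<bar>h x\<bar> \<le> H" using h_bounded by blast
  obtain M where M: "M > 0" "\<And>x y. x \<in> {0..2*pi} \<Longrightarrow> y \<in> {0..2*pi} \<Longrightarrow>
      (h y - h x)\<^sup>2 \<le> M * (sin ((x - y)/2))\<^sup>2" using h_Lipschitz by blast
  \<comment> \<open>R bounds |a|, so exp(-R) is a lower bound for the derivative of exp between 0
    and a, while exp(-H-1) is one for the modulus of the points on the levels |s| \<le> 1.\<close>
  define R where "R = 2*H + 1"
  define c1 where "c1 = (exp (- H - 1))\<^sup>2 * (exp (- R))\<^sup>2"
  have c1: "c1 > 0" by (simp add: c1_def)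
  show thesis
  proof (rule that)
    \<comment> \<open>The denominator comes from s^2 + S \<le> 2a^2 + (2M + 1)S.\<close>
    show "c1 / (3 + 2*M) > 0" using c1 M(1) by simp
    fix x y s :: real assume x: "x \<in> {0..2*pi}" and y: "y \<in> {0..2*pi}" and s: "\<bar>s\<bar> \<le> 1"
    define a where "a = h y - h x - s"
    define S where "S = (sin ((x - y)/2))\<^sup>2"
    have S: "(sin ((y - x)/2))\<^sup>2 = S"
    proof -
      have "(y - x)/2 = - ((x - y)/2)" by (simp add: field_simps)
      then show ?thesis by (simp only: S_def sin_minus power2_minus)
    qed
    have S0: "0 \<le> S" by (simp add: S_def)
    have aR: "\<bar>a\<bar> \<le> R" using H(2)[of x] H(2)[of y] s by (simp add: a_def R_def)
    have "wave y (h y) = wave x (h x + s) * wave (y - x) a"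
      using wave_add[of x "y - x" "h x + s" a] by (simp add: a_def)
    then have "curve y - lev s x = lev s x * (wave (y - x) a - 1)"
      by (simp add: lev_def algebra_simps)
    then have "(norm (curve y - lev s x))\<^sup>2 = (exp (h x + s))\<^sup>2 * ((exp a - 1)\<^sup>2 + 4 * exp a * S)"
      by (simp add: norm_mult power_mult_distrib norm_lev wave_minus_1 S)
    also have "\<dots> \<ge> (exp (- H - 1))\<^sup>2 * ((exp (- R))\<^sup>2 * (a\<^sup>2 + S))"
    proof (rule mult_mono)
      show "(exp (- H - 1))\<^sup>2 \<le> (exp (h x + s))\<^sup>2"
        using H(2)[of x] s by (intro power_mono) auto
      have e1: "exp (- R) * \<bar>a\<bar> \<le> \<bar>exp a - 1\<bar>"
      proof (cases "a \<ge> 0")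
        case True
        have "exp (- R) * a \<le> 1 * a" using True aR by (intro mult_right_mono) auto
        also have "\<dots> \<le> exp a - 1" using exp_ge_add_one_self[of a] by linarith
        finally show ?thesis using True by simp
      next
        case False
        have "exp (- R) * (- a) \<le> exp a * (- a)" using False aR by (intro mult_right_mono) auto
        also have "\<dots> \<le> exp a * (exp (- a) - 1)"
          using exp_ge_add_one_self[of "- a"] by (intro mult_left_mono) auto
        also have "\<dots> = 1 - exp a" by (simp add: algebra_simps exp_minus)
        finally show ?thesis using False by simp
      qed
      have "(exp (- R) * \<bar>a\<bar>)\<^sup>2 \<le> \<bar>exp a - 1\<bar>\<^sup>2" using e1 by (intro power_mono) auto
      then have 1: "(exp (- R))\<^sup>2 * a\<^sup>2 \<le> (exp a - 1)\<^sup>2" by (simp add: power_mult_distrib)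
      have "(exp (- R))\<^sup>2 \<le> exp (- R) * 1"
        unfolding power2_eq_square using aR by (intro mult_left_mono) auto
      also have "\<dots> \<le> 4 * exp a" using aR exp_gt_zero[of a] by (smt (verit) exp_le_cancel_iff)
      finally have "(exp (- R))\<^sup>2 * S \<le> 4 * exp a * S" using S0 by (rule mult_right_mono)
      with 1 show "(exp (- R))\<^sup>2 * (a\<^sup>2 + S) \<le> (exp a - 1)\<^sup>2 + 4 * exp a * S"
        by (simp add: distrib_left)
    qed (use S0 in auto)
    finally have lower: "c1 * (a\<^sup>2 + S) \<le> (norm (curve y - lev s x))\<^sup>2"
      by (simp add: c1_def mult.assoc)
    have "s\<^sup>2 = (- a + (h y - h x))\<^sup>2" by (simp add: a_def)
    also have "\<dots> \<le> 2 * a\<^sup>2 + 2 * (h y - h x)\<^sup>2"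
      using norm_add_sq_le[of "- a" "h y - h x"] by simp
    also have "\<dots> \<le> 2 * a\<^sup>2 + 2 * (M * S)" using M(2)[OF x y] by (simp add: S_def)
    finally have "s\<^sup>2 + S \<le> (2 * a\<^sup>2 + 2 * (M * S)) + S" by simp
    also have "\<dots> \<le> (3 + 2*M) * (a\<^sup>2 + S)"
      using M(1) S0 by (simp add: algebra_simps)
    finally have "c1 / (3 + 2*M) * (s\<^sup>2 + S) \<le> c1 / (3 + 2*M) * ((3 + 2*M) * (a\<^sup>2 + S))"
      using c1 M(1) by (intro mult_left_mono) auto
    also have "\<dots> = c1 * (a\<^sup>2 + S)" using M(1) by simp
    finally show "c1 / (3 + 2*M) * (s\<^sup>2 + (sin ((x - y)/2))\<^sup>2) \<le> (norm (curve y - lev s x))\<^sup>2"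
      using lower by (simp add: S_def)
  qed
qed

subsection \<open>Cauchy integrals\<close>

text \<open>Since dw = -i \<open>tang\<close> \<open>curve\<close> dx and the parametrisation runs
  clockwise like e^(-ix), this is the usual Cauchy integral over the positively oriented
  curve.\<close>

definition Cauchy_integral :: "(real \<Rightarrow> complex) \<Rightarrow> complex \<Rightarrow> complex" where
  "Cauchy_integral u w = (\<integral>y. u y * tang y * curve y / (curve y - w) \<partial>circ) / (2*pi)"

lemma integrable_tang_curve:
  assumes "integrable circ u"
  shows "integrable circ (\<lambda>y. u y * tang y * curve y)"
  using integrable_circ_mult_continuous[OF assms, of "\<lambda>y. tang y * curve y"]
  by (simp add: mult.assoc continuous_intros cont_tang cont_lev)

lemma curve_separated:
  assumes "\<And>x. w \<noteq> curve x"
  obtains d where "d > 0" "\<And>x. d \<le> norm (curve x - w)"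
proof -
  have "compact (curve ` {0..2*pi})"
    by (rule compact_continuous_image[OF cont_lev compact_Icc])
  moreover have "w \<notin> curve ` {0..2*pi}" using assms by auto
  ultimately obtain d where d: "d > 0" "\<forall>z \<in> curve ` {0..2*pi}. d \<le> dist w z"
    using separate_point_closed compact_imp_closed by metis
  have "d \<le> norm (curve x - w)" for x
  proof -
    obtain k where "x + 2*pi * of_int k \<in> {0..2*pi}" using reduce_period by blast
    then have "d \<le> dist w (curve (x + 2*pi * of_int k))" using d(2) by blast
    then show ?thesis by (simp add: lev_int dist_norm norm_minus_commute)
  qed
  with d(1) show thesis by (rule that)
qed

lemma Cauchy_integral_holomorphic:
  assumes u: "integrable circ u" and S: "\<And>x. curve x \<notin> S"
  shows "Cauchy_integral u holomorphic_on S"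
  unfolding holomorphic_on_def
proof
  fix w assume "w \<in> S"
  then have "w \<noteq> curve x" for x using S by metis
  then obtain d where d: "d > 0" "\<And>x. d \<le> norm (curve x - w)" using curve_separated by blast
  have "(\<lambda>w. \<integral>y. u y * tang y * curve y / (curve y - w) \<partial>circ) field_differentiable (at w)"
    by (rule Cauchy_type_integral_differentiable[OF integrable_tang_curve[OF u] _ _, of _ "d/2"]) (use d in auto)
  then have "(\<lambda>w. (\<integral>y. u y * tang y * curve y / (curve y - w) \<partial>circ) / (2*pi)) field_differentiable (at w)"
    by (intro derivative_intros) auto
  then show "Cauchy_integral u field_differentiable (at w within S)"
    unfolding Cauchy_integral_def[abs_def] by (rule field_differentiable_at_within)
qed

lemma curve_notin: "curve x \<notin> below" "curve x \<notin> above"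
  by (simp_all add: lev_in_below_iff lev_in_above_iff)

lemma Cauchy_integral_zero: "Cauchy_integral u 0 = (\<integral>y. u y * tang y \<partial>circ) / (2*pi)"
  by (simp add: Cauchy_integral_def)

text \<open>Up to a factor these integrals are the coefficients of w^(-j) in the expansion of the
  Cauchy integral at infinity. The index 0 is left out because that integral is 2 pi times the value
  at 0.\<close>

definition moments_vanish :: "(real \<Rightarrow> complex) \<Rightarrow> bool" where
  "moments_vanish u \<longleftrightarrow> (\<forall>j>0. (\<integral>y. u y * tang y * curve y ^ j \<partial>circ) = 0)"

text \<open>Near infinity the vanishing moments annihilate the expansion in powers of 1/w; the
  exterior is connected, so the zero spreads to all of it.\<close>

lemma Cauchy_integral_above_eq_0:
  assumes u: "integrable circ u" and m: "moments_vanish u" and w: "w \<in> above"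
  shows "Cauchy_integral u w = 0"
proof -
  obtain H where H: "H > 0" "\<And>x. \<bar>h x\<bar> \<le> H" using h_bounded by blast
  define R where "R = 2 * exp H"
  have hol: "Cauchy_integral u holomorphic_on above"
    by (rule Cauchy_integral_holomorphic[OF u curve_notin(2)])
  have curveR: "norm (curve y) \<le> R/2" for y
    using H(2)[of y] by (simp add: norm_lev R_def)
  have R: "R > 0" by (simp add: R_def)
  define C where "C = (\<integral>y. norm (u y * tang y * curve y) \<partial>circ) * (1 / (R/2))"
  have far: "Cauchy_integral u w = 0" if w: "norm w > R" for w
  proof -
    have ne: "curve y - w \<noteq> 0" "R/2 \<le> norm (curve y - w)" for y
      using norm_triangle_ineq2[of w "curve y"] curveR[of y] w R by (auto simp: norm_minus_commute)
    have w0: "w \<noteq> 0" using w R by auto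
    note iu = integrable_tang_curve[OF u]
    \<comment> \<open>The remainder of the geometric series for 1 / (\<open>curve\<close> - w).
      Consecutive remainders differ by a multiple of a moment, so all are equal, while the n-th is
      O(2^(-n)); no series has to be integrated.\<close>
    define I where "I n = (\<integral>y. (u y * tang y * curve y) * ((curve y / w)^n / (curve y - w)) \<partial>circ)" for n
    have int_n: "integrable circ (\<lambda>y. (u y * tang y * curve y) * ((curve y / w)^n / (curve y - w)))" for n
      by (rule integrable_circ_mult_continuous[OF iu]) (use ne w0 in \<open>auto intro!: continuous_intros cont_lev\<close>)
    have step: "I (Suc n) = I n" for n
    proof -
      have int_j: "integrable circ (\<lambda>y. (u y * tang y * curve y) * (curve y ^ n / w ^ Suc n))"
        by (rule integrable_circ_mult_continuous[OF iu]) (use w0 in \<open>auto intro!: continuous_intros cont_lev\<close>)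
      have "I (Suc n) - I n = (\<integral>y. (u y * tang y * curve y) * (curve y ^ n / w ^ Suc n) \<partial>circ)"
        unfolding I_def Bochner_Integration.integral_diff[OF int_n int_n, symmetric]
      proof (rule Bochner_Integration.integral_cong[OF refl])
        fix y
        have "(b / w)^Suc n / (b - w) - (b / w)^n / (b - w) = b ^ n / w ^ Suc n" if "b - w \<noteq> 0" for b
        proof -
          have "(b / w)^Suc n / (b - w) - (b / w)^n / (b - w) = (b / w)^n * ((b / w - 1) / (b - w))"
            by (simp add: diff_divide_distrib algebra_simps)
          also have "(b / w - 1) / (b - w) = 1 / w"
            using that w0 by (simp add: field_simps)
          finally show ?thesis by (simp add: power_divide)
        qed
        from this[OF ne(1)[of y]]
        show "u y * tang y * curve y * ((curve y / w) ^ Suc n / (curve y - w)) - u y * tang y * curve y * ((curve y / w) ^ n / (curve y - w))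
            = u y * tang y * curve y * (curve y ^ n / w ^ Suc n)"
          by (metis right_diff_distrib)
      qed
      also have "\<dots> = (\<integral>y. (u y * tang y * curve y ^ Suc n) * (1 / w ^ Suc n) \<partial>circ)"
        by (rule Bochner_Integration.integral_cong) auto
      also have "\<dots> = (\<integral>y. u y * tang y * curve y ^ Suc n \<partial>circ) * (1 / w ^ Suc n)"
        by (rule integral_mult_left_zero)
      also have "\<dots> = 0" using m by (simp add: moments_vanish_def del: power_Suc)
      finally show ?thesis by simp
    qed
    have I_eq: "I n = I 0" for n by (induction n) (auto simp: step)
    have I_bound: "norm (I 0) \<le> C * (1/2)^n" for n
    proof -
      have "norm (I n) \<le> (\<integral>y. norm (u y * tang y * curve y) * ((1/2)^n * (1 / (R/2))) \<partial>circ)"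
        unfolding I_def
      proof (rule Bochner_Integration.integral_norm_bound_integral[OF int_n])
        show "integrable circ (\<lambda>y. norm (u y * tang y * curve y) * ((1/2)^n * (1 / (R/2))))"
          using iu by simp
        fix y
        have "norm (curve y / w) \<le> 1/2"
        proof -
          have "norm (curve y) \<le> norm w / 2" using curveR[of y] w by simp
          then show ?thesis using w0 by (simp add: norm_divide divide_simps)
        qed
        then have "norm ((curve y / w)^n / (curve y - w)) \<le> (1/2)^n / (R/2)"
          unfolding norm_divide[of "_ ^ n"] norm_power using ne(2)[of y] R
          by (intro frac_le power_mono) auto
        then show "norm (u y * tang y * curve y * ((curve y / w) ^ n / (curve y - w)))
            \<le> norm (u y * tang y * curve y) * ((1/2)^n * (1 / (R/2)))"
          unfolding norm_mult[of "_ * curve y"] by (intro mult_left_mono) auto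
      qed
      also have "\<dots> = C * (1/2)^n" by (simp add: C_def)
      finally show ?thesis using I_eq[of n] by simp
    qed
    have "(\<lambda>n. C * (1/2)^n) \<longlonglongrightarrow> C * 0"
      by (intro tendsto_intros LIMSEQ_realpow_zero) auto
    then have "norm (I 0) \<le> C * 0"
      by (rule LIMSEQ_le_const) (use I_bound in auto)
    then show ?thesis by (simp add: I_def Cauchy_integral_def)
  qed
  show ?thesis
  proof (rule analytic_continuation_open[of "{w. norm w > R}" above "Cauchy_integral u" "\<lambda>_. 0"])
    show "open {w::complex. norm w > R}" by (intro open_Collect_less continuous_intros)
    show "{w::complex. norm w > R} \<noteq> {}"
      using R by (auto intro!: exI[of _ "of_real (R + 1)"])
    show "{w::complex. norm w > R} \<subseteq> above"
    proof
      fix w :: complex assume "w \<in> {w. norm w > R}"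
      then have w: "norm w > R" by simp
      then have "w \<noteq> 0" using R by auto
      then obtain x y where xy: "w = wave x y" "y = ln (norm w)" by (rule wave_surj)
      have "exp y = norm w" unfolding xy(1) by (rule norm_wave[symmetric])
      then have "exp y > 2 * exp H" using w unfolding R_def by simp
      then have "exp y > exp H" using exp_gt_zero[of H] by linarith
      then have "h x < y" using H(2)[of x] by simp
      then show "w \<in> above" using xy(1) wave_in_above_iff by simp
    qed
  qed (use open_above connected_above hol far w in auto)
qed

text \<open>For h = 0 this is exactly the Poisson kernel of radius e^(-\<epsilon>), normalised to
  mass 1: the two evaluation points are then mirror images in the unit circle.\<close>

definition jump_kernel :: "real \<Rightarrow> real \<Rightarrow> real \<Rightarrow> complex" where
  "jump_kernel \<epsilon> x y = tang y * curve y / (2*pi) *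
     (1 / (curve y - lev (- \<epsilon>) x) - 1 / (curve y - lev \<epsilon> x))"

lemma curve_ne_lev: "s \<noteq> 0 \<Longrightarrow> curve y - lev s x \<noteq> 0"
  using lev_in_below_iff[of 0 y] lev_in_below_iff[of s x] lev_in_above_iff[of 0 y] lev_in_above_iff[of s x]
  by (metis eq_iff_diff_eq_0 less_irrefl linorder_neqE_linordered_idom)

lemma Cauchy_integral_jump:
  assumes u: "integrable circ u" and e: "\<epsilon> > 0"
  shows "(\<integral>y. jump_kernel \<epsilon> x y * u y \<partial>circ) = Cauchy_integral u (lev (- \<epsilon>) x) - Cauchy_integral u (lev \<epsilon> x)"
proof -
  have i: "integrable circ (\<lambda>y. u y * tang y * curve y / (curve y - lev s x))" if "s \<noteq> 0" for s
    using integrable_circ_mult_continuous[OF integrable_tang_curve[OF u], of "\<lambda>y. 1 / (curve y - lev s x)"]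
      curve_ne_lev[OF that] by (simp add: continuous_intros cont_lev)
  have "(\<integral>y. jump_kernel \<epsilon> x y * u y \<partial>circ)
      = (\<integral>y. (u y * tang y * curve y / (curve y - lev (- \<epsilon>) x) - u y * tang y * curve y / (curve y - lev \<epsilon> x)) / (2*pi) \<partial>circ)"
    by (rule Bochner_Integration.integral_cong) (auto simp: jump_kernel_def field_simps)
  also have "\<dots> = Cauchy_integral u (lev (- \<epsilon>) x) - Cauchy_integral u (lev \<epsilon> x)"
    using e unfolding integral_divide_zero
    by (subst Bochner_Integration.integral_diff) (auto simp: i Cauchy_integral_def diff_divide_distrib)
  finally show ?thesis .
qed

text \<open>The curve winds once around a point below it and not at all around a point above
  it.\<close>

lemma jump_kernel_integral:
  assumes "\<epsilon> > 0"
  shows "(\<integral>y. jump_kernel \<epsilon> x y \<partial>circ) = 1"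
  using Cauchy_integral_jump[of "\<lambda>_. 1" \<epsilon> x] assms winding_below[of "lev (- \<epsilon>) x"] winding_above[of "lev \<epsilon> x"]
  by (simp add: Cauchy_integral_def lev_in_below_iff lev_in_above_iff)

text \<open>Each Cauchy kernel alone has a singularity of first order. In the difference 1/a - 1/b =
  (b - a)/(ab) the numerator is O(\<epsilon>), because the two levels are dilates of each other, and
  \<open>lev_diff_bound\<close> controls the denominator.\<close>

lemma jump_kernel_bound:
  obtains A where "A > 0" "\<And>\<epsilon> x y. 0 < \<epsilon> \<Longrightarrow> \<epsilon> < 1 \<Longrightarrow> x \<in> {0..2*pi} \<Longrightarrow> y \<in> {0..2*pi} \<Longrightarrow>
      norm (jump_kernel \<epsilon> x y) \<le> A * kernel_majorant \<epsilon> x y"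
proof -
  obtain c where c: "c > 0" "\<And>x y s. x \<in> {0..2*pi} \<Longrightarrow> y \<in> {0..2*pi} \<Longrightarrow> \<bar>s\<bar> \<le> 1 \<Longrightarrow>
      c * (s\<^sup>2 + (sin ((x - y)/2))\<^sup>2) \<le> (norm (curve y - lev s x))\<^sup>2" using lev_diff_bound by blast
  obtain H where H: "H > 0" "\<And>x. \<bar>h x\<bar> \<le> H" using h_bounded by blast
  obtain T where T: "T > 0" "\<And>x. x \<in> {0..2*pi} \<Longrightarrow> norm (tang x) \<le> T" using tang_bounded by blast
  define A where "A = T * exp H / (2*pi) * (exp H * 3 / c)"
  show thesis
  proof (rule that)
    show "A > 0" using T(1) c(1) by (simp add: A_def)
    fix \<epsilon> x y :: real assume e: "0 < \<epsilon>" "\<epsilon> < 1" and x: "x \<in> {0..2*pi}" and y: "y \<in> {0..2*pi}"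
    define q where "q = \<epsilon>\<^sup>2 + (sin ((x - y)/2))\<^sup>2"
    have q: "q > 0" using e by (simp add: q_def add_pos_nonneg)
    define a where "a = curve y - lev (- \<epsilon>) x"
    define b where "b = curve y - lev \<epsilon> x"
    have ab: "a \<noteq> 0" "b \<noteq> 0" using curve_ne_lev e by (simp_all add: a_def b_def)
    have aq: "c * q \<le> (norm a)\<^sup>2" and bq: "c * q \<le> (norm b)\<^sup>2"
      using c(2)[OF x y, of "- \<epsilon>"] c(2)[OF x y, of \<epsilon>] e by (simp_all add: a_def b_def q_def)
    have prod: "c * q \<le> norm a * norm b"
    proof (rule power2_le_imp_le)
      have "(c * q) * (c * q) \<le> (norm a)\<^sup>2 * (norm b)\<^sup>2"
        using aq bq c(1) q by (intro mult_mono) auto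
      then show "(c * q)\<^sup>2 \<le> (norm a * norm b)\<^sup>2" by (simp add: power2_eq_square mult_ac)
    qed simp
    have num: "norm (b - a) \<le> exp H * 3 * \<epsilon>"
    proof -
      have "b - a = of_real (exp (- \<epsilon>) - exp \<epsilon>) * curve x"
        by (simp add: a_def b_def lev_curve[of "- \<epsilon>"] lev_curve[of \<epsilon>] algebra_simps)
      then have "norm (b - a) = \<bar>exp (- \<epsilon>) - exp \<epsilon>\<bar> * exp (h x)"
        by (simp only: norm_mult norm_of_real norm_lev add_0_right)
      also have "\<dots> \<le> (3 * \<epsilon>) * exp H"
      proof (rule mult_mono)
        \<comment> \<open>For \<epsilon> < 1, exp(\<epsilon>) - 1 is at most 2\<epsilon> and 1 -
          exp(-\<epsilon>) at most \<epsilon>.\<close>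
        have "exp \<epsilon> \<le> 1 + \<epsilon> + \<epsilon>\<^sup>2" using exp_bound[of \<epsilon>] e by simp
        also have "\<dots> \<le> 1 + 2 * \<epsilon>" using e by (simp add: power2_eq_square mult_left_le)
        finally show "\<bar>exp (- \<epsilon>) - exp \<epsilon>\<bar> \<le> 3 * \<epsilon>"
          using exp_ge_add_one_self[of "- \<epsilon>"] exp_le_cancel_iff[of "- \<epsilon>" \<epsilon>] e by linarith
        show "exp (h x) \<le> exp H" using H(2)[of x] by simp
      qed (use e in auto)
      finally show ?thesis by (simp add: mult_ac)
    qed
    have "norm (1 / a - 1 / b) = norm (b - a) / (norm a * norm b)"
      using ab by (simp add: diff_frac_eq norm_divide norm_mult)
    also have "\<dots> \<le> (exp H * 3 * \<epsilon>) / (c * q)"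
      by (rule frac_le) (use num prod c(1) q e in auto)
    finally have k1: "norm (1 / a - 1 / b) \<le> (exp H * 3 * \<epsilon>) / (c * q)" .
    have k2: "norm (tang y * curve y / (2*pi)) \<le> T * exp H / (2*pi)"
    proof -
      have "norm (tang y) * norm (curve y) \<le> T * exp H"
        using T(2)[OF y] H(2)[of y] T(1) by (intro mult_mono) (auto simp: norm_lev)
      then show ?thesis by (simp add: norm_divide norm_mult divide_right_mono)
    qed
    have "norm (jump_kernel \<epsilon> x y) = norm (tang y * curve y / (2*pi)) * norm (1 / a - 1 / b)"
      by (simp only: jump_kernel_def a_def b_def norm_mult)
    also have "\<dots> \<le> (T * exp H / (2*pi)) * ((exp H * 3 * \<epsilon>) / (c * q))"
      using k1 k2 T(1) by (intro mult_mono) auto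
    also have "\<dots> = A * (\<epsilon> / q)" by (simp add: A_def)
    finally show "norm (jump_kernel \<epsilon> x y) \<le> A * kernel_majorant \<epsilon> x y"
      by (simp add: kernel_majorant_def q_def)
  qed
qed

lemma jump_kernel_measurable:
  "(\<lambda>p. jump_kernel \<epsilon> (fst p) (snd p)) \<in> borel_measurable (circ \<Otimes>\<^sub>M circ)"
  unfolding jump_kernel_def
  using measurable_compose[OF measurable_fst, of "lev \<epsilon>" circ borel circ]
    measurable_compose[OF measurable_fst, of "lev (- \<epsilon>)" circ borel circ]
    measurable_compose[OF measurable_snd, of "curve" circ borel circ]
    measurable_compose[OF measurable_snd, of tang circ borel circ]
  by measurable

text \<open>
  If the moments vanish, the Cauchy integral is \<open>0\<close> above the curve, hence below the curve it
  equals its own jump, whose kernel is dominated by a Poisson kernel. No bound for the singular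
  Cauchy integral on the curve is needed.
\<close>

lemma Cauchy_integral_boundary_value:
  assumes u: "sqint u" and m: "moments_vanish u"
  shows "((\<lambda>\<epsilon>. nsq (\<lambda>x. Cauchy_integral u (lev (- \<epsilon>) x) - u x)) \<longlongrightarrow> 0) (at_right 0)"
proof -
  obtain A where A: "A > 0" "\<And>\<epsilon> x y. 0 < \<epsilon> \<Longrightarrow> \<epsilon> < 1 \<Longrightarrow> x \<in> {0..2*pi} \<Longrightarrow> y \<in> {0..2*pi} \<Longrightarrow>
      norm (jump_kernel \<epsilon> x y) \<le> A * kernel_majorant \<epsilon> x y" using jump_kernel_bound by blast
  note iu = sqint_L1(1)[OF u]
  have lim: "((\<lambda>\<epsilon>. nsq (\<lambda>x. (\<integral>y. jump_kernel \<epsilon> x y * u y \<partial>circ) - u x)) \<longlongrightarrow> 0) (at_right 0)"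
    by (rule approximate_identity[OF jump_kernel_measurable A jump_kernel_integral u])
  have "(\<integral>y. jump_kernel \<epsilon> x y * u y \<partial>circ) = Cauchy_integral u (lev (- \<epsilon>) x)" if "\<epsilon> > 0" for \<epsilon> x
    using Cauchy_integral_jump[OF iu that] Cauchy_integral_above_eq_0[OF iu m, of "lev \<epsilon> x"] that
    by (simp add: lev_in_above_iff)
  then have "\<forall>\<^sub>F \<epsilon> in at_right 0. nsq (\<lambda>x. (\<integral>y. jump_kernel \<epsilon> x y * u y \<partial>circ) - u x)
      = nsq (\<lambda>x. Cauchy_integral u (lev (- \<epsilon>) x) - u x)"
    by (intro eventually_at_rightI[of 0 1]) auto
  then show ?thesis using lim by (rule Lim_transform_eventually[rotated])
qed

text \<open>The difference quotient G is analytic on the whole domain, so its integral over the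
  level vanishes and only a winding number remains. The condition on w says that it lies inside the
  level: dilation by e^\<epsilon> turns that level into the curve itself.\<close>

lemma Cauchy_formula:
  fixes F :: "complex \<Rightarrow> complex"
  assumes F: "F holomorphic_on below" and e: "\<epsilon> > 0" and w: "of_real (exp \<epsilon>) * w \<in> below"
  shows "(\<integral>x. F (lev (- \<epsilon>) x) * tang x * lev (- \<epsilon>) x / (lev (- \<epsilon>) x - w) \<partial>circ) = 2*pi * F w"
proof -
  define G where "G = (\<lambda>z. if z = w then deriv F w else (F z - F w) / (z - w))"
  have G: "G holomorphic_on below"
    unfolding G_def by (rule pole_lemma_open[OF F open_below])
  have rel: "lev (- \<epsilon>) x - w = of_real (exp (- \<epsilon>)) * (curve x - of_real (exp \<epsilon>) * w)" for x
    unfolding lev_curve[of "- \<epsilon>"] by (simp add: algebra_simps exp_minus)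
  have ne: "lev (- \<epsilon>) x - w \<noteq> 0" for x
  proof -
    have "curve x \<noteq> of_real (exp \<epsilon>) * w" using w curve_notin(1)[of x] by metis
    then show ?thesis unfolding rel by simp
  qed
  let ?l = "lev (- \<epsilon>)"
  have wind: "(\<integral>x. tang x * ?l x / (?l x - w) \<partial>circ) = 2*pi"
  proof -
    have "tang x * ?l x / (?l x - w) = tang x * curve x / (curve x - of_real (exp \<epsilon>) * w)" for x
      unfolding rel unfolding lev_curve[of "- \<epsilon>"] by simp
    then show ?thesis using winding_below[OF w] by simp
  qed
  have i1: "integrable circ (\<lambda>x. F (?l x) * tang x * ?l x / (?l x - w))"
    and i2: "integrable circ (\<lambda>x. F w * (tang x * ?l x / (?l x - w)))"
    using ne by (auto intro!: integrable_circ_continuous continuous_intros cont_tang cont_lev continuous_on_level[OF F e])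
  have "0 = (\<integral>x. G (?l x) * ?l x * tang x \<partial>circ)"
    by (rule integral_level_zero[OF G e, symmetric])
  also have "\<dots> = (\<integral>x. F (?l x) * tang x * ?l x / (?l x - w) - F w * (tang x * ?l x / (?l x - w)) \<partial>circ)"
  proof (rule Bochner_Integration.integral_cong[OF refl])
    fix x
    show "G (?l x) * ?l x * tang x = F (?l x) * tang x * ?l x / (?l x - w) - F w * (tang x * ?l x / (?l x - w))"
    proof -
      have "(A - B) / d * l * t = A * t * l / d - B * (t * l / d)" for A B d l t :: complex
        by (simp add: diff_divide_distrib algebra_simps)
      moreover have "G (?l x) = (F (?l x) - F w) / (?l x - w)" using ne[of x] by (auto simp: G_def)
      ultimately show ?thesis by (simp only:)
    qed
  qed
  also have "\<dots> = (\<integral>x. F (?l x) * tang x * ?l x / (?l x - w) \<partial>circ) - F w * (2*pi)"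
    unfolding Bochner_Integration.integral_diff[OF i1 i2] integral_mult_right_zero wind by simp
  finally show ?thesis by simp
qed

lemma Cauchy_formula_0:
  fixes F :: "complex \<Rightarrow> complex"
  assumes "F holomorphic_on below" "\<epsilon> > 0"
  shows "(\<integral>x. F (lev (- \<epsilon>) x) * tang x \<partial>circ) = 2*pi * F 0"
  using Cauchy_formula[OF assms, of 0] zero_in_below by simp

text \<open>The right-hand side does not depend on \<epsilon>, which lets the identity pass to the
  boundary.\<close>

lemma level_square_integral:
  fixes F :: "complex \<Rightarrow> complex"
  assumes "F holomorphic_on below" "\<epsilon> > 0"
  shows "(\<integral>x. (F (lev (- \<epsilon>) x))\<^sup>2 * tang x \<partial>circ) = 2*pi * (F 0)\<^sup>2"
  using Cauchy_formula_0[of "\<lambda>w. (F w)\<^sup>2" \<epsilon>] assms by (simp add: holomorphic_on_power)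

lemma sqint_level:
  fixes F :: "complex \<Rightarrow> complex"
  assumes "F holomorphic_on below" "\<epsilon> > 0"
  shows "sqint (\<lambda>x. F (lev (- \<epsilon>) x))"
  by (rule sqint_continuous[OF continuous_on_level[OF assms]])

text \<open>The boundary is reached only through L^2 convergence of the level traces; this is enough
  because F enters quadratically and \<open>tang\<close> is bounded.\<close>

lemma boundary_square_integral:
  assumes u: "sqint u" and m: "moments_vanish u"
  shows "(\<integral>x. (u x)\<^sup>2 * tang x \<partial>circ) = 2*pi * (Cauchy_integral u 0)\<^sup>2"
proof -
  let ?F = "Cauchy_integral u"
  have F: "?F holomorphic_on below"
    by (rule Cauchy_integral_holomorphic[OF sqint_L1(1)[OF u] curve_notin(1)])
  obtain T where T: "T > 0" "\<And>x. x \<in> {0..2*pi} \<Longrightarrow> norm (tang x) \<le> T" using tang_bounded by blast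
  have "((\<lambda>\<epsilon>. \<integral>x. (?F (lev (- \<epsilon>) x))\<^sup>2 * tang x \<partial>circ) \<longlongrightarrow> (\<integral>x. (u x)\<^sup>2 * tang x \<partial>circ)) (at_right 0)"
    by (rule tendsto_integral_square[OF _ u _ T(2) Cauchy_integral_boundary_value[OF u m]])
       (auto intro!: eventually_at_rightI[of 0 1] sqint_level[OF F])
  moreover have "\<forall>\<^sub>F \<epsilon> in at_right 0. (\<integral>x. (?F (lev (- \<epsilon>) x))\<^sup>2 * tang x \<partial>circ) = 2*pi * (?F 0)\<^sup>2"
    by (intro eventually_at_rightI[of 0 1]) (auto simp: level_square_integral[OF F])
  ultimately have "((\<lambda>\<epsilon>::real. 2*pi * (?F 0)\<^sup>2) \<longlongrightarrow> (\<integral>x. (u x)\<^sup>2 * tang x \<partial>circ)) (at_right 0)"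
    by (rule Lim_transform_eventually)
  then show ?thesis
    by (simp add: tendsto_const_iff)
qed

text \<open>
  The Cauchy integral \<open>F\<close> of \<open>g\<close> has boundary value \<open>g\<close> and \<open>F(0)\<close> is purely imaginary, so the real
  part of \<open>\<integral>g\<^sup>2(1 + ih\<^sub>x) = 2\<pi>F(0)\<^sup>2\<close> gives \<open>\<integral>g\<^sup>2 \<le> 0\<close>.
\<close>

lemma real_moments_vanish_imp_zero:
  assumes g: "sqint g" and mean: "(\<integral>x. g x \<partial>circ) = 0" and m: "moments_vanish (\<lambda>x. of_real (g x))"
  shows "nsq g = 0"
proof -
  have sg: "sqint (\<lambda>x. of_real (g x) :: complex)" using g by (simp add: sqint_of_real)
  obtain T where T: "T > 0" "\<And>x. x \<in> {0..2*pi} \<Longrightarrow> norm (tang x) \<le> T" using tang_bounded by blast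
  have ig: "integrable circ (\<lambda>x. of_real (g x) * tang x)"
    by (rule integrable_circ_mult_continuous[OF sqint_L1(1)[OF sg] cont_tang])
  have ig2: "integrable circ (\<lambda>x. (of_real (g x))\<^sup>2 * tang x)"
  proof -
    have "integrable circ (\<lambda>x. of_real ((g x)\<^sup>2) :: complex)"
      using g by (intro integrable_of_real) (simp add: sqint_def)
    from integrable_circ_mult_continuous[OF this cont_tang] show ?thesis by simp
  qed
  define a where "a = (\<integral>x. of_real (g x) * tang x \<partial>circ)"
  have "Re a = (\<integral>x. Re (of_real (g x) * tang x) \<partial>circ)"
    unfolding a_def by (rule integral_Re[OF ig, symmetric])
  also have "\<dots> = 0" using mean by (simp add: tang_def)
  finally have Rea: "Re a = 0" .
  have "nsq g = (\<integral>x. Re ((of_real (g x))\<^sup>2 * tang x) \<partial>circ)"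
    unfolding nsq_def by (rule Bochner_Integration.integral_cong) (auto simp: tang_def power2_eq_square)
  also have "\<dots> = Re (\<integral>x. (of_real (g x))\<^sup>2 * tang x \<partial>circ)"
    by (rule integral_Re[OF ig2])
  also have "\<dots> = Re (2*pi * (a / (2*pi))\<^sup>2)"
    using boundary_square_integral[OF sg m] by (simp add: Cauchy_integral_zero a_def)
  also have "\<dots> \<le> 0"
  proof -
    obtain b where "a = \<i> * of_real b" using Rea by (metis complex_eq mult_zero_left add.left_neutral of_real_0)
    then show ?thesis by (simp add: power2_eq_square)
  qed
  finally show ?thesis using nsq_nonneg[of g] by linarith
qed

end

section \<open>Rellich's inequality\<close>

lemma Rellich_pointwise:
  fixes u t :: complex
  assumes "Re t = 1"
  shows "(Im (u * t))\<^sup>2 / (norm t)\<^sup>2 \<le> 4 * (Re (u * t))\<^sup>2 - 2 * Re (u\<^sup>2 * t)"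
proof -
  define a b m where "a = Re u" and "b = Im u" and "m = Im t"
  \<comment> \<open>g is the tangential derivative Re(ut) and q = |t|^2. In these terms Im(ut) = m g
    + b q and Re(u^2 t) = g^2 - b^2 q, so the square integral trades b^2 q for g^2. The constant 4
    is 2 from splitting the sum plus 2 from this trade.\<close>
  define q g where "q = 1 + m\<^sup>2" and "g = a - b * m"
  have q: "q > 0" "m\<^sup>2 \<le> q" by (simp_all add: q_def add_pos_nonneg)
  have t: "(norm t)\<^sup>2 = q" by (simp add: cmod_power2 assms q_def m_def)
  have n: "Im (u * t) = m * g + b * q"
    by (simp add: assms a_def b_def m_def g_def q_def power2_eq_square algebra_simps)
  have "(m * g + b * q)\<^sup>2 \<le> 2 * (m * g)\<^sup>2 + 2 * (b * q)\<^sup>2"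
    using norm_add_sq_le[of "m * g" "b * q"] by simp
  also have "\<dots> = 2 * m\<^sup>2 * g\<^sup>2 + 2 * b\<^sup>2 * q\<^sup>2" by (simp add: power_mult_distrib)
  also have "\<dots> \<le> 2 * q * g\<^sup>2 + 2 * b\<^sup>2 * q\<^sup>2"
    using q(2) by (intro add_right_mono mult_right_mono) auto
  also have "\<dots> = (2 * g\<^sup>2 + 2 * b\<^sup>2 * q) * q" by (simp add: power2_eq_square algebra_simps)
  also have "2 * g\<^sup>2 + 2 * b\<^sup>2 * q = 4 * (Re (u * t))\<^sup>2 - 2 * Re (u\<^sup>2 * t)"
    by (simp add: assms a_def[symmetric] b_def[symmetric] m_def[symmetric] g_def q_def power2_eq_square algebra_simps)
  finally show ?thesis
    unfolding n t pos_divide_le_eq[OF q(1)] .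
qed

text \<open>The first order condition at a minimum, read off at t = A/(B + 1), which is defined also
  for B = 0.\<close>

lemma quadratic_nonneg_imp_zero:
  fixes A B :: real
  assumes "\<And>t. 0 \<le> - 2 * t * A + t\<^sup>2 * B" "0 \<le> B"
  shows "A = 0"
proof -
  define s where "s = 1 / (B + 1)"
  have s: "s > 0" "s * B < 1" using assms(2) by (simp_all add: s_def)
  have "0 \<le> - 2 * (s * A) * A + (s * A)\<^sup>2 * B" by (rule assms(1))
  also have "\<dots> = (A\<^sup>2 * s) * (s * B - 2)" by (simp add: power2_eq_square algebra_simps)
  finally have "0 \<le> (A\<^sup>2 * s) * (s * B - 2)" .
  then have "A\<^sup>2 * s \<le> 0" using s(2) by (simp add: zero_le_mult_iff)
  then have "A\<^sup>2 \<le> 0" using s(1) by (simp add: mult_le_0_iff)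
  then show ?thesis by simp
qed

context periodic_graph begin

lemma sqint_mult_tang: "sqint u \<Longrightarrow> sqint (\<lambda>x. u x * tang x)"
proof -
  assume u: "sqint u"
  obtain T where T: "T > 0" "\<And>x. x \<in> {0..2*pi} \<Longrightarrow> norm (tang x) \<le> T" using tang_bounded by blast
  show ?thesis
    using sqint_mult_bounded(1)[OF tang_measurable_circ u T(2)] by (simp add: mult.commute)
qed

lemma norm_tang_ge_1: "1 \<le> norm (tang x)"
  using abs_Re_le_cmod[of "tang x"] by (simp add: tang_def)

lemma sqint_normal_component:
  assumes u: "sqint u"
  shows "sqint (\<lambda>x. Im (u x * tang x) / norm (tang x))"
proof (rule sqint_dominated(1)[OF _ sqint_Im(1)[OF sqint_mult_tang[OF u]]])
  show "(\<lambda>x. Im (u x * tang x) / norm (tang x)) \<in> borel_measurable circ"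
    using sqint_measurable[OF u] by measurable
  show "AE x in circ. norm (Im (u x * tang x) / norm (tang x)) \<le> 1 * norm (Im (u x * tang x))"
  proof (rule AE_I2)
    fix x
    have "\<bar>Im (u x * tang x)\<bar> / norm (tang x) \<le> \<bar>Im (u x * tang x)\<bar> / 1"
      using norm_tang_ge_1[of x] by (intro divide_left_mono) auto
    then show "norm (Im (u x * tang x) / norm (tang x)) \<le> 1 * norm (Im (u x * tang x))"
      by (simp add: abs_divide)
  qed
qed

text \<open>For u = phi_x - i phi_y on the boundary the first inequality is the estimate of the
  normal derivative. The second, with 5 = 4 + 1, recovers u from its tangential part alone and
  drives the projection argument. Neither constant depends on h.\<close>

lemma Rellich:
  assumes u: "sqint u" and z: "(\<integral>x. (u x)\<^sup>2 * tang x \<partial>circ) = 0"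
  shows "nsq (\<lambda>x. Im (u x * tang x) / norm (tang x)) \<le> 4 * nsq (\<lambda>x. Re (u x * tang x))"
    and "nsq u \<le> 5 * nsq (\<lambda>x. Re (u x * tang x))"
proof -
  have sut: "sqint (\<lambda>x. u x * tang x)" by (rule sqint_mult_tang[OF u])
  define n where "n x = Im (u x * tang x) / norm (tang x)" for x
  define g where "g x = Re (u x * tang x)" for x
  note t1 = norm_tang_ge_1
  have sn: "sqint n" unfolding n_def by (rule sqint_normal_component[OF u])
  have sg: "sqint g" unfolding g_def by (rule sqint_Re(1)[OF sut])
  have iu: "integrable circ (\<lambda>x. (u x)\<^sup>2 * tang x)"
    using sqint_mult(1)[OF u sut] by (simp add: power2_eq_square mult.assoc)
  have "nsq n = (\<integral>x. (n x)\<^sup>2 \<partial>circ)" by (simp add: nsq_def)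
  also have "\<dots> \<le> (\<integral>x. 4 * (g x)\<^sup>2 - 2 * Re ((u x)\<^sup>2 * tang x) \<partial>circ)"
  proof (rule integral_mono)
    fix x
    show "(n x)\<^sup>2 \<le> 4 * (g x)\<^sup>2 - 2 * Re ((u x)\<^sup>2 * tang x)"
      using Rellich_pointwise[of "tang x" "u x"] unfolding n_def g_def power_divide by (simp add: tang_def)
  qed (use sn sg iu in \<open>auto simp: sqint_def simp del: times_complex.sel\<close>)
  also have "\<dots> = 4 * nsq g - 2 * Re (\<integral>x. (u x)\<^sup>2 * tang x \<partial>circ)"
    using sg iu by (simp add: sqint_def nsq_def del: times_complex.sel)
  finally have 1: "nsq n \<le> 4 * nsq g" using z by simp
  then show "nsq (\<lambda>x. Im (u x * tang x) / norm (tang x)) \<le> 4 * nsq (\<lambda>x. Re (u x * tang x))"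
    by (simp add: n_def[abs_def] g_def[abs_def])
  have "nsq u \<le> (\<integral>x. (g x)\<^sup>2 + (n x)\<^sup>2 \<partial>circ)"
    unfolding nsq_def
  proof (rule integral_mono)
    fix x
    have "(norm (u x))\<^sup>2 * (norm (tang x))\<^sup>2 = (g x)\<^sup>2 + (n x)\<^sup>2 * (norm (tang x))\<^sup>2"
      using cmod_power2[of "u x * tang x"] t1[of x]
      by (simp add: n_def g_def norm_mult power_mult_distrib power_divide)
    also have "\<dots> \<le> (g x)\<^sup>2 * (norm (tang x))\<^sup>2 + (n x)\<^sup>2 * (norm (tang x))\<^sup>2"
      using t1[of x] by (simp add: mult_le_cancel_left1 power_le_one_iff one_le_power)
    finally have "(norm (u x))\<^sup>2 * (norm (tang x))\<^sup>2 \<le> ((g x)\<^sup>2 + (n x)\<^sup>2) * (norm (tang x))\<^sup>2"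
      by (simp add: distrib_right)
    then show "(norm (u x))\<^sup>2 \<le> (g x)\<^sup>2 + (n x)\<^sup>2"
      by (rule mult_right_le_imp_le) (use t1[of x] in auto)
  qed (use u sn sg in \<open>auto simp: sqint_def\<close>)
  also have "\<dots> = nsq g + nsq n" using sn sg by (simp add: sqint_def nsq_def)
  finally show "nsq u \<le> 5 * nsq (\<lambda>x. Re (u x * tang x))"
    using 1 by (simp add: g_def[abs_def])
qed

subsection \<open>Analytic functions with prescribed real part of the boundary differential\<close>

text \<open>Boundary values of the polynomials that vanish at w = 0. The extra factor sets the value
  at y = -infinity to zero, so Cauchy's theorem makes the square integral vanish and Rellich's
  inequality applies.\<close>

definition poly_trace :: "complex poly \<Rightarrow> real \<Rightarrow> complex" where
  "poly_trace p x = curve x * poly p (curve x)"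

lemma cont_poly_trace: "continuous_on S (poly_trace p)"
  unfolding poly_trace_def by (intro continuous_intros cont_lev)

lemma sqint_poly_trace: "sqint (poly_trace p)"
  by (rule sqint_continuous[OF cont_poly_trace])

lemma integral_poly_trace: "(\<integral>x. poly_trace p x * tang x * curve x ^ j \<partial>circ) = 0"
proof -
  obtain G where G: "\<And>w. (G has_field_derivative poly p w * w ^ j) (at w)"
  proof -
    have fd: "(\<lambda>w. poly p w * w ^ j) field_differentiable (at w)" for w :: complex
      unfolding field_differentiable_def by (auto intro!: derivative_eq_intros poly_DERIV)
    have "starlike (UNIV :: complex set)" by (simp add: convex_imp_starlike)
    then have "\<exists>G. \<forall>w\<in>UNIV. (G has_field_derivative poly p w * w ^ j) (at w)"
      by (intro holomorphic_starlike_primitive[where k="{}"]) (auto intro!: continuous_intros fd)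
    then show thesis using that by blast
  qed
  have "(\<integral>x. (poly p (curve x) * curve x ^ j) * curve x * tang x \<partial>circ) = 0"
    by (rule integral_level_exact[OF G]) (intro continuous_intros cont_lev)
  then show ?thesis by (simp add: poly_trace_def mult_ac)
qed

lemma Rellich_poly_trace: "nsq (poly_trace p) \<le> 5 * nsq (\<lambda>x. Re (poly_trace p x * tang x))"
proof (rule Rellich(2)[OF sqint_poly_trace])
  have "moments_vanish (poly_trace p)" by (simp add: moments_vanish_def integral_poly_trace)
  then show "(\<integral>x. (poly_trace p x)\<^sup>2 * tang x \<partial>circ) = 0"
    using boundary_square_integral[OF sqint_poly_trace] integral_poly_trace[of p 0]
    by (simp add: Cauchy_integral_zero)
qed

text \<open>
  Orthogonal projection of \<open>g\<close> onto the closure of the functions \<open>Re (p(\<gamma>)(1 + ih\<^sub>x))\<close>, \<open>p\<close> a polynomial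
  with \<open>p(0) = 0\<close>. Rellich's inequality turns convergence of these real parts into convergence of
  the \<open>p(\<gamma>)\<close>; the remainder is orthogonal to all of them, hence has vanishing moments.
\<close>

theorem exists_analytic_boundary_function:
  assumes g: "sqint g" and mean: "(\<integral>x. g x \<partial>circ) = 0"
  obtains u where "sqint u" "moments_vanish u" "(\<integral>x. u x * tang x \<partial>circ) = 0"
    "AE x in circ. Re (u x * tang x) = g x"
proof -
  obtain T where T: "T > 0" "\<And>x. x \<in> {0..2*pi} \<Longrightarrow> norm (tang x) \<le> T" using tang_bounded by blast
  define R where "R p x = Re (poly_trace p x * tang x)" for p x
  have sR: "sqint (R p)" for p
    unfolding R_def by (rule sqint_Re(1)[OF sqint_mult_tang[OF sqint_poly_trace]])
  have sgR: "sqint (\<lambda>x. g x - R p x)" for p by (rule sqint_diff(1)[OF g sR])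
  define d where "d p = nsq (\<lambda>x. g x - R p x)" for p
  define m where "m = Inf (range d)"
  have d0: "0 \<le> d p" for p by (simp add: d_def)
  have bdd: "bdd_below (range d)" by (rule bdd_belowI[of _ 0]) (use d0 in auto)
  have m_le: "m \<le> d p" for p unfolding m_def by (rule cInf_lower[OF _ bdd]) simp
  have "\<exists>p. d p < m + (1/4)^n" for n :: nat
    using cInf_lessD[of "range d" "m + (1/4)^n"] by (auto simp: m_def)
  \<comment> \<open>A minimising sequence; the rate (1/4)^n is the one that
    \<open>Riesz_Fischer\<close> asks for.\<close>
  then obtain p where p: "\<And>n. d (p n) < m + (1/4)^n" by metis
  have cauchy: "nsq (\<lambda>x. poly_trace (p n) x - poly_trace (p k) x) \<le> 10 * ((1/4)^n + (1/4)^k)" for n k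
  proof -
    \<comment> \<open>The midpoint in the parallelogram law; its squared distance to g is at least
      the infimum m.\<close>
    define q where "q = smult (1/2) (p n + p k)"
    have R_diff: "R (p n - p k) x = R (p n) x - R (p k) x" for x
      by (simp add: R_def poly_trace_def algebra_simps)
    have R_q: "R q x = (R (p n) x + R (p k) x) / 2" for x
    proof -
      have "poly_trace q x = (poly_trace (p n) x + poly_trace (p k) x) / 2"
        by (simp add: q_def poly_trace_def algebra_simps add_divide_distrib)
      then have "poly_trace q x * tang x = (poly_trace (p n) x * tang x + poly_trace (p k) x * tang x) / 2"
        by (simp only: distrib_right times_divide_eq_left)
      then show ?thesis by (simp only: R_def Re_divide_numeral plus_complex.sel)
    qed
    have "nsq (\<lambda>x. poly_trace (p n) x - poly_trace (p k) x) = nsq (poly_trace (p n - p k))"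
      by (simp add: poly_trace_def[abs_def] algebra_simps)
    also have "\<dots> \<le> 5 * nsq (R (p n - p k))"
      using Rellich_poly_trace by (simp add: R_def[abs_def])
    also have "nsq (R (p n - p k)) = 2 * d (p n) + 2 * d (p k) - 4 * d q"
    proof -
      have "nsq (R (p n - p k)) = (\<integral>x. 2 * (g x - R (p n) x)\<^sup>2 + 2 * (g x - R (p k) x)\<^sup>2 - 4 * (g x - R q x)\<^sup>2 \<partial>circ)"
        unfolding nsq_def
        by (rule Bochner_Integration.integral_cong) (auto simp: R_diff R_q power2_eq_square field_simps)
      then show ?thesis
        using sgR[of "p n"] sgR[of "p k"] sgR[of q] by (simp add: d_def nsq_def sqint_def)
    qed
    also have "5 * (2 * d (p n) + 2 * d (p k) - 4 * d q) \<le> 10 * ((1/4)^n + (1/4)^k)"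
    proof -
      have "5 * (2 * A + 2 * B - 4 * D) \<le> 10 * (a + b)" if "A < m + a" "B < m + b" "m \<le> D" for A B D a b :: real
        using that by (simp add: algebra_simps)
      from this[OF p[of n] p[of k] m_le[of q]] show ?thesis .
    qed
    finally show ?thesis .
  qed
  obtain u where u: "sqint u" and lim: "(\<lambda>n. nsq (\<lambda>x. poly_trace (p n) x - u x)) \<longlonglongrightarrow> 0"
    by (rule Riesz_Fischer[of "\<lambda>n. poly_trace (p n)" 10, OF sqint_poly_trace _ cauchy]) auto
  have mom: "(\<integral>x. u x * tang x * curve x ^ j \<partial>circ) = 0" for j
  proof -
    have "sqint (\<lambda>x. tang x * curve x ^ j)"
      by (rule sqint_continuous) (intro continuous_intros cont_tang cont_lev)
    from tendsto_integral_mult[OF _ u this lim]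
    have "(\<lambda>n. \<integral>x. poly_trace (p n) x * (tang x * curve x ^ j) \<partial>circ) \<longlonglongrightarrow> (\<integral>x. u x * (tang x * curve x ^ j) \<partial>circ)"
      by (simp add: sqint_poly_trace)
    then have "(\<lambda>n::nat. 0::complex) \<longlonglongrightarrow> (\<integral>x. u x * tang x * curve x ^ j \<partial>circ)"
      using integral_poly_trace by (simp add: mult.assoc)
    then show ?thesis by (simp add: LIMSEQ_const_iff)
  qed
  have sut: "sqint (\<lambda>x. u x * tang x)" by (rule sqint_mult_tang[OF u])
  define g0 where "g0 x = g x - Re (u x * tang x)" for x
  have sg0: "sqint g0" unfolding g0_def by (rule sqint_diff(1)[OF g sqint_Re(1)[OF sut]])
  have lim0: "(\<lambda>n. nsq (\<lambda>x. (g x - R (p n) x) - g0 x)) \<longlonglongrightarrow> 0"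
  proof (rule tendsto_sandwich[of "\<lambda>_. 0" _ _ "\<lambda>n. T\<^sup>2 * nsq (\<lambda>x. poly_trace (p n) x - u x)"])
    show "(\<lambda>n. T\<^sup>2 * nsq (\<lambda>x. poly_trace (p n) x - u x)) \<longlonglongrightarrow> 0"
      using tendsto_mult_right_zero[OF lim] .
    have "nsq (\<lambda>x. (g x - R (p n) x) - g0 x) \<le> T\<^sup>2 * nsq (\<lambda>x. poly_trace (p n) x - u x)" for n
    proof -
      have sd: "sqint (\<lambda>x. poly_trace (p n) x - u x)" by (rule sqint_diff(1)[OF sqint_poly_trace u])
      have "nsq (\<lambda>x. (g x - R (p n) x) - g0 x) = nsq (\<lambda>x. Re (tang x * (poly_trace (p n) x - u x)))"
        unfolding nsq_def
        by (rule Bochner_Integration.integral_cong) (auto simp: R_def g0_def algebra_simps power2_eq_square)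
      also have "\<dots> \<le> nsq (\<lambda>x. tang x * (poly_trace (p n) x - u x))"
        by (rule sqint_Re(2)[OF sqint_mult_bounded(1)[OF tang_measurable_circ sd T(2)]])
      also have "\<dots> \<le> T\<^sup>2 * nsq (\<lambda>x. poly_trace (p n) x - u x)"
        by (rule sqint_mult_bounded(2)[OF tang_measurable_circ sd T(2)])
      finally show ?thesis .
    qed
    then show "\<forall>\<^sub>F n in sequentially. nsq (\<lambda>x. (g x - R (p n) x) - g0 x) \<le> T\<^sup>2 * nsq (\<lambda>x. poly_trace (p n) x - u x)"
      by simp
  qed auto
  \<comment> \<open>The limit need not be recognised as a minimiser: p n is minimal up to (1/4)^n,
    and the quadratic inequality appears as n grows.\<close>
  have orth: "(\<integral>x. g0 x * R q x \<partial>circ) = 0" for q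
  proof (rule quadratic_nonneg_imp_zero[of _ "nsq (R q)"])
    fix t :: real
    have lower: "- ((1/4)^n) \<le> - 2 * t * (\<integral>x. (g x - R (p n) x) * R q x \<partial>circ) + t\<^sup>2 * nsq (R q)" for n
    proof -
      have Rq: "R (p n + smult (of_real t) q) x = R (p n) x + t * R q x" for x
      proof -
        have "poly_trace (p n + smult (of_real t) q) x * tang x = poly_trace (p n) x * tang x + of_real t * (poly_trace q x * tang x)"
          by (simp add: poly_trace_def algebra_simps)
        then show ?thesis by (simp only: R_def Re_complex_of_real plus_complex.sel times_complex.sel Im_complex_of_real)
      qed
      have i: "integrable circ (\<lambda>x. (g x - R (p n) x) * R q x)" by (rule sqint_mult(1)[OF sgR sR])
      have "d (p n + smult (of_real t) q) = (\<integral>x. (g x - R (p n) x)\<^sup>2 - 2 * t * ((g x - R (p n) x) * R q x) + t\<^sup>2 * (R q x)\<^sup>2 \<partial>circ)"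
        unfolding d_def nsq_def Rq
        by (rule Bochner_Integration.integral_cong) (auto simp: power2_eq_square algebra_simps)
      also have "\<dots> = d (p n) - 2 * t * (\<integral>x. (g x - R (p n) x) * R q x \<partial>circ) + t\<^sup>2 * nsq (R q)"
        using i sgR[of "p n"] sR[of q] by (simp add: d_def nsq_def sqint_def)
      finally show ?thesis using m_le[of "p n + smult (of_real t) q"] p[of n] by linarith
    qed
    have l1: "(\<lambda>n. - 2 * t * (\<integral>x. (g x - R (p n) x) * R q x \<partial>circ) + t\<^sup>2 * nsq (R q))
        \<longlonglongrightarrow> - 2 * t * (\<integral>x. g0 x * R q x \<partial>circ) + t\<^sup>2 * nsq (R q)"
      by (intro tendsto_intros tendsto_integral_mult[OF _ sg0 sR lim0]) (simp add: sgR)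
    have l2: "(\<lambda>n. - ((1/4)^n) :: real) \<longlonglongrightarrow> - 0"
      by (intro tendsto_intros LIMSEQ_realpow_zero) auto
    show "0 \<le> - 2 * t * (\<integral>x. g0 x * R q x \<partial>circ) + t\<^sup>2 * nsq (R q)"
      using LIMSEQ_le[OF l2 l1] lower by auto
  qed simp
  have "moments_vanish (\<lambda>x. of_real (g0 x))"
    unfolding moments_vanish_def
  proof (intro allI impI)
    fix j :: nat assume "j > 0"
    \<comment> \<open>The exponent is j - 1 because \<open>poly_trace\<close> multiplies by the
      curve. The polynomials q and i q test the real and the imaginary part of the moment.\<close>
    define q :: "complex poly" where "q = monom 1 (j - 1)"
    have q: "poly_trace q x = curve x ^ j" for x
      using \<open>j > 0\<close> by (cases j) (simp_all add: q_def poly_trace_def poly_monom)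
    have iq: "poly_trace (smult \<i> q) x = \<i> * curve x ^ j" for x
      using q[of x] by (simp add: poly_trace_def)
    let ?I = "\<lambda>x. of_real (g0 x) * tang x * curve x ^ j"
    have ii: "integrable circ ?I"
    proof -
      have "integrable circ (\<lambda>x. of_real (g0 x) :: complex)"
        using sqint_L1(1)[OF sg0] by (rule integrable_of_real)
      from integrable_circ_mult_continuous[OF this, of "\<lambda>x. tang x * curve x ^ j"]
      show ?thesis by (simp add: mult.assoc continuous_intros cont_tang cont_lev)
    qed
    have "Re (\<integral>x. ?I x \<partial>circ) = (\<integral>x. g0 x * R q x \<partial>circ)"
      unfolding integral_Re[OF ii, symmetric]
      by (rule Bochner_Integration.integral_cong) (auto simp: R_def q algebra_simps)
    moreover have "Im (\<integral>x. ?I x \<partial>circ) = - (\<integral>x. g0 x * R (smult \<i> q) x \<partial>circ)"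
      unfolding integral_Im[OF ii, symmetric] Bochner_Integration.integral_minus[symmetric]
      by (rule Bochner_Integration.integral_cong) (auto simp: R_def iq algebra_simps)
    ultimately show "(\<integral>x. ?I x \<partial>circ) = 0" by (simp add: orth complex_eq_iff)
  qed
  moreover have "(\<integral>x. g0 x \<partial>circ) = 0"
  proof -
    have iu: "integrable circ (\<lambda>x. u x * tang x)" by (rule sqint_L1(1)[OF sut])
    have "(\<integral>x. g0 x \<partial>circ) = (\<integral>x. g x \<partial>circ) - (\<integral>x. Re (u x * tang x) \<partial>circ)"
      unfolding g0_def by (rule Bochner_Integration.integral_diff[OF sqint_L1(1)[OF g] integrable_Re[OF iu]])
    also have "(\<integral>x. Re (u x * tang x) \<partial>circ) = Re (\<integral>x. u x * tang x \<partial>circ)" by (rule integral_Re[OF iu])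
    finally show ?thesis using mom[of 0] mean by simp
  qed
  ultimately have "nsq g0 = 0" using real_moments_vanish_imp_zero[OF sg0] by blast
  then have "AE x in circ. g0 x = 0" using nsq_eq_0_AE[OF sg0] by simp
  then have "AE x in circ. Re (u x * tang x) = g x" by eventually_elim (simp add: g0_def)
  moreover have "moments_vanish u" using mom by (simp add: moments_vanish_def)
  ultimately show thesis using that[OF u] mom[of 0] by simp
qed

end

subsection \<open>Partial derivatives\<close>

lemma has_derivative_partials:
  assumes "(f has_derivative L) (at p)"
  shows "((\<lambda>s. f (s, snd p)) has_real_derivative L (1, 0)) (at (fst p))"
    and "((\<lambda>s. f (fst p, s)) has_real_derivative L (0, 1)) (at (snd p))"
    and "pdx f p = L (1, 0)" and "pdy f p = L (0, 1)"
proof -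
  interpret L: bounded_linear L using assms by (rule has_derivative_bounded_linear)
  have p: "p = (fst p, snd p)" by simp
  have "((\<lambda>s. (s, snd p)) has_derivative (\<lambda>v. (v, 0))) (at (fst p))"
    by (auto intro!: derivative_eq_intros)
  from has_derivative_compose[OF this, of f L] assms
  have "((\<lambda>s. f (s, snd p)) has_derivative (\<lambda>v. L (v, 0))) (at (fst p))" by simp
  moreover have "(\<lambda>v. L (v, 0)) = (*) (L (1, 0))"
  proof
    fix v
    show "L (v, 0) = L (1, 0) * v"
      using L.scaleR[of v "(1, 0)"] by (simp only: scaleR_Pair real_scaleR_def mult_1_right mult_zero_right mult_1_left mult_zero_left mult.commute)
  qed
  ultimately show 1: "((\<lambda>s. f (s, snd p)) has_real_derivative L (1, 0)) (at (fst p))"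
    by (simp only: has_field_derivative_def)
  have "((\<lambda>s. (fst p, s)) has_derivative (\<lambda>v. (0, v))) (at (snd p))"
    by (auto intro!: derivative_eq_intros)
  from has_derivative_compose[OF this, of f L] assms
  have "((\<lambda>s. f (fst p, s)) has_derivative (\<lambda>v. L (0, v))) (at (snd p))" by simp
  moreover have "(\<lambda>v. L (0, v)) = (*) (L (0, 1))"
  proof
    fix v
    show "L (0, v) = L (0, 1) * v"
      using L.scaleR[of v "(0, 1)"] by (simp only: scaleR_Pair real_scaleR_def mult_1_right mult_zero_right mult_1_left mult_zero_left mult.commute)
  qed
  ultimately show 2: "((\<lambda>s. f (fst p, s)) has_real_derivative L (0, 1)) (at (snd p))"
    by (simp only: has_field_derivative_def)
  show "pdx f p = L (1, 0)" "pdy f p = L (0, 1)"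
    using 1 2 by (simp_all add: pdx_def pdy_def DERIV_imp_deriv)
qed

lemma differentiable_gradient:
  fixes f :: "real \<times> real \<Rightarrow> real"
  assumes "f differentiable_on S" "open S" "p \<in> S"
  shows "(f has_derivative (\<lambda>v. pdx f p * fst v + pdy f p * snd v)) (at p)"
proof -
  obtain L where L: "(f has_derivative L) (at p)"
    using assms by (metis differentiable_on_def differentiable_def at_within_open)
  interpret L: bounded_linear L using L by (rule has_derivative_bounded_linear)
  have "L v = pdx f p * fst v + pdy f p * snd v" for v
  proof -
    have "v = fst v *\<^sub>R (1, 0) + snd v *\<^sub>R (0, 1)" by (simp add: prod_eq_iff)
    then have "L v = fst v *\<^sub>R L (1, 0) + snd v *\<^sub>R L (0, 1)" by (metis L.add L.scaleR)
    then show ?thesis using has_derivative_partials(3,4)[OF L] by simp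
  qed
  then have "L = (\<lambda>v. pdx f p * fst v + pdy f p * snd v)" by blast
  with L show ?thesis by simp
qed

text \<open>The partial derivatives depend only on values near p, so formulas valid on the open
  domain can be differentiated once more.\<close>

lemma pdx_pdy_cong:
  assumes "open S" "p \<in> S" "\<And>q. q \<in> S \<Longrightarrow> f q = g q"
  shows "pdx f p = pdx g p" "pdy f p = pdy g p"
proof -
  obtain e where e: "e > 0" "ball p e \<subseteq> S" using assms(1,2) open_contains_ball by blast
  have "\<forall>\<^sub>F s in nhds (fst p). f (s, snd p) = g (s, snd p)"
    unfolding eventually_nhds_metric
    using e assms(3) by (intro exI[of _ e]) (auto simp: subset_iff dist_prod_def dist_commute)
  then show "pdx f p = pdx g p" unfolding pdx_def by (rule deriv_cong_ev) simp
  have "\<forall>\<^sub>F s in nhds (snd p). f (fst p, s) = g (fst p, s)"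
    unfolding eventually_nhds_metric
    using e assms(3) by (intro exI[of _ e]) (auto simp: subset_iff dist_prod_def dist_commute)
  then show "pdy f p = pdy g p" unfolding pdy_def by (rule deriv_cong_ev) simp
qed

text \<open>Schwarz's theorem: the second difference over a small square, expanded by the mean value
  theorem in either order, is r^2 times one or the other mixed derivative at a nearby point.\<close>

lemma mixed_partials_commute:
  assumes S: "open S" and f: "C2_on S f" and p: "p \<in> S"
  shows "pdy (pdx f) p = pdx (pdy f) p"
proof -
  obtain x y where xy: "p = (x, y)" by (cases p)
  let ?A = "pdy (pdx f)" and ?B = "pdx (pdy f)"
  have df: "f differentiable_on S" "pdx f differentiable_on S" "pdy f differentiable_on S"
    and cA: "continuous_on S ?A" and cB: "continuous_on S ?B"
    using f by (auto simp: C2_on_def)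
  have Dx: "((\<lambda>s. f (s, t)) has_real_derivative pdx f (s, t)) (at s)"
    and Dy: "((\<lambda>t. f (s, t)) has_real_derivative pdy f (s, t)) (at t)"
    and Dxy: "((\<lambda>t. pdx f (s, t)) has_real_derivative ?A (s, t)) (at t)"
    and Dyx: "((\<lambda>s. pdy f (s, t)) has_real_derivative ?B (s, t)) (at s)" if "(s, t) \<in> S" for s t
    using has_derivative_partials(1,2)[OF differentiable_gradient[OF df(1) S that]]
      has_derivative_partials(2)[OF differentiable_gradient[OF df(2) S that]]
      has_derivative_partials(1)[OF differentiable_gradient[OF df(3) S that]] by simp_all
  have "\<bar>?A p - ?B p\<bar> \<le> 0 + e" if e: "e > 0" for e
  proof -
    have "isCont ?A p" "isCont ?B p" using cA cB S p by (auto simp: continuous_on_eq_continuous_at)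
    then obtain d1 d2 where d: "d1 > 0" "\<And>q. dist q p < d1 \<Longrightarrow> dist (?A q) (?A p) < e/2"
        "d2 > 0" "\<And>q. dist q p < d2 \<Longrightarrow> dist (?B q) (?B p) < e/2"
      unfolding continuous_at_eps_delta using e by (metis half_gt_zero)
    obtain d3 where d3: "d3 > 0" "ball p d3 \<subseteq> S" using S p open_contains_ball by blast
    \<comment> \<open>Points of the square of side r are within 2r of p, so a third of the
      admissible radius suffices.\<close>
    define r where "r = min d1 (min d2 d3) / 3"
    have r: "r > 0" "2 * r < min d1 (min d2 d3)"
    proof -
      have "2 * (M / 3) < M" if "M > 0" for M :: real using that by simp
      from this[of "min d1 (min d2 d3)"] show "r > 0" "2 * r < min d1 (min d2 d3)"
        using d(1,3) d3(1) by (simp_all only: r_def)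
    qed
    have near: "dist (s, t) p < min d1 (min d2 d3)" if "x \<le> s" "s \<le> x + r" "y \<le> t" "t \<le> y + r" for s t
    proof -
      have "dist (s, t) p \<le> \<bar>s - x\<bar> + \<bar>t - y\<bar>"
        unfolding xy dist_prod_def by (simp add: dist_real_def sqrt_sum_squares_le_sum_abs)
      also have "\<dots> \<le> 2 * r" using that by simp
      also have "\<dots> < min d1 (min d2 d3)" by (rule r(2))
      finally show ?thesis .
    qed
    have inS: "(s, t) \<in> S" if "x \<le> s" "s \<le> x + r" "y \<le> t" "t \<le> y + r" for s t
      using near[OF that] d3(2) by (auto simp: dist_commute)
    have D1: "((\<lambda>s. f (s, y + r) - f (s, y)) has_real_derivative (pdx f (s, y + r) - pdx f (s, y))) (at s)"
      if "x \<le> s" "s \<le> x + r" for s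
      by (intro DERIV_diff Dx inS) (use r that in auto)
    obtain \<xi> where \<xi>: "x < \<xi>" "\<xi> < x + r"
      "(f (x + r, y + r) - f (x + r, y)) - (f (x, y + r) - f (x, y)) = (x + r - x) * (pdx f (\<xi>, y + r) - pdx f (\<xi>, y))"
      using MVT2[where a=x and b="x + r", OF _ D1] r(1) by auto
    have D2: "((\<lambda>t. pdx f (\<xi>, t)) has_real_derivative ?A (\<xi>, t)) (at t)" if "y \<le> t" "t \<le> y + r" for t
      by (intro Dxy inS) (use r that \<xi> in auto)
    obtain \<eta> where \<eta>: "y < \<eta>" "\<eta> < y + r" "pdx f (\<xi>, y + r) - pdx f (\<xi>, y) = (y + r - y) * ?A (\<xi>, \<eta>)"
      using MVT2[where a=y and b="y + r", OF _ D2] r(1) by auto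
    have D3: "((\<lambda>t. f (x + r, t) - f (x, t)) has_real_derivative (pdy f (x + r, t) - pdy f (x, t))) (at t)"
      if "y \<le> t" "t \<le> y + r" for t
      by (intro DERIV_diff Dy inS) (use r that in auto)
    obtain \<eta>' where \<eta>': "y < \<eta>'" "\<eta>' < y + r"
      "(f (x + r, y + r) - f (x, y + r)) - (f (x + r, y) - f (x, y)) = (y + r - y) * (pdy f (x + r, \<eta>') - pdy f (x, \<eta>'))"
      using MVT2[where a=y and b="y + r", OF _ D3] r(1) by auto
    have D4: "((\<lambda>s. pdy f (s, \<eta>')) has_real_derivative ?B (s, \<eta>')) (at s)" if "x \<le> s" "s \<le> x + r" for s
      by (intro Dyx inS) (use r that \<eta>' in auto)
    obtain \<xi>' where \<xi>': "x < \<xi>'" "\<xi>' < x + r" "pdy f (x + r, \<eta>') - pdy f (x, \<eta>') = (x + r - x) * ?B (\<xi>', \<eta>')"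
      using MVT2[where a=x and b="x + r", OF _ D4] r(1) by auto
    have "r * (r * ?A (\<xi>, \<eta>)) = r * (r * ?B (\<xi>', \<eta>'))"
    proof -
      have "(f (x + r, y + r) - f (x + r, y)) - (f (x, y + r) - f (x, y))
          = (f (x + r, y + r) - f (x, y + r)) - (f (x + r, y) - f (x, y))" by simp
      then show ?thesis unfolding \<xi>(3) \<eta>(3) \<eta>'(3) \<xi>'(3) by simp
    qed
    then have "?A (\<xi>, \<eta>) = ?B (\<xi>', \<eta>')" using r by simp
    moreover have "dist (?A (\<xi>, \<eta>)) (?A p) < e/2" "dist (?B (\<xi>', \<eta>')) (?B p) < e/2"
      using d(2)[of "(\<xi>, \<eta>)"] d(4)[of "(\<xi>', \<eta>')"] near[of \<xi> \<eta>] near[of \<xi>' \<eta>'] \<xi> \<eta> \<xi>' \<eta>' by auto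
    ultimately show ?thesis unfolding dist_real_def by linarith
  qed
  then have "\<bar>?A p - ?B p\<bar> \<le> 0" by (rule field_le_epsilon)
  then show ?thesis by simp
qed

section \<open>Harmonic functions as real parts of analytic functions\<close>

definition Wave :: "real \<times> real \<Rightarrow> complex" where "Wave p = wave (fst p) (snd p)"

lemma Wave_has_derivative:
  "(Wave has_derivative (\<lambda>v. Wave p * Complex (snd v) (- fst v))) (at p)"
proof -
  have "((\<lambda>p. of_real (snd p) + \<i> * of_real (- fst p)) has_derivative (\<lambda>v. of_real (snd v) + \<i> * of_real (- fst v))) (at p)"
    by (auto intro!: derivative_eq_intros)
  from has_derivative_compose[OF this, of exp "\<lambda>v. exp (of_real (snd p) + \<i> * of_real (- fst p)) * v"]
  have "((\<lambda>p. exp (of_real (snd p) + \<i> * of_real (- fst p))) has_derivative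
      (\<lambda>v. exp (of_real (snd p) + \<i> * of_real (- fst p)) * (of_real (snd v) + \<i> * of_real (- fst v)))) (at p)"
    using DERIV_exp[of "of_real (snd p) + \<i> * of_real (- fst p)"] unfolding has_field_derivative_def by simp
  then show ?thesis by (simp only: Wave_def[abs_def] wave_def Complex_eq)
qed

context periodic_graph begin

lemma open_subgraph: "open (subgraph h)"
proof -
  have "subgraph h = {p. snd p < h (fst p)}" by (auto simp: subgraph_def)
  moreover have "open {p :: real \<times> real. snd p < h (fst p)}"
    by (intro open_Collect_less continuous_intros continuous_on_compose2[OF cont_h]) auto
  ultimately show ?thesis by simp
qed

lemma subgraph_iff: "p \<in> subgraph h \<longleftrightarrow> snd p < h (fst p)"
  by (cases p) (simp add: subgraph_def)

lemma connected_subgraph: "connected (subgraph h)"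
proof -
  have "subgraph h = (\<lambda>q. (fst q, h (fst q) - snd q)) ` (UNIV \<times> {0<..})"
  proof
    show "subgraph h \<subseteq> (\<lambda>q. (fst q, h (fst q) - snd q)) ` (UNIV \<times> {0<..})"
    proof
      fix p assume "p \<in> subgraph h"
      then show "p \<in> (\<lambda>q. (fst q, h (fst q) - snd q)) ` (UNIV \<times> {0<..})"
        by (intro image_eqI[of _ _ "(fst p, h (fst p) - snd p)"]) (auto simp: subgraph_iff)
    qed
  qed (auto simp: subgraph_iff)
  moreover have "connected ((\<lambda>q. (fst q, h (fst q) - snd q)) ` (UNIV \<times> {0<..}))"
  proof (rule connected_continuous_image)
    show "continuous_on (UNIV \<times> {0<..}) (\<lambda>q. (fst q, h (fst q) - snd q))"
      by (intro continuous_intros continuous_on_compose2[OF cont_h]) auto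
    show "connected (UNIV \<times> {0<..} :: (real \<times> real) set)"
      by (intro connected_Times) auto
  qed
  ultimately show ?thesis by simp
qed

lemma Wave_in_below_iff: "Wave p \<in> below \<longleftrightarrow> p \<in> subgraph h"
  by (simp add: Wave_def wave_in_below_iff subgraph_iff)

text \<open>Since dw / w = dy - i dx, the y-derivative of F(w) is \<open>euler F\<close> and the
  x-derivative is -i \<open>euler F\<close>.\<close>

definition euler :: "(complex \<Rightarrow> complex) \<Rightarrow> complex \<Rightarrow> complex" where
  "euler F w = w * deriv F w"

lemma euler_holomorphic: "F holomorphic_on below \<Longrightarrow> euler F holomorphic_on below"
  unfolding euler_def by (intro holomorphic_intros holomorphic_deriv open_below)

text \<open>The factor c keeps the class of functions Re(c F) closed under partial differentiation,
  so higher derivatives come from the same formula.\<close>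

lemma Re_Wave_has_derivative:
  assumes F: "F holomorphic_on below" and p: "p \<in> subgraph h"
  shows "((\<lambda>p. Re (c * F (Wave p))) has_derivative
      (\<lambda>v. Re (- \<i> * c * euler F (Wave p)) * fst v + Re (c * euler F (Wave p)) * snd v)) (at p)"
proof -
  have "(F has_field_derivative deriv F (Wave p)) (at (Wave p))"
    using F p open_below by (simp add: holomorphic_derivI Wave_in_below_iff)
  then have "(F has_derivative (\<lambda>v. deriv F (Wave p) * v)) (at (Wave p))"
    by (simp add: has_field_derivative_def)
  from has_derivative_compose[OF Wave_has_derivative this]
  have "((\<lambda>p. Re (c * F (Wave p))) has_derivative
      (\<lambda>v. Re (c * (deriv F (Wave p) * (Wave p * Complex (snd v) (- fst v)))))) (at p)"
    by (auto intro!: derivative_eq_intros)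
  moreover have "Re (c * (deriv F (Wave p) * (Wave p * Complex (snd v) (- fst v))))
      = Re (- \<i> * c * euler F (Wave p)) * fst v + Re (c * euler F (Wave p)) * snd v" for v
  proof -
    define a where "a = c * euler F (Wave p)"
    have e1: "c * (deriv F (Wave p) * (Wave p * Complex (snd v) (- fst v))) = a * Complex (snd v) (- fst v)"
      by (simp only: a_def euler_def mult_ac)
    have e2: "- \<i> * c * euler F (Wave p) = - \<i> * a" by (simp only: a_def mult.assoc)
    show ?thesis unfolding e1 e2 unfolding a_def[symmetric] by simp
  qed
  ultimately show ?thesis by simp
qed

lemma Re_Wave_partials:
  assumes F: "F holomorphic_on below" and p: "p \<in> subgraph h"
  shows "pdx (\<lambda>p. Re (c * F (Wave p))) p = Re (- \<i> * c * euler F (Wave p))"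
    and "pdy (\<lambda>p. Re (c * F (Wave p))) p = Re (c * euler F (Wave p))"
  using has_derivative_partials(3,4)[OF Re_Wave_has_derivative[OF assms, of c]] by simp_all

lemma Re_Wave_differentiable:
  assumes "F holomorphic_on below" "\<And>q. q \<in> subgraph h \<Longrightarrow> f q = Re (c * F (Wave q))"
  shows "f differentiable_on subgraph h"
  unfolding differentiable_on_def
proof
  fix p assume p: "p \<in> subgraph h"
  have "(f has_derivative (\<lambda>v. Re (- \<i> * c * euler F (Wave p)) * fst v + Re (c * euler F (Wave p)) * snd v)) (at p)"
    by (rule has_derivative_transform_within_open[OF Re_Wave_has_derivative[OF assms(1) p, of c] open_subgraph p])
       (simp add: assms(2))
  then show "f differentiable (at p within subgraph h)"
    using differentiable_at_withinI differentiableI by blast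
qed

lemma continuous_on_Wave:
  assumes "F holomorphic_on below"
  shows "continuous_on (subgraph h) (\<lambda>p. F (Wave p))"
proof (rule continuous_on_compose2[OF holomorphic_on_imp_continuous_on[OF assms]])
  show "continuous_on (subgraph h) Wave"
    unfolding Wave_def by (intro continuous_intros)
qed (auto simp: Wave_in_below_iff)

text \<open>Two x-derivatives multiply by (-i)^2 = -1 and two y-derivatives by 1, so the Laplacian
  cancels.\<close>

lemma Re_Wave_harmonic:
  assumes F: "F holomorphic_on below" and f: "\<And>q. q \<in> subgraph h \<Longrightarrow> f q = Re (F (Wave q))"
  shows "harmonic_on (subgraph h) f"
proof -
  let ?S = "subgraph h" and ?E = "euler F" and ?E2 = "euler (euler F)"
  note E = euler_holomorphic[OF F]
  note E2 = euler_holomorphic[OF E]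
  have x: "pdx f p = Re (- \<i> * ?E (Wave p))" and y: "pdy f p = Re (1 * ?E (Wave p))" if "p \<in> ?S" for p
    using pdx_pdy_cong[OF open_subgraph that, of f "\<lambda>p. Re (1 * F (Wave p))"] f
      Re_Wave_partials[OF F that, of 1] by simp_all
  have xx: "pdx (pdx f) p = Re ((-1) * ?E2 (Wave p))" and xy: "pdy (pdx f) p = Re (- \<i> * ?E2 (Wave p))"
    and yx: "pdx (pdy f) p = Re (- \<i> * ?E2 (Wave p))" and yy: "pdy (pdy f) p = Re (1 * ?E2 (Wave p))" if "p \<in> ?S" for p
    using pdx_pdy_cong[OF open_subgraph that x] pdx_pdy_cong[OF open_subgraph that y]
      Re_Wave_partials[OF E that, of "- \<i>"] Re_Wave_partials[OF E that, of 1] by simp_all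
  have cont: "continuous_on ?S q" if "\<And>p. p \<in> ?S \<Longrightarrow> q p = Re (c * ?E2 (Wave p))" for q c
  proof -
    have "continuous_on ?S (\<lambda>p. Re (c * ?E2 (Wave p)))"
      by (intro continuous_intros continuous_on_Wave E2)
    then show ?thesis using that by (simp cong: continuous_on_cong)
  qed
  have "C2_on ?S f"
    unfolding C2_on_def
  proof (intro conjI)
    show "f differentiable_on ?S" by (rule Re_Wave_differentiable[OF F, of _ 1]) (simp add: f)
    show "pdx f differentiable_on ?S" by (rule Re_Wave_differentiable[OF E x])
    show "pdy f differentiable_on ?S" by (rule Re_Wave_differentiable[OF E y])
  qed (rule cont, erule xx xy yx yy)+
  then show ?thesis
    unfolding harmonic_on_def using xx yy by simp
qed

text \<open>
  Conversely, \<open>\<partial>\<^sub>xf - i\<partial>\<^sub>yf\<close> is an analytic function of \<open>w = e\<^bsup>y-ix\<^esup>\<close> with a removable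
  singularity at \<open>w = 0\<close>, i.e. at \<open>y = -\<infinity>\<close>.
\<close>

lemma harmonic_imp_Re_Wave:
  assumes harm: "harmonic_on (subgraph h) P"
    and per: "\<And>x y. (x, y) \<in> subgraph h \<Longrightarrow> P (x + 2*pi, y) = P (x, y)"
    and decay: "uniform_limit UNIV (\<lambda>y x. grad P (x, y)) (\<lambda>x. 0) at_bot"
  obtains \<Phi> where "\<Phi> holomorphic_on below" "\<And>p. p \<in> subgraph h \<Longrightarrow> P p = Re (\<Phi> (Wave p))"
proof -
  let ?S = "subgraph h"
  have C2: "C2_on ?S P" and lap: "\<And>p. p \<in> ?S \<Longrightarrow> pdx (pdx P) p + pdy (pdy P) p = 0"
    using harm by (auto simp: harmonic_on_def)
  have dP: "P differentiable_on ?S" "pdx P differentiable_on ?S" "pdy P differentiable_on ?S"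
    using C2 by (auto simp: C2_on_def)
  \<comment> \<open>Returns (x, y) from the logarithmic coordinate z = y - ix, so that the
    exponential is the covering map onto the punctured domain.\<close>
  define pt where "pt z = (- Im z, Re z)" for z :: complex
  define A where "A = {z. pt z \<in> ?S}"
  have Wpt: "Wave (pt z) = exp z" for z by (simp add: Wave_def pt_def wave_def)
  have openA: "open A"
  proof -
    have "open {z. Re z < h (- Im z)}"
      by (intro open_Collect_less continuous_intros continuous_on_compose2[OF cont_h]) auto
    then show ?thesis by (simp add: A_def pt_def subgraph_iff)
  qed
  define f where "f z = Complex (pdx P (pt z)) (- pdy P (pt z))" for z
  have f_holo: "(f has_field_derivative Complex (pdy (pdx P) (pt z)) (- pdy (pdy P) (pt z))) (at z)" if "z \<in> A" for z
  proof -
    have p: "pt z \<in> ?S" using that by (simp add: A_def)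
    have dpt: "(pt has_derivative (\<lambda>v. (- Im v, Re v))) (at z)"
      unfolding pt_def by (auto intro!: derivative_eq_intros)
    have d1: "((\<lambda>z. pdx P (pt z)) has_derivative (\<lambda>v. pdx (pdx P) (pt z) * - Im v + pdy (pdx P) (pt z) * Re v)) (at z)"
      using has_derivative_compose[OF dpt differentiable_gradient[OF dP(2) open_subgraph p]] by (simp only: fst_conv snd_conv)
    have d2: "((\<lambda>z. pdy P (pt z)) has_derivative (\<lambda>v. pdx (pdy P) (pt z) * - Im v + pdy (pdy P) (pt z) * Re v)) (at z)"
      using has_derivative_compose[OF dpt differentiable_gradient[OF dP(3) open_subgraph p]] by (simp only: fst_conv snd_conv)
    have "(f has_derivative (\<lambda>v. of_real (pdx (pdx P) (pt z) * - Im v + pdy (pdx P) (pt z) * Re v)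
        + \<i> * of_real (- (pdx (pdy P) (pt z) * - Im v + pdy (pdy P) (pt z) * Re v)))) (at z)"
      unfolding f_def Complex_eq
      by (intro has_derivative_add has_derivative_mult_right has_derivative_of_real has_derivative_minus d1 d2)
    moreover have "of_real (pdx (pdx P) (pt z) * - Im v + pdy (pdx P) (pt z) * Re v)
        + \<i> * of_real (- (pdx (pdy P) (pt z) * - Im v + pdy (pdy P) (pt z) * Re v))
        = Complex (pdy (pdx P) (pt z)) (- pdy (pdy P) (pt z)) * v" for v
    proof -
      \<comment> \<open>Of the two Cauchy-Riemann equations one is harmonicity and the other the
        symmetry of the mixed derivatives.\<close>
      have "pdx (pdx P) (pt z) = - pdy (pdy P) (pt z)" using lap[OF p] by simp
      then show ?thesis
        using mixed_partials_commute[OF open_subgraph C2 p] by (simp add: complex_eq_iff algebra_simps)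
    qed
    ultimately show ?thesis by (simp add: has_field_derivative_def)
  qed
  have P_int: "P (x + 2*pi * of_int k, y) = P (x, y)" if "y < h x" for x y and k :: int
  proof -
    have nat: "P (x + 2*pi * of_nat n, y) = P (x, y)" if "y < h x" for x n
    proof (induction n)
      case (Suc n)
      have "x + 2*pi * of_nat (Suc n) = (x + 2*pi * of_nat n) + 2*pi" by (simp add: algebra_simps)
      moreover have "(x + 2*pi * of_nat n, y) \<in> ?S" using h_int[of x "int n"] that by (simp add: subgraph_iff)
      ultimately show ?case using Suc per[of "x + 2*pi * of_nat n" y] by (simp only:)
    qed simp
    show ?thesis
    proof (cases "k \<ge> 0")
      case True
      then show ?thesis using nat[OF that, of "nat k"] by simp
    next
      case False
      then show ?thesis using nat[of "x + 2*pi * of_int k" "nat (-k)"] that h_int[of x k] by simp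
    qed
  qed
  have grad_int: "pdx P (x + 2*pi * of_int k, y) = pdx P (x, y)" "pdy P (x + 2*pi * of_int k, y) = pdy P (x, y)"
    if "y < h x" for x y and k :: int
  proof -
    let ?c = "2*pi * of_int k"
    have q: "(x + ?c, y) \<in> ?S" using that h_int[of x k] by (simp add: subgraph_iff)
    have "((\<lambda>p. (fst p + ?c, snd p)) has_derivative (\<lambda>v. v)) (at (x, y))"
      by (auto intro!: derivative_eq_intros)
    from has_derivative_compose[OF this, of P] differentiable_gradient[OF dP(1) open_subgraph q]
    have "((\<lambda>p. P (fst p + ?c, snd p)) has_derivative (\<lambda>v. pdx P (x + ?c, y) * fst v + pdy P (x + ?c, y) * snd v)) (at (x, y))"
      by simp
    note * = has_derivative_partials(3,4)[OF this]
    have "pdx (\<lambda>p. P (fst p + ?c, snd p)) (x, y) = pdx P (x, y)" "pdy (\<lambda>p. P (fst p + ?c, snd p)) (x, y) = pdy P (x, y)"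
      using that by (auto intro!: pdx_pdy_cong[OF open_subgraph] simp: subgraph_iff P_int)
    with * show "pdx P (x + ?c, y) = pdx P (x, y)" "pdy P (x + ?c, y) = pdy P (x, y)" by simp_all
  qed
  \<comment> \<open>The jump of \<open>Ln\<close> is harmless, because f has the period of the
    exponential by \<open>grad_int\<close>.\<close>
  define F where "F w = (if w = 0 then 0 else f (Ln w))" for w
  have expA: "exp z \<in> below \<longleftrightarrow> z \<in> A" for z
    using Wave_in_below_iff[of "pt z"] by (simp add: Wpt A_def)
  have F_exp: "F (exp z) = f z" if "z \<in> A" for z
  proof -
    have "wave (- Im (Ln (exp z))) (Re (Ln (exp z))) = wave (- Im z) (Re z)"
      using wave_Ln[of "exp z"] by (simp only: exp_not_eq_zero not_False_eq_True simp_thms) (simp add: wave_def)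
    from wave_eq_imp[OF this] obtain k :: int where "Re (Ln (exp z)) = Re z" "- Im (Ln (exp z)) = - Im z + 2*pi * k" by blast
    then have "pt (Ln (exp z)) = (- Im z + 2*pi * of_int k, Re z)" by (simp add: pt_def)
    moreover have "Re z < h (- Im z)" using that by (simp add: A_def pt_def subgraph_iff)
    ultimately show ?thesis using grad_int[of "Re z" "- Im z" k] by (simp add: F_def f_def pt_def)
  qed
  have F_diff: "F field_differentiable (at w)" if w: "w \<in> below" "w \<noteq> 0" for w
  proof -
    \<comment> \<open>A branch of the logarithm near w, with its cut turned away from w.\<close>
    define L where "L v = Ln (v / w) + Ln w" for v
    have Lw: "L w = Ln w" using w(2) by (simp add: L_def)
    have expL: "exp (L v) = v" if "v \<noteq> 0" for v using that w(2) by (simp add: L_def exp_add)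
    have "Ln w \<in> A" using expA[of "Ln w"] w by simp
    then have "(f has_field_derivative Complex (pdy (pdx P) (pt (Ln w))) (- pdy (pdy P) (pt (Ln w)))) (at (L w))"
      using f_holo Lw by simp
    moreover have "(L has_field_derivative 1 / w) (at w)"
      unfolding L_def using w(2) by (auto intro!: derivative_eq_intros)
    ultimately have c1: "((\<lambda>v. f (L v)) has_field_derivative Complex (pdy (pdx P) (pt (Ln w))) (- pdy (pdy P) (pt (Ln w))) * (1 / w)) (at w)"
      by (rule DERIV_chain2)
    have c2: "open (below - {0})" using open_below by (intro open_Diff) auto
    have c3: "f (L v) = F v" if "v \<in> below - {0}" for v
      using F_exp[of "L v"] expA[of "L v"] expL[of v] that by simp
    have "(F has_field_derivative Complex (pdy (pdx P) (pt (Ln w))) (- pdy (pdy P) (pt (Ln w))) * (1 / w)) (at w)"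
      by (rule has_field_derivative_transform_within_open[OF c1 c2 _ c3]) (use w in auto)
    then show ?thesis unfolding field_differentiable_def by blast
  qed
  have F_norm: "norm (F w) = norm (grad P (- Im (Ln w), Re (Ln w)))" if "w \<noteq> 0" for w
    using that by (simp add: F_def f_def pt_def grad_def norm_prod_def cmod_def)
  have "(F \<longlongrightarrow> 0) (at 0)"
    unfolding tendsto_iff
  proof (intro allI impI)
    fix e :: real assume e: "e > 0"
    have "\<forall>\<^sub>F y in at_bot. \<forall>x\<in>UNIV. dist (grad P (x, y)) 0 < e"
      using decay e by (simp add: uniform_limit_iff)
    then obtain N where N: "\<And>y x. y \<le> N \<Longrightarrow> dist (grad P (x, y)) 0 < e"
      unfolding eventually_at_bot_linorder by blast
    show "\<forall>\<^sub>F w in at 0. dist (F w) 0 < e"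
      unfolding eventually_at
    proof (intro exI[of _ "exp N"] conjI ballI impI)
      fix w :: complex assume w: "w \<noteq> 0 \<and> dist w 0 < exp N"
      then have "ln (norm w) < N" by (metis dist_norm diff_zero ln_exp ln_less_cancel_iff zero_less_norm_iff exp_gt_zero)
      then show "dist (F w) 0 < e"
        using N[of "Re (Ln w)" "- Im (Ln w)"] w F_norm[of w] by (simp add: dist_norm)
    qed simp
  qed
  then have F_cont: "isCont F 0" by (simp add: isCont_def F_def)
  have F: "F holomorphic_on below"
  proof (rule no_isolated_singularity[where K="{0}"])
    show "continuous_on below F"
      unfolding continuous_on_eq_continuous_at[OF open_below]
      using F_cont F_diff field_differentiable_imp_continuous_at by blast
    show "F holomorphic_on below - {0}"
      unfolding holomorphic_on_def using F_diff field_differentiable_at_within by blast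
  qed (use open_below in auto)
  have F0: "F 0 = 0" by (simp add: F_def)
  \<comment> \<open>The decay of the gradient gave F(0) = 0, so F(w)/w has a removable singularity;
    a primitive of i G is then mapped by \<open>euler\<close> to i F.\<close>
  define G where "G = (\<lambda>w. if w = 0 then deriv F 0 else (F w - F 0) / (w - 0))"
  have "G holomorphic_on below" unfolding G_def by (rule pole_lemma_open[OF F open_below])
  then have "(\<lambda>w. \<i> * G w) holomorphic_on below" by (intro holomorphic_intros)
  then obtain \<Psi> where \<Psi>: "\<And>w. w \<in> below \<Longrightarrow> (\<Psi> has_field_derivative \<i> * G w) (at w)"
    using holomorphic_primitive_below by blast
  then have \<Psi>_holo: "\<Psi> holomorphic_on below"
    by (auto simp: holomorphic_on_open[OF open_below])
  have euler_\<Psi>: "euler \<Psi> w = \<i> * F w" if "w \<in> below" for w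
    using DERIV_imp_deriv[OF \<Psi>[OF that]] by (simp add: euler_def G_def F0)
  have FW: "F (Wave p) = Complex (pdx P p) (- pdy P p)" if "p \<in> ?S" for p
  proof -
    have "pt (Complex (snd p) (- fst p)) = p" by (simp add: pt_def)
    then show ?thesis
      using F_exp[of "Complex (snd p) (- fst p)"] that by (simp add: Wave_def wave_def A_def f_def)
  qed
  have const: "P p - Re (\<Psi> (Wave p)) = P q - Re (\<Psi> (Wave q))" if "p \<in> ?S" "q \<in> ?S" for p q
  proof (rule has_derivative_zero_unique_connected[OF open_subgraph connected_subgraph _ that])
    fix x assume x: "x \<in> ?S"
    have "((\<lambda>p. P p - Re (1 * \<Psi> (Wave p))) has_derivative (\<lambda>v. (pdx P x * fst v + pdy P x * snd v)
        - (Re (- \<i> * 1 * euler \<Psi> (Wave x)) * fst v + Re (1 * euler \<Psi> (Wave x)) * snd v))) (at x)"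
      by (intro has_derivative_diff differentiable_gradient[OF dP(1) open_subgraph x] Re_Wave_has_derivative[OF \<Psi>_holo x])
    then show "((\<lambda>p. P p - Re (\<Psi> (Wave p))) has_derivative (\<lambda>v. 0)) (at x)"
      using x by (simp add: euler_\<Psi> Wave_in_below_iff FW)
  qed
  obtain p0 where p0: "p0 \<in> ?S"
    using subgraph_iff[of "(0, h 0 - 1)"] by auto
  define c where "c = P p0 - Re (\<Psi> (Wave p0))"
  show thesis
  proof (rule that)
    show "(\<lambda>w. \<Psi> w + of_real c) holomorphic_on below"
      using \<Psi>_holo by (intro holomorphic_intros)
    show "P p = Re (\<Psi> (Wave p) + of_real c)" if "p \<in> ?S" for p
      using const[OF that p0] by (simp add: c_def)
  qed
qed

text \<open>
  The identity \<open>\<integral>\<Phi>\<^sup>2(1 + ih\<^sub>x) = 2\<pi>\<Phi>(0)\<^sup>2\<close> on each level bounds the imaginary part of \<open>\<Phi>\<close> by its real part.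
\<close>

lemma Re_boundary_zero_imp_imaginary_constant:
  assumes F: "\<Phi> holomorphic_on below"
    and lim: "((\<lambda>\<epsilon>. nsq (\<lambda>x. Re (\<Phi> (lev (- \<epsilon>) x)))) \<longlongrightarrow> 0) (at_right 0)"
  obtains b where "\<And>w. w \<in> below \<Longrightarrow> \<Phi> w = \<i> * of_real b"
proof -
  obtain T where T: "T > 0" "\<And>x. x \<in> {0..2*pi} \<Longrightarrow> norm (tang x) \<le> T" using tang_bounded by blast
  obtain H where H: "H > 0" "\<And>x. \<bar>h x\<bar> \<le> H" using h_bounded by blast
  obtain r where r: "r > 0" "ball 0 r \<subseteq> below" "\<And>s x. s \<ge> -1 \<Longrightarrow> 2 * r \<le> norm (lev s x)"
    using ball_below by blast
  define b where "b = Im (\<Phi> 0)"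
  \<comment> \<open>Subtracting i Im \<Phi>(0) makes the value at 0 real, so that its square enters
    with the favourable sign.\<close>
  define \<Psi> where "\<Psi> w = \<Phi> w - \<i> * of_real b" for w
  have \<Psi>: "\<Psi> holomorphic_on below" unfolding \<Psi>_def by (intro holomorphic_intros F)
  have \<Psi>0: "\<Psi> 0 = of_real (Re (\<Phi> 0))" by (simp add: \<Psi>_def b_def complex_eq_iff)
  define \<phi> where "\<phi> \<epsilon> = nsq (\<lambda>x. Re (\<Phi> (lev (- \<epsilon>) x)))" for \<epsilon>
  define K where "K = 1 + 2 * (1 + 2 * T\<^sup>2)"
  have bound: "nsq (\<lambda>x. \<Psi> (lev (- \<epsilon>) x)) \<le> K * \<phi> \<epsilon>" if e: "\<epsilon> > 0" for \<epsilon>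
  proof -
    let ?v = "\<lambda>x. \<Psi> (lev (- \<epsilon>) x)"
    have sv: "sqint ?v" by (rule sqint_level[OF \<Psi> e])
    have sR: "sqint (\<lambda>x. Re (?v x))" "sqint (\<lambda>x. Im (?v x))" by (rule sqint_Re(1)[OF sv], rule sqint_Im(1)[OF sv])
    have Re_eq: "Re (?v x) = Re (\<Phi> (lev (- \<epsilon>) x))" for x by (simp add: \<Psi>_def)
    have it: "integrable circ (\<lambda>x. (?v x)\<^sup>2 * tang x)"
      by (intro integrable_circ_continuous continuous_intros continuous_on_level[OF \<Psi> e] cont_tang)
    have "nsq (\<lambda>x. Im (?v x)) \<le> (\<integral>x. 2 * (1 + 2 * T\<^sup>2) * (Re (?v x))\<^sup>2 - 2 * Re ((?v x)\<^sup>2 * tang x) \<partial>circ)"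
      unfolding nsq_def
    proof (rule integral_mono)
      fix x assume "x \<in> space circ"
      then have x: "x \<in> {0..2*pi}" by simp
      define a c m where "a = Re (?v x)" and "c = Im (?v x)" and "m = h' x"
      have "m\<^sup>2 \<le> (norm (tang x))\<^sup>2" by (simp add: cmod_power2 tang_def m_def)
      also have "\<dots> \<le> T\<^sup>2" using T(2)[OF x] by (intro power_mono) auto
      finally have m: "m\<^sup>2 * a\<^sup>2 \<le> T\<^sup>2 * a\<^sup>2" by (intro mult_right_mono) auto
      have e: "Re ((?v x)\<^sup>2 * tang x) = a\<^sup>2 - c\<^sup>2 - 2 * m * a * c"
        by (simp add: tang_def power2_eq_square a_def c_def m_def algebra_simps)
      \<comment> \<open>Completing the square absorbs the mixed term m a c at the price of a factor
        T^2 on a^2.\<close>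
      have "0 \<le> (2 * m * a + c)\<^sup>2" by simp
      then have "c\<^sup>2 \<le> 2 * (1 + 2 * T\<^sup>2) * a\<^sup>2 - 2 * (a\<^sup>2 - c\<^sup>2 - 2 * m * a * c)"
        using m by (simp add: power2_eq_square algebra_simps)
      then show "(norm (Im (?v x)))\<^sup>2 \<le> 2 * (1 + 2 * T\<^sup>2) * (Re (?v x))\<^sup>2 - 2 * Re ((?v x)\<^sup>2 * tang x)"
        unfolding e by (simp add: a_def c_def)
    qed (use sR it in \<open>auto simp: sqint_def simp del: times_complex.sel\<close>)
    also have "\<dots> = 2 * (1 + 2 * T\<^sup>2) * nsq (\<lambda>x. Re (?v x)) - 2 * Re (\<integral>x. (?v x)\<^sup>2 * tang x \<partial>circ)"
      using sR it by (simp add: sqint_def nsq_def del: times_complex.sel)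
    also have "(\<integral>x. (?v x)\<^sup>2 * tang x \<partial>circ) = of_real (2*pi * (Re (\<Phi> 0))\<^sup>2)"
      using level_square_integral[OF \<Psi> e] by (simp add: \<Psi>0)
    finally have "nsq (\<lambda>x. Im (?v x)) \<le> 2 * (1 + 2 * T\<^sup>2) * nsq (\<lambda>x. Re (?v x)) - 2 * (2*pi * (Re (\<Phi> 0))\<^sup>2)"
      by (simp only: Re_complex_of_real)
    moreover have "0 \<le> 2 * (2*pi * (Re (\<Phi> 0))\<^sup>2)" by simp
    ultimately have "nsq (\<lambda>x. Im (?v x)) \<le> 2 * (1 + 2 * T\<^sup>2) * nsq (\<lambda>x. Re (?v x))"
      by linarith
    then show ?thesis
      using nsq_Re_Im[OF sv] by (simp add: K_def \<phi>_def Re_eq algebra_simps)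
  qed
  \<comment> \<open>Interior values follow from the Cauchy formula on levels close to the boundary,
    where the kernel is bounded because w stays in the small ball. The identity theorem then reaches
    the whole domain.\<close>
  have near0: "\<Psi> w = 0" if w: "norm w < r" for w
  proof -
    define C where "C = T * exp H / r"
    have small: "2*pi * norm (\<Psi> w) \<le> C * sqrt (2*pi * (K * \<phi> \<epsilon>))"
      if e: "0 < \<epsilon>" "\<epsilon> < 1" "norm (of_real (exp \<epsilon>) * w) < r" for \<epsilon>
    proof -
      let ?l = "lev (- \<epsilon>)"
      have "2*pi * \<Psi> w = (\<integral>x. \<Psi> (?l x) * tang x * ?l x / (?l x - w) \<partial>circ)"
        using Cauchy_formula[OF \<Psi> e(1), of w] e(3) r(2) by (auto simp: subset_iff)
      also have "norm \<dots> \<le> (\<integral>x. C * norm (\<Psi> (?l x)) \<partial>circ)"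
      proof (rule Bochner_Integration.integral_norm_bound_integral)
        have far: "r \<le> norm (?l x - w)" for x
          using r(3)[of "- \<epsilon>" x] e w norm_triangle_ineq2[of "?l x" w] by simp
        then have ne: "?l x - w \<noteq> 0" for x using r(1) by (metis norm_zero not_le)
        show "integrable circ (\<lambda>x. \<Psi> (?l x) * tang x * ?l x / (?l x - w))"
          using ne by (intro integrable_circ_continuous continuous_intros continuous_on_level[OF \<Psi> e(1)] cont_tang cont_lev) auto
        show "integrable circ (\<lambda>x. C * norm (\<Psi> (?l x)))"
          by (intro integrable_circ_continuous continuous_intros continuous_on_level[OF \<Psi> e(1)])
        fix x assume "x \<in> space circ"
        then have x: "x \<in> {0..2*pi}" by simp
        have "norm (tang x) * norm (?l x) / norm (?l x - w) \<le> T * exp H / r"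
        proof (rule frac_le)
          have "norm (?l x) \<le> exp H" using H(2)[of x] e by (simp add: norm_lev)
          then show "norm (tang x) * norm (?l x) \<le> T * exp H"
            using T(2)[OF x] T(1) by (intro mult_mono) auto
        qed (use far r(1) T(1) in auto)
        then have "norm (\<Psi> (?l x)) * (norm (tang x) * norm (?l x) / norm (?l x - w)) \<le> norm (\<Psi> (?l x)) * C"
          unfolding C_def by (intro mult_left_mono) auto
        moreover have "norm (\<Psi> (?l x) * tang x * ?l x / (?l x - w)) = norm (\<Psi> (?l x)) * (norm (tang x) * norm (?l x) / norm (?l x - w))"
          by (simp add: norm_mult norm_divide mult.assoc)
        ultimately show "norm (\<Psi> (?l x) * tang x * ?l x / (?l x - w)) \<le> C * norm (\<Psi> (?l x))"
          by (simp only: mult.commute[of C])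
      qed
      also have "\<dots> = C * (\<integral>x. norm (\<Psi> (?l x)) \<partial>circ)" by simp
      also have "\<dots> \<le> C * sqrt (2*pi * nsq (\<lambda>x. \<Psi> (?l x)))"
        using sqint_L1(2)[OF sqint_level[OF \<Psi> e(1)]] T(1) r(1) by (intro mult_left_mono) (auto simp: C_def)
      also have "\<dots> \<le> C * sqrt (2*pi * (K * \<phi> \<epsilon>))"
        using bound[OF e(1)] T(1) r(1) by (intro mult_left_mono real_sqrt_le_mono) (auto simp: C_def)
      finally show ?thesis by (simp add: norm_mult)
    qed
    have "((\<lambda>\<epsilon>::real. norm (of_real (exp \<epsilon>) * w)) \<longlongrightarrow> norm (of_real (exp 0) * w)) (at_right 0)"
      by (intro tendsto_intros)
    then have "\<forall>\<^sub>F \<epsilon>::real in at_right 0. norm (of_real (exp \<epsilon>) * w) < r"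
      by (rule order_tendstoD) (use w in simp)
    moreover have "\<forall>\<^sub>F \<epsilon>::real in at_right 0. 0 < \<epsilon> \<and> \<epsilon> < 1"
      by (intro eventually_at_rightI[of 0 1]) auto
    ultimately have ev: "\<forall>\<^sub>F \<epsilon> in at_right 0. 2*pi * norm (\<Psi> w) \<le> C * sqrt (2*pi * (K * \<phi> \<epsilon>))"
      by eventually_elim (use small in blast)
    have "((\<lambda>\<epsilon>. C * sqrt (2*pi * (K * \<phi> \<epsilon>))) \<longlongrightarrow> C * sqrt (2*pi * (K * 0))) (at_right 0)"
      by (intro tendsto_intros) (use lim in \<open>simp add: \<phi>_def\<close>)
    from tendsto_lowerbound[OF this ev] have "2*pi * norm (\<Psi> w) \<le> C * sqrt (2*pi * (K * 0))" by simp
    then show ?thesis using pi_gt_zero by (auto simp: mult_le_0_iff)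
  qed
  show thesis
  proof (rule that)
    fix w assume w: "w \<in> below"
    have "\<Psi> w = 0"
    proof (rule analytic_continuation_open[of "ball 0 r" below \<Psi> "\<lambda>_. 0"])
      show "connected below" by (rule starlike_imp_connected[OF starlike_below])
    qed (use r open_below \<Psi> near0 w in auto)
    then show "\<Phi> w = \<i> * of_real b" by (simp add: \<Psi>_def)
  qed
qed

end

subsection \<open>Boundary values\<close>

text \<open>Limits in \<open>circ\<close> live on a single period. Reduction modulo 2pi by the floor
  function yields the periodic Borel function that \<open>has_boundary_value\<close> asks for; only
  values at the endpoints can change.\<close>

lemma exists_L2_torus_representative:
  assumes u: "sqint u"
  obtains v where "v \<in> L2_torus" "AE x in circ. v x = u x"
proof -
  have "u \<in> borel_measurable (restrict_space lborel {0..2*pi})"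
    using sqint_measurable[OF u] by (simp add: circ_def)
  then have U: "(\<lambda>x. indicator {0..2*pi} x *\<^sub>R u x) \<in> borel_measurable borel"
    by (subst (asm) borel_measurable_restrict_space_iff) auto
  define v where "v x = (let t = x - 2*pi * of_int \<lfloor>x / (2*pi)\<rfloor> in indicator {0..2*pi} t *\<^sub>R u t)" for x
  have v_meas: "v \<in> borel_measurable borel"
    unfolding v_def Let_def
  proof (rule measurable_compose[OF _ U])
    have "(\<lambda>x. real_of_int \<lfloor>x / (2*pi)\<rfloor>) \<in> borel_measurable borel"
      by (rule measurable_compose[OF _ borel_measurable_real_floor]) simp
    then show "(\<lambda>x. x - 2*pi * real_of_int \<lfloor>x / (2*pi)\<rfloor>) \<in> borel_measurable borel"
      by simp
  qed
  have "periodic v"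
    unfolding periodic_def
  proof
    fix x
    have "(x + 2*pi) / (2*pi) = x / (2*pi) + 1" by (simp add: add_divide_distrib)
    then have "x + 2*pi - 2*pi * of_int \<lfloor>(x + 2*pi) / (2*pi)\<rfloor> = x - 2*pi * of_int \<lfloor>x / (2*pi)\<rfloor>"
      by (simp add: algebra_simps)
    then show "v (x + 2*pi) = v x" by (simp only: v_def)
  qed
  have ae: "AE x in circ. v x = u x"
    using AE_circ_interior
  proof eventually_elim
    case (elim x)
    then have "\<lfloor>x / (2*pi)\<rfloor> = 0" by (intro floor_eq_iff[THEN iffD2]) (auto simp: divide_simps)
    then show ?case using elim by (simp add: v_def)
  qed
  have ae': "AE x in circ. u x = v x" using ae by eventually_elim simp
  have "sqint v"
    using sqint_AE_cong(1)[OF u measurable_circ[OF v_meas] ae'] .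
  with v_meas \<open>periodic v\<close> have "v \<in> L2_torus" by (simp add: L2_torus_iff)
  then show thesis using ae by (rule that)
qed

lemma L2_torus_diff: "f \<in> L2_torus \<Longrightarrow> g \<in> L2_torus \<Longrightarrow> (\<lambda>x. f x - g x) \<in> L2_torus"
  by (auto simp: L2_torus_iff periodic_def sqint_diff(1))

lemma has_boundary_valueI:
  assumes g: "g \<in> L2_torus" and F: "\<And>\<epsilon>. \<epsilon> > 0 \<Longrightarrow> (\<lambda>x. F (x, h x - \<epsilon>)) \<in> L2_torus"
    and lim: "((\<lambda>\<epsilon>. nsq (\<lambda>x. F (x, h x - \<epsilon>) - g x)) \<longlongrightarrow> 0) (at_right 0)"
  shows "has_boundary_value h F g"
proof -
  have "((\<lambda>\<epsilon>. ennreal (sqrt (nsq (\<lambda>x. F (x, h x - \<epsilon>) - g x)))) \<longlongrightarrow> ennreal (sqrt 0)) (at_right 0)"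
    by (intro tendsto_ennrealI tendsto_real_sqrt lim)
  moreover have "\<forall>\<^sub>F \<epsilon> in at_right 0. ennreal (sqrt (nsq (\<lambda>x. F (x, h x - \<epsilon>) - g x))) = L2_norm (\<lambda>x. F (x, h x - \<epsilon>) - g x)"
    by (intro eventually_at_rightI[of 0 1]) (auto simp: L2_norm_eq[OF L2_torus_diff[OF F g]])
  ultimately have "((\<lambda>\<epsilon>. L2_norm (\<lambda>x. F (x, h x - \<epsilon>) - g x)) \<longlongrightarrow> ennreal (sqrt 0)) (at_right 0)"
    by (rule Lim_transform_eventually)
  then show ?thesis using g by (simp add: has_boundary_value_def)
qed

text \<open>Since \<open>L2_norm\<close> is infinite outside the space, its convergence to 0 already
  forces the differences to be square integrable for small \<epsilon>.\<close>

lemma has_boundary_valueD: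
  assumes "has_boundary_value h F g"
  shows "\<forall>\<^sub>F \<epsilon> in at_right 0. sqint (\<lambda>x. F (x, h x - \<epsilon>) - g x)"
    and "((\<lambda>\<epsilon>. nsq (\<lambda>x. F (x, h x - \<epsilon>) - g x)) \<longlongrightarrow> 0) (at_right 0)"
proof -
  have lim: "((\<lambda>\<epsilon>. L2_norm (\<lambda>x. F (x, h x - \<epsilon>) - g x)) \<longlongrightarrow> 0) (at_right 0)"
    using assms by (simp add: has_boundary_value_def)
  have L2: "f \<in> L2_torus" if "L2_norm f < ennreal c" for f c
    using that by (auto simp: L2_norm_def split: if_splits)
  have small: "\<forall>\<^sub>F \<epsilon> in at_right 0. sqint (\<lambda>x. F (x, h x - \<epsilon>) - g x) \<and> nsq (\<lambda>x. F (x, h x - \<epsilon>) - g x) < e" if "e > 0" for e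
  proof -
    have "\<forall>\<^sub>F \<epsilon> in at_right 0. L2_norm (\<lambda>x. F (x, h x - \<epsilon>) - g x) < ennreal (sqrt e)"
      by (rule order_tendstoD(2)[OF lim]) (use that in simp)
    then show ?thesis
    proof eventually_elim
      case (elim \<epsilon>)
      note m = L2[OF elim]
      have "sqrt (nsq (\<lambda>x. F (x, h x - \<epsilon>) - g x)) < sqrt e"
        using elim that by (simp add: L2_norm_eq[OF m] ennreal_less_iff)
      then show ?case using L2_torus_sqint[OF m] by simp
    qed
  qed
  show "\<forall>\<^sub>F \<epsilon> in at_right 0. sqint (\<lambda>x. F (x, h x - \<epsilon>) - g x)"
    using small[of 1] by (auto elim: eventually_mono)
  show "((\<lambda>\<epsilon>. nsq (\<lambda>x. F (x, h x - \<epsilon>) - g x)) \<longlongrightarrow> 0) (at_right 0)"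
  proof (rule order_tendstoI)
    fix a :: real assume "a < 0"
    then show "\<forall>\<^sub>F \<epsilon> in at_right 0. a < nsq (\<lambda>x. F (x, h x - \<epsilon>) - g x)"
      by (intro always_eventually allI) (meson less_le_trans nsq_nonneg)
  next
    fix a :: real assume "0 < a"
    from small[OF this] show "\<forall>\<^sub>F \<epsilon> in at_right 0. nsq (\<lambda>x. F (x, h x - \<epsilon>) - g x) < a"
      by eventually_elim simp
  qed
qed

lemma nsq_difference_tendsto_0:
  fixes a b :: "real \<Rightarrow> real \<Rightarrow> real"
  assumes "\<forall>\<^sub>F \<epsilon> in F. sqint (\<lambda>x. a \<epsilon> x - g x)" "\<forall>\<^sub>F \<epsilon> in F. sqint (\<lambda>x. b \<epsilon> x - g x)"
    and "((\<lambda>\<epsilon>. nsq (\<lambda>x. a \<epsilon> x - g x)) \<longlongrightarrow> 0) F" "((\<lambda>\<epsilon>. nsq (\<lambda>x. b \<epsilon> x - g x)) \<longlongrightarrow> 0) F"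
  shows "((\<lambda>\<epsilon>. nsq (\<lambda>x. a \<epsilon> x - b \<epsilon> x)) \<longlongrightarrow> 0) F"
proof (rule tendsto_sandwich[of "\<lambda>_. 0"])
  show "((\<lambda>\<epsilon>. 2 * nsq (\<lambda>x. a \<epsilon> x - g x) + 2 * nsq (\<lambda>x. b \<epsilon> x - g x)) \<longlongrightarrow> 0) F"
    using tendsto_add[OF tendsto_mult_right_zero[OF assms(3), of 2] tendsto_mult_right_zero[OF assms(4), of 2]] by simp
  show "\<forall>\<^sub>F \<epsilon> in F. nsq (\<lambda>x. a \<epsilon> x - b \<epsilon> x) \<le> 2 * nsq (\<lambda>x. a \<epsilon> x - g x) + 2 * nsq (\<lambda>x. b \<epsilon> x - g x)"
    using assms(1,2)
  proof eventually_elim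
    case (elim \<epsilon>)
    then show ?case using sqint_diff(2)[OF elim] by simp
  qed
qed auto

text \<open>This pins down the trace selected by \<open>boundary_value\<close> up to a null
  set.\<close>

lemma has_boundary_value_unique:
  assumes "has_boundary_value h F g" "has_boundary_value h F g'"
  shows "AE x in circ. g x = g' x"
proof -
  have sg: "sqint g" "sqint g'"
    using assms L2_torus_sqint by (auto simp: has_boundary_value_def)
  have "((\<lambda>\<epsilon>::real. nsq (\<lambda>x. (F (x, h x - \<epsilon>) - g x) - (F (x, h x - \<epsilon>) - g' x))) \<longlongrightarrow> 0) (at_right 0)"
    using nsq_difference_tendsto_0[where F="at_right 0" and a="\<lambda>\<epsilon> x. F (x, h x - \<epsilon>) - g x"
        and g="\<lambda>_. 0" and b="\<lambda>\<epsilon> x. F (x, h x - \<epsilon>) - g' x"]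
      has_boundary_valueD[OF assms(1)] has_boundary_valueD[OF assms(2)] by simp
  then have "((\<lambda>\<epsilon>::real. nsq (\<lambda>x. g' x - g x)) \<longlongrightarrow> 0) (at_right 0)" by simp
  then have "nsq (\<lambda>x. g' x - g x) = 0" by (simp add: tendsto_const_iff)
  then have "AE x in circ. g' x - g x = 0"
    using nsq_eq_0_AE[OF sqint_diff(1)[OF sg(2,1)]] by simp
  then show ?thesis by eventually_elim simp
qed

context periodic_graph begin

lemma deriv_h_eq: "deriv h = h'"
  using deriv_h by (intro ext DERIV_imp_deriv)

lemma Wave_level: "Wave (x, h x - \<epsilon>) = lev (- \<epsilon>) x"
  by (simp add: Wave_def lev_def)

lemma level_in_subgraph: "\<epsilon> > 0 \<Longrightarrow> (x, h x - \<epsilon>) \<in> subgraph h"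
  by (simp add: subgraph_iff)

lemma tang_periodic: "tang (x + 2*pi) = tang x"
  by (simp add: tang_def h'_2pi)

lemma lev_add_2pi: "lev s (x + 2*pi) = lev s x"
  using lev_int[of s x 1] by simp

lemma L2_torus_level:
  assumes F: "F holomorphic_on below" and e: "\<epsilon> > 0"
  shows "(\<lambda>x. Re (F (lev (- \<epsilon>) x))) \<in> L2_torus" "(\<lambda>x. - Im (F (lev (- \<epsilon>) x) * tang x)) \<in> L2_torus"
proof -
  have c: "continuous_on S (\<lambda>x. Re (F (lev (- \<epsilon>) x)))" "continuous_on S (\<lambda>x. - Im (F (lev (- \<epsilon>) x) * tang x))" for S
    by (intro continuous_intros continuous_on_level[OF F e] cont_tang)+
  show "(\<lambda>x. Re (F (lev (- \<epsilon>) x))) \<in> L2_torus" "(\<lambda>x. - Im (F (lev (- \<epsilon>) x) * tang x)) \<in> L2_torus"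
    unfolding L2_torus_iff
    by (intro conjI borel_measurable_continuous_onI c sqint_continuous; simp add: periodic_def lev_add_2pi tang_periodic)+
qed

subsection \<open>Finite energy\<close>

text \<open>At depth below \<epsilon>0 the assumed bound is used. Deeper down the zero at w = 0
  takes over: there F = w G with G bounded, and |w| is of order e^(-\<epsilon>).\<close>

lemma level_exponential_decay:
  assumes F: "F holomorphic_on below" "F 0 = 0"
    and K: "\<forall>\<^sub>F \<epsilon> in at_right 0. nsq (\<lambda>x. F (lev (- \<epsilon>) x)) \<le> K"
  obtains C where "C \<ge> 0" "\<And>\<epsilon>. \<epsilon> > 0 \<Longrightarrow> nsq (\<lambda>x. F (lev (- \<epsilon>) x)) \<le> C * exp (- 2 * \<epsilon>)"
proof -
  obtain H where H: "H > 0" "\<And>x. \<bar>h x\<bar> \<le> H" using h_bounded by blast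
  obtain \<epsilon>0 where \<epsilon>0: "\<epsilon>0 > 0" "\<And>\<epsilon>. 0 < \<epsilon> \<Longrightarrow> \<epsilon> < \<epsilon>0 \<Longrightarrow> nsq (\<lambda>x. F (lev (- \<epsilon>) x)) \<le> K"
    using K unfolding eventually_at_right_field by auto
  have K0: "0 \<le> K" using \<epsilon>0(2)[of "\<epsilon>0/2"] \<epsilon>0(1) nsq_nonneg[of "\<lambda>x. F (lev (- (\<epsilon>0/2)) x)"] by linarith
  define G where "G = (\<lambda>w. if w = 0 then deriv F 0 else (F w - F 0) / (w - 0))"
  have G: "G holomorphic_on below" unfolding G_def by (rule pole_lemma_open[OF F(1) open_below])
  have FG: "F w = w * G w" for w using F(2) by (simp add: G_def)
  \<comment> \<open>The region on and below the level -\<epsilon>0 together with the point 0, a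
    compact subset of the domain.\<close>
  define Q where "Q = (\<lambda>p. of_real (fst p) * curve (snd p)) ` ({0..exp (- \<epsilon>0)} \<times> {0..2*pi})"
  have "compact Q"
    unfolding Q_def
    by (intro compact_continuous_image compact_Times compact_Icc continuous_intros continuous_on_compose2[OF cont_lev]) auto
  moreover have "Q \<subseteq> below"
  proof
    fix w assume "w \<in> Q"
    then obtain t x where t: "0 \<le> t" "t \<le> exp (- \<epsilon>0)" "w = of_real t * curve x" unfolding Q_def by force
    show "w \<in> below"
    proof (cases "t = 0")
      case False
      then have "w = lev (ln t) x" using t by (simp add: lev_curve[of "ln t"])
      moreover have "ln t < 0"
      proof -
        have "t < 1" using t(2) \<epsilon>0(1) by (meson exp_less_one_iff le_less_trans neg_less_0_iff_less)
        then show ?thesis using t(1) False by simp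
      qed
      ultimately show ?thesis by (simp add: lev_in_below_iff)
    qed (use t in \<open>simp add: zero_in_below\<close>)
  qed
  ultimately have "bounded (G ` Q)"
    using holomorphic_on_imp_continuous_on[OF G] by (meson compact_continuous_image compact_imp_bounded continuous_on_subset)
  then obtain B where B: "B > 0" "\<And>w. w \<in> Q \<Longrightarrow> norm (G w) \<le> B" unfolding bounded_pos by auto
  define C1 where "C1 = 2*pi * (exp H * B)\<^sup>2"
  define C2 where "C2 = K * exp (2 * \<epsilon>0)"
  show thesis
  proof (rule that)
    show "C1 + C2 \<ge> 0" using K0 by (simp add: C1_def C2_def)
    fix \<epsilon> :: real assume e: "\<epsilon> > 0"
    show "nsq (\<lambda>x. F (lev (- \<epsilon>) x)) \<le> (C1 + C2) * exp (- 2 * \<epsilon>)"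
    proof (cases "\<epsilon> < \<epsilon>0")
      case True
      have "nsq (\<lambda>x. F (lev (- \<epsilon>) x)) \<le> K * 1" using \<epsilon>0(2)[OF e True] by simp
      also have "\<dots> \<le> K * (exp (2 * \<epsilon>0) * exp (- 2 * \<epsilon>))"
        using True K0 by (intro mult_left_mono) (auto simp flip: exp_add)
      also have "\<dots> \<le> (C1 + C2) * exp (- 2 * \<epsilon>)" by (simp add: C1_def C2_def algebra_simps)
      finally show ?thesis .
    next
      case False
      have "nsq (\<lambda>x. F (lev (- \<epsilon>) x)) \<le> 2*pi * (exp H * B * exp (- \<epsilon>))\<^sup>2"
      proof (rule nsq_bounded)
        show "(\<lambda>x. F (lev (- \<epsilon>) x)) \<in> borel_measurable circ"
          by (rule sqint_measurable[OF sqint_level[OF F(1) e]])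
        fix x :: real assume x: "x \<in> {0..2*pi}"
        have "lev (- \<epsilon>) x \<in> Q"
          unfolding Q_def using x False by (intro image_eqI[of _ _ "(exp (- \<epsilon>), x)"]) (auto simp: lev_curve[of "- \<epsilon>"])
        then have "norm (F (lev (- \<epsilon>) x)) \<le> norm (lev (- \<epsilon>) x) * B"
          unfolding FG norm_mult by (intro mult_left_mono B) auto
        also have "norm (lev (- \<epsilon>) x) = exp (h x) * exp (- \<epsilon>)"
          by (simp add: norm_lev exp_diff exp_minus divide_inverse)
        also have "exp (h x) * exp (- \<epsilon>) * B \<le> exp H * exp (- \<epsilon>) * B"
          using H(2)[of x] B(1) by (intro mult_right_mono) auto
        finally show "norm (F (lev (- \<epsilon>) x)) \<le> exp H * B * exp (- \<epsilon>)" by (simp add: mult_ac)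
      qed
      also have "\<dots> = C1 * exp (- 2 * \<epsilon>)"
      proof -
        have "(exp (- \<epsilon>))\<^sup>2 = exp (- 2 * \<epsilon>)" by (simp flip: exp_of_nat_mult)
        then show ?thesis by (simp add: C1_def power_mult_distrib)
      qed
      also have "\<dots> \<le> (C1 + C2) * exp (- 2 * \<epsilon>)"
        using K0 by (intro mult_right_mono) (auto simp: C2_def)
      finally show ?thesis .
    qed
  qed
qed

text \<open>The coordinates x and depth \<epsilon> = h(x) - y preserve area, so Tonelli's theorem
  reduces the energy to an integral of the squared level norms over the depth.\<close>

lemma energy_integrable:
  assumes F: "F holomorphic_on below"
    and C: "C \<ge> 0" "\<And>\<epsilon>. \<epsilon> > 0 \<Longrightarrow> nsq (\<lambda>x. F (lev (- \<epsilon>) x)) \<le> C * exp (- 2 * \<epsilon>)"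
  shows "set_integrable lborel (subgraph h \<inter> {0..2*pi} \<times> UNIV) (\<lambda>p. (norm (F (Wave p)))\<^sup>2)"
proof -
  let ?A = "subgraph h \<inter> {0..2*pi} \<times> UNIV"
  define f where "f p = indicator ?A p *\<^sub>R (norm (F (Wave p)))\<^sup>2" for p
  have A: "?A \<in> sets borel"
    using open_subgraph by (intro sets.Int borel_open borel_closed closed_Times) auto
  have f_meas: "f \<in> borel_measurable borel"
    unfolding f_def
    by (rule borel_measurable_continuous_on_indicator[OF A])
       (intro continuous_intros continuous_on_subset[OF continuous_on_Wave[OF F]], auto)
  have f0: "f p \<ge> 0" for p by (simp add: f_def)
  define g where "g x \<epsilon> = ennreal (f (x, h x - \<epsilon>))" for x \<epsilon>
  have "(\<lambda>p. (fst p, h (fst p) - snd p)) \<in> borel_measurable (borel :: (real \<times> real) measure)"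
    by (intro borel_measurable_continuous_onI continuous_intros continuous_on_compose2[OF cont_h]) auto
  from measurable_compose[OF this f_meas]
  have g_meas: "case_prod g \<in> borel_measurable (lborel \<Otimes>\<^sub>M lborel)"
    unfolding lborel_prod g_def split_beta by simp
  have "(\<integral>\<^sup>+p. ennreal (f p) \<partial>lborel) = (\<integral>\<^sup>+x. \<integral>\<^sup>+y. ennreal (f (x, y)) \<partial>lborel \<partial>lborel)"
    unfolding lborel_prod[symmetric, where ?'a=real and ?'b=real]
    by (rule lborel.nn_integral_fst[symmetric]) (use f_meas in \<open>simp add: lborel_prod\<close>)
  also have "\<dots> = (\<integral>\<^sup>+x. \<integral>\<^sup>+\<epsilon>. g x \<epsilon> \<partial>lborel \<partial>lborel)"
  proof (rule nn_integral_cong)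
    fix x :: real
    have "(\<lambda>y. ennreal (f (x, y))) \<in> borel_measurable borel"
      using f_meas by measurable
    from nn_integral_real_affine[OF this, of "-1" "h x"]
    show "(\<integral>\<^sup>+y. ennreal (f (x, y)) \<partial>lborel) = (\<integral>\<^sup>+\<epsilon>. g x \<epsilon> \<partial>lborel)"
      by (simp add: g_def)
  qed
  also have "\<dots> = (\<integral>\<^sup>+\<epsilon>. \<integral>\<^sup>+x. g x \<epsilon> \<partial>lborel \<partial>lborel)"
    by (rule lborel_pair.Fubini'[OF g_meas, symmetric])
  also have "\<dots> \<le> (\<integral>\<^sup>+\<epsilon>. ennreal (C * exp (- 2 * \<epsilon>)) * indicator {0..} \<epsilon> \<partial>lborel)"
  proof (rule nn_integral_mono)
    fix \<epsilon> :: real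
    show "(\<integral>\<^sup>+x. g x \<epsilon> \<partial>lborel) \<le> ennreal (C * exp (- 2 * \<epsilon>)) * indicator {0..} \<epsilon>"
    proof (cases "\<epsilon> > 0")
      case True
      have "(\<integral>\<^sup>+x. g x \<epsilon> \<partial>lborel) = (\<integral>\<^sup>+x. ennreal ((norm (F (lev (- \<epsilon>) x)))\<^sup>2) * indicator {0..2*pi} x \<partial>lborel)"
        by (rule nn_integral_cong)
           (use True in \<open>auto simp: g_def f_def Wave_level subgraph_iff indicator_def\<close>)
      also have "\<dots> = (\<integral>\<^sup>+x. ennreal ((norm (F (lev (- \<epsilon>) x)))\<^sup>2) \<partial>circ)"
        unfolding circ_def by (rule nn_integral_restrict_space[symmetric]) simp
      also have "\<dots> = ennreal (nsq (\<lambda>x. F (lev (- \<epsilon>) x)))"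
        unfolding nsq_def using sqint_level[OF F True]
        by (intro nn_integral_eq_integral) (auto simp: sqint_def)
      also have "\<dots> \<le> ennreal (C * exp (- 2 * \<epsilon>))" by (rule ennreal_leI[OF C(2)[OF True]])
      finally show ?thesis using True by simp
    next
      case False
      then have "g x \<epsilon> = 0" for x by (simp add: g_def f_def subgraph_iff)
      then show ?thesis by simp
    qed
  qed
  also have "\<dots> = ennreal (0 - (- C / 2 * exp (- 2 * 0)))"
  proof (rule nn_integral_FTC_atLeast)
    show "((\<lambda>x. - C / 2 * exp (- 2 * x)) has_real_derivative C * exp (- 2 * x)) (at x)" for x
      by (auto intro!: derivative_eq_intros)
    have "((\<lambda>x::real. - C / 2 * exp (- 2 * x)) \<longlongrightarrow> - C / 2 * 0) at_top"
      by (intro tendsto_intros filterlim_compose[OF exp_at_bot] filterlim_tendsto_neg_mult_at_bot[OF tendsto_const _ filterlim_ident]) auto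
    then show "((\<lambda>x::real. - C / 2 * exp (- 2 * x)) \<longlongrightarrow> 0) at_top" by simp
  qed (use C in auto)
  also have "\<dots> < \<infinity>" by simp
  finally have "integrable lborel f"
    using f_meas f0 by (intro integrableI_nonneg) auto
  then show ?thesis by (simp add: set_integrable_def f_def[abs_def])
qed


section \<open>The boundary value of the analytic potential\<close>

lemma Re_primitive:
  assumes "integrable circ f"
  shows "Re (primitive f x) = primitive (\<lambda>t. Re (f t)) x"
  unfolding primitive_def integral_Re[OF integrable_indicator_circ[OF assms], symmetric] by simp

lemma primitive_cong_AE:
  fixes f g :: "real \<Rightarrow> real"
  assumes "integrable circ f" "integrable circ g" "AE t in circ. f t = g t"
  shows "primitive f x = primitive g x"
  unfolding primitive_def
  by (rule integral_cong_AE)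
     (use assms borel_measurable_integrable[OF integrable_indicator_circ] in \<open>auto elim: eventually_mono\<close>)

text \<open>Along a level \<Phi> is its value at x = 0 plus the primitive of F \<open>tang\<close>,
  so L^2 convergence of F gives uniform convergence up to a constant. Cauchy's formula settles that
  constant: the integral of \<Phi> \<open>tang\<close> is 2 pi \<Phi>(0) on every level.\<close>

lemma analytic_potential_boundary_value:
  assumes u: "sqint u" "moments_vanish u"
    and \<Phi>: "\<And>w. w \<in> below \<Longrightarrow> (\<Phi> has_field_derivative \<i> * G w) (at w)"
    and G: "G holomorphic_on below" "\<And>w. w * G w = Cauchy_integral u w"
  shows "\<exists>L \<delta>. (\<delta> \<longlongrightarrow> 0) (at_right 0) \<and> (\<forall>\<epsilon>>0. \<forall>x\<in>{0..2*pi}.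
       norm (\<Phi> (lev (- \<epsilon>) x) - (L + primitive (\<lambda>t. u t * tang t) x)) \<le> \<delta> \<epsilon>)"
proof -
  obtain T where T: "T > 0" "\<And>x. x \<in> {0..2*pi} \<Longrightarrow> norm (tang x) \<le> T" using tang_bounded by blast
  let ?F = "Cauchy_integral u"
  have F: "?F holomorphic_on below"
    by (rule Cauchy_integral_holomorphic[OF sqint_L1(1)[OF u(1)] curve_notin(1)])
  have \<Phi>_holo: "\<Phi> holomorphic_on below" using \<Phi> by (auto simp: holomorphic_on_open[OF open_below])
  define v where "v \<epsilon> x = ?F (lev (- \<epsilon>) x) * tang x" for \<epsilon> x
  define w where "w x = u x * tang x" for x
  have sw: "sqint w" unfolding w_def by (rule sqint_mult_tang[OF u(1)])
  have iw: "integrable circ w" by (rule sqint_L1(1)[OF sw])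
  have cv: "continuous_on S (v \<epsilon>)" if "\<epsilon> > 0" for \<epsilon> S
    unfolding v_def by (intro continuous_intros continuous_on_level[OF F that] cont_tang)
  have iv: "integrable circ (v \<epsilon>)" if "\<epsilon> > 0" for \<epsilon>
    by (rule integrable_circ_continuous[OF cv[OF that]])
  define D where "D \<epsilon> = T * sqrt (2*pi * nsq (\<lambda>x. ?F (lev (- \<epsilon>) x) - u x))" for \<epsilon>
  have D_lim: "(D \<longlongrightarrow> T * sqrt (2*pi * 0)) (at_right 0)"
    unfolding D_def by (intro tendsto_intros Cauchy_integral_boundary_value[OF u])
  have L1: "(\<integral>x. norm (v \<epsilon> x - w x) \<partial>circ) \<le> D \<epsilon>" if e: "\<epsilon> > 0" for \<epsilon>
  proof -
    have sd: "sqint (\<lambda>x. ?F (lev (- \<epsilon>) x) - u x)" by (rule sqint_diff(1)[OF sqint_level[OF F e] u(1)])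
    have "(\<integral>x. norm (v \<epsilon> x - w x) \<partial>circ) \<le> (\<integral>x. T * norm (?F (lev (- \<epsilon>) x) - u x) \<partial>circ)"
    proof (rule integral_mono)
      fix x assume "x \<in> space circ"
      then have "norm (?F (lev (- \<epsilon>) x) - u x) * norm (tang x) \<le> norm (?F (lev (- \<epsilon>) x) - u x) * T"
        using T(2) by (intro mult_left_mono) auto
      then show "norm (v \<epsilon> x - w x) \<le> T * norm (?F (lev (- \<epsilon>) x) - u x)"
        by (simp only: v_def w_def norm_mult mult.commute[of T] flip: left_diff_distrib)
    qed (use iv[OF e] iw sqint_L1(1)[OF sd] in auto)
    also have "\<dots> \<le> D \<epsilon>"
      unfolding D_def using sqint_L1(2)[OF sd] T(1) by simp
    finally show ?thesis .
  qed
  define E0 where "E0 = primitive w"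
  have E_diff: "norm (primitive (v \<epsilon>) x - E0 x) \<le> D \<epsilon>" if e: "\<epsilon> > 0" for \<epsilon> x
  proof -
    have "primitive (v \<epsilon>) x - E0 x = primitive (\<lambda>t. v \<epsilon> t - w t) x"
      unfolding E0_def by (rule primitive_diff[OF iv[OF e] iw, symmetric])
    also have "norm \<dots> \<le> (\<integral>t. norm (v \<epsilon> t - w t) \<partial>circ)"
      by (rule norm_primitive_le) (use iv[OF e] iw in simp)
    also have "\<dots> \<le> D \<epsilon>" by (rule L1[OF e])
    finally show ?thesis .
  qed
  have \<Phi>_eq: "\<Phi> (lev (- \<epsilon>) x) = \<Phi> (lev (- \<epsilon>) 0) + primitive (v \<epsilon>) x" if e: "\<epsilon> > 0" and x: "x \<in> {0..2*pi}" for \<epsilon> x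
  proof -
    have deriv: "((\<Phi> \<circ> lev (- \<epsilon>)) has_vector_derivative v \<epsilon> t) (at t)" for t
    proof -
      have "((\<Phi> \<circ> lev (- \<epsilon>)) has_vector_derivative (- \<i> * tang t * lev (- \<epsilon>) t) * (\<i> * G (lev (- \<epsilon>) t))) (at t)"
        by (rule field_vector_diff_chain_at[OF deriv_lev \<Phi>]) (use e in \<open>simp add: lev_in_below_iff\<close>)
      moreover have "(- \<i> * tang t * lev (- \<epsilon>) t) * (\<i> * G (lev (- \<epsilon>) t)) = v \<epsilon> t"
      proof -
        have "(- a * b * c) * (a * d) = - (a * a) * (c * d * b)" for a b c d :: complex
          by (simp add: mult_ac)
        from this[of \<i>] show ?thesis unfolding v_def G(2)[symmetric] by simp
      qed
      ultimately show ?thesis by simp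
    qed
    have "primitive (v \<epsilon>) x = (\<Phi> \<circ> lev (- \<epsilon>)) x - (\<Phi> \<circ> lev (- \<epsilon>)) 0"
      unfolding primitive_def
      by (rule integral_circ_FTC_upto[OF has_vector_derivative_at_within[OF deriv] cv[OF e] x])
    then show ?thesis by simp
  qed
  have E0_meas: "E0 \<in> borel_measurable circ"
    unfolding E0_def by (rule primitive_measurable) (use iw in auto)
  have iE0: "integrable circ E0"
    by (rule integrable_circ_bounded[OF E0_meas]) (unfold E0_def, rule norm_primitive_le[OF iw])
  have iE0t: "integrable circ (\<lambda>x. E0 x * tang x)"
    by (rule integrable_circ_mult_continuous[OF iE0 cont_tang])
  \<comment> \<open>The limit of \<Phi> at x = 0, found by integrating against \<open>tang\<close>,
    whose total integral is 2 pi.\<close>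
  define L where "L = \<Phi> 0 - (\<integral>x. E0 x * tang x \<partial>circ) / (2*pi)"
  have base: "norm (\<Phi> (lev (- \<epsilon>) 0) - L) \<le> T * D \<epsilon>" if e: "\<epsilon> > 0" for \<epsilon>
  proof -
    let ?c = "\<Phi> (lev (- \<epsilon>) 0)"
    have i1: "integrable circ (\<lambda>x. \<Phi> (lev (- \<epsilon>) x) * tang x)"
      by (intro integrable_circ_continuous continuous_intros continuous_on_level[OF \<Phi>_holo e] cont_tang)
    have it: "integrable circ (\<lambda>x. ?c * tang x)"
      by (intro integrable_circ_continuous continuous_intros cont_tang)
    have "2*pi * (?c - L) = (\<integral>x. ?c * tang x \<partial>circ) - (\<integral>x. \<Phi> (lev (- \<epsilon>) x) * tang x \<partial>circ) + (\<integral>x. E0 x * tang x \<partial>circ)"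
      unfolding Cauchy_formula_0[OF \<Phi>_holo e] by (simp add: integral_tang L_def field_simps)
    also have "\<dots> = (\<integral>x. ?c * tang x - \<Phi> (lev (- \<epsilon>) x) * tang x + E0 x * tang x \<partial>circ)"
      using i1 it iE0t by simp
    also have "norm \<dots> \<le> (\<integral>x. T * D \<epsilon> \<partial>circ)"
    proof (rule Bochner_Integration.integral_norm_bound_integral)
      fix x assume "x \<in> space circ"
      then have x: "x \<in> {0..2*pi}" by simp
      have "?c * tang x - \<Phi> (lev (- \<epsilon>) x) * tang x + E0 x * tang x = (E0 x - primitive (v \<epsilon>) x) * tang x"
        unfolding \<Phi>_eq[OF e x] by (simp add: algebra_simps)
      also have "norm \<dots> \<le> D \<epsilon> * T"
        unfolding norm_mult using E_diff[OF e, of x] T(2)[OF x]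
        by (intro mult_mono) (auto simp: norm_minus_commute intro: order_trans[OF norm_ge_zero])
      finally show "norm (?c * tang x - \<Phi> (lev (- \<epsilon>) x) * tang x + E0 x * tang x) \<le> T * D \<epsilon>"
        by (simp add: mult.commute)
    next
      show "integrable circ (\<lambda>x. ?c * tang x - \<Phi> (lev (- \<epsilon>) x) * tang x + E0 x * tang x)"
        by (intro Bochner_Integration.integrable_add Bochner_Integration.integrable_diff it i1 iE0t)
    qed simp
    also have "\<dots> = 2*pi * (T * D \<epsilon>)"
      by (simp only: lebesgue_integral_const measure_circ space_circ real_scaleR_def)
    finally have "2*pi * norm (?c - L) \<le> 2*pi * (T * D \<epsilon>)" by (simp add: norm_mult)
    then show ?thesis by simp
  qed
  show ?thesis
  proof (intro exI[of _ L] exI[of _ "\<lambda>\<epsilon>. T * D \<epsilon> + D \<epsilon>"] conjI allI impI ballI)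
    have "((\<lambda>\<epsilon>. T * D \<epsilon> + D \<epsilon>) \<longlongrightarrow> T * (T * sqrt (2*pi * 0)) + T * sqrt (2*pi * 0)) (at_right 0)"
      by (intro tendsto_intros D_lim)
    then show "((\<lambda>\<epsilon>. T * D \<epsilon> + D \<epsilon>) \<longlongrightarrow> 0) (at_right 0)" by simp
    fix \<epsilon> x :: real assume e: "\<epsilon> > 0" and x: "x \<in> {0..2*pi}"
    have "\<Phi> (lev (- \<epsilon>) x) - (L + E0 x) = (\<Phi> (lev (- \<epsilon>) 0) - L) + (primitive (v \<epsilon>) x - E0 x)"
      by (simp add: \<Phi>_eq[OF e x])
    also have "norm \<dots> \<le> T * D \<epsilon> + D \<epsilon>"
      by (rule norm_triangle_le[OF add_mono[OF base[OF e] E_diff[OF e]]])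
    finally show "norm (\<Phi> (lev (- \<epsilon>) x) - (L + primitive (\<lambda>t. u t * tang t) x)) \<le> T * D \<epsilon> + D \<epsilon>"
      by (simp add: E0_def w_def[abs_def])
  qed
qed

text \<open>That Re(u \<open>tang\<close>) equals g fixes the boundary data up to a constant. The
  vanishing integral of u \<open>tang\<close> means F(0) = 0, which is the decay of the gradient at
  y = -infinity and the source of the finite energy.\<close>

theorem exists_dirichlet_solution:
  assumes \<zeta>: "\<zeta> \<in> L2_torus" "has_weak_deriv \<zeta> g" "sqint g"
  obtains u \<Phi> where "sqint u" "moments_vanish u" "(\<integral>x. u x * tang x \<partial>circ) = 0"
    "AE x in circ. Re (u x * tang x) = g x" "\<Phi> holomorphic_on below"
    "\<And>w. w \<in> below \<Longrightarrow> euler \<Phi> w = \<i> * Cauchy_integral u w"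
    "dirichlet_solution h \<zeta> (\<lambda>p. Re (\<Phi> (Wave p)))"
proof -
  obtain u where u: "sqint u" "moments_vanish u" "(\<integral>x. u x * tang x \<partial>circ) = 0"
    and ug: "AE x in circ. Re (u x * tang x) = g x"
    using exists_analytic_boundary_function[OF \<zeta>(3) has_weak_deriv_mean_zero[OF \<zeta>(2)]] by blast
  let ?F = "Cauchy_integral u"
  have F: "?F holomorphic_on below"
    by (rule Cauchy_integral_holomorphic[OF sqint_L1(1)[OF u(1)] curve_notin(1)])
  have F0: "?F 0 = 0" by (simp add: Cauchy_integral_zero u(3))
  \<comment> \<open>F(0) = 0 removes the singularity of F(w)/w, and integrating i F(w)/w inverts
    \<open>euler\<close>.\<close>
  define G where "G = (\<lambda>w. if w = 0 then deriv ?F 0 else (?F w - ?F 0) / (w - 0))"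
  have G: "G holomorphic_on below" unfolding G_def by (rule pole_lemma_open[OF F open_below])
  have wG: "w * G w = ?F w" for w by (simp add: G_def F0)
  have "(\<lambda>w. \<i> * G w) holomorphic_on below" by (intro holomorphic_intros G)
  then obtain \<Psi> where \<Psi>: "\<And>w. w \<in> below \<Longrightarrow> (\<Psi> has_field_derivative \<i> * G w) (at w)"
    using holomorphic_primitive_below by blast
  have "\<exists>L \<delta>. (\<delta> \<longlongrightarrow> 0) (at_right 0) \<and> (\<forall>\<epsilon>>0. \<forall>x\<in>{0..2*pi}.
       norm (\<Psi> (lev (- \<epsilon>) x) - (L + primitive (\<lambda>t. u t * tang t) x)) \<le> \<delta> \<epsilon>)"
    by (rule analytic_potential_boundary_value[OF u(1,2) \<Psi> G wG])
  then obtain L \<delta> where \<delta>: "(\<delta> \<longlongrightarrow> 0) (at_right 0)"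
    and close: "\<forall>\<epsilon>>0. \<forall>x\<in>{0..2*pi}.
       norm (\<Psi> (lev (- \<epsilon>) x) - (L + primitive (\<lambda>t. u t * tang t) x)) \<le> \<delta> \<epsilon>"
    by (elim exE conjE)
  obtain c where c: "AE x in circ. \<zeta> x = c + primitive g x"
    using has_weak_deriv_primitive[OF \<zeta>(2)] .
  \<comment> \<open>The added real number matches the constant of integration of the boundary
    data.\<close>
  define \<Phi> where "\<Phi> w = \<Psi> w + of_real (c - Re L)" for w
  have \<Phi>: "(\<Phi> has_field_derivative \<i> * G w) (at w)" if "w \<in> below" for w
    unfolding \<Phi>_def using \<Psi>[OF that] by (auto intro!: derivative_eq_intros)
  have \<Phi>_holo: "\<Phi> holomorphic_on below" using \<Phi> by (auto simp: holomorphic_on_open[OF open_below])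
  have eul: "euler \<Phi> w = \<i> * ?F w" if "w \<in> below" for w
    using DERIV_imp_deriv[OF \<Phi>[OF that]] wG[of w] by (simp add: euler_def)
  define \<phi> where "\<phi> p = Re (\<Phi> (Wave p))" for p
  have grad: "grad \<phi> p = (Re (?F (Wave p)), - Im (?F (Wave p)))" if "p \<in> subgraph h" for p
    using Re_Wave_partials[OF \<Phi>_holo that, of 1] eul[of "Wave p"] that
    by (simp add: grad_def \<phi>_def[abs_def] Wave_in_below_iff)
  have norm_grad: "norm (grad \<phi> p) = norm (?F (Wave p))" if "p \<in> subgraph h" for p
    unfolding grad[OF that] by (simp add: norm_prod_def cmod_def)
  have "dirichlet_solution h \<zeta> \<phi>"
    unfolding dirichlet_solution_def
  proof (intro conjI allI impI)
    show "\<phi> (x + 2*pi, y) = \<phi> (x, y)" for x y by (simp add: \<phi>_def Wave_def)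
    show "harmonic_on (subgraph h) \<phi>" by (rule Re_Wave_harmonic[OF \<Phi>_holo]) (simp add: \<phi>_def)
    have "\<forall>\<^sub>F \<epsilon> in at_right 0. nsq (\<lambda>x. ?F (lev (- \<epsilon>) x)) \<le> 2 + 2 * nsq u"
      by (rule tendsto_nsq[OF _ u(1) Cauchy_integral_boundary_value[OF u(1,2)]])
         (auto intro!: eventually_at_rightI[of 0 1] sqint_level[OF F])
    then obtain C where "C \<ge> 0" "\<And>\<epsilon>. \<epsilon> > 0 \<Longrightarrow> nsq (\<lambda>x. ?F (lev (- \<epsilon>) x)) \<le> C * exp (- 2 * \<epsilon>)"
      using level_exponential_decay[OF F F0] by blast
    then have "set_integrable lborel (subgraph h \<inter> {0..2*pi} \<times> UNIV) (\<lambda>p. (norm (?F (Wave p)))\<^sup>2)"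
      by (rule energy_integrable[OF F])
    then show "set_integrable lborel (subgraph h \<inter> {0..2*pi} \<times> UNIV) (\<lambda>p. (norm (grad \<phi> p))\<^sup>2)"
      by (subst set_integrable_cong[OF refl refl]) (auto simp: norm_grad)
    show "has_boundary_value h \<phi> \<zeta>"
    proof (rule has_boundary_valueI[OF \<zeta>(1)])
      show "(\<lambda>x. \<phi> (x, h x - \<epsilon>)) \<in> L2_torus" if "\<epsilon> > 0" for \<epsilon>
        using L2_torus_level(1)[OF \<Phi>_holo that] by (simp add: \<phi>_def Wave_level)
      have est: "nsq (\<lambda>x. \<phi> (x, h x - \<epsilon>) - \<zeta> x) \<le> (\<delta> \<epsilon>)\<^sup>2 * (2*pi)" if e: "\<epsilon> > 0" for \<epsilon>
      proof -
        have iu: "integrable circ (\<lambda>t. u t * tang t)" by (rule sqint_L1(1)[OF sqint_mult_tang[OF u(1)]])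
        have ae: "AE x in circ. norm (\<phi> (x, h x - \<epsilon>) - \<zeta> x) \<le> \<delta> \<epsilon> * norm (1::real)"
          using c AE_space
        proof eventually_elim
          case (elim x)
          then have x: "x \<in> {0..2*pi}" by simp
          have "Re (primitive (\<lambda>t. u t * tang t) x) = primitive g x"
            unfolding Re_primitive[OF iu]
            by (rule primitive_cong_AE[OF integrable_Re[OF iu] sqint_L1(1)[OF \<zeta>(3)] ug])
          then have "\<phi> (x, h x - \<epsilon>) - \<zeta> x = Re (\<Psi> (lev (- \<epsilon>) x) - (L + primitive (\<lambda>t. u t * tang t) x))"
            using elim by (simp add: \<phi>_def Wave_level \<Phi>_def)
          then have "norm (\<phi> (x, h x - \<epsilon>) - \<zeta> x) \<le> norm (\<Psi> (lev (- \<epsilon>) x) - (L + primitive (\<lambda>t. u t * tang t) x))"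
            by (simp only: real_norm_def abs_Re_le_cmod)
          then show ?case using close[rule_format, OF e x] by simp
        qed
        have "(\<lambda>x. \<phi> (x, h x - \<epsilon>) - \<zeta> x) \<in> borel_measurable circ"
          using L2_torus_level(1)[OF \<Phi>_holo e] \<zeta>(1) L2_torus_sqint sqint_measurable
          by (auto simp: \<phi>_def Wave_level intro!: borel_measurable_diff)
        from sqint_dominated(2)[OF this sqint_const ae] show ?thesis by (simp add: nsq_const)
      qed
      show "((\<lambda>\<epsilon>. nsq (\<lambda>x. \<phi> (x, h x - \<epsilon>) - \<zeta> x)) \<longlongrightarrow> 0) (at_right 0)"
      proof (rule tendsto_sandwich[of "\<lambda>_. 0"])
        have "((\<lambda>\<epsilon>. (\<delta> \<epsilon>)\<^sup>2 * (2*pi)) \<longlongrightarrow> 0\<^sup>2 * (2*pi)) (at_right 0)"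
          by (intro tendsto_intros \<delta>)
        then show "((\<lambda>\<epsilon>. (\<delta> \<epsilon>)\<^sup>2 * (2*pi)) \<longlongrightarrow> 0) (at_right 0)" by simp
        show "\<forall>\<^sub>F \<epsilon> in at_right 0. nsq (\<lambda>x. \<phi> (x, h x - \<epsilon>) - \<zeta> x) \<le> (\<delta> \<epsilon>)\<^sup>2 * (2*pi)"
          by (intro eventually_at_rightI[of 0 1]) (auto simp: est)
      qed auto
    qed
    show "uniform_limit UNIV (\<lambda>y x. grad \<phi> (x, y)) (\<lambda>x. 0) at_bot"
      unfolding uniform_limit_iff
    proof (intro allI impI)
      fix e :: real assume e: "e > 0"
      obtain r where r: "r > 0" "ball 0 r \<subseteq> below" by (rule openE[OF open_below zero_in_below])
      have "isCont ?F 0"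
        using holomorphic_on_imp_continuous_on[OF F] zero_in_below
        by (simp add: continuous_on_eq_continuous_at[OF open_below])
      then obtain d where d: "d > 0" "\<And>w. dist w 0 < d \<Longrightarrow> dist (?F w) (?F 0) < e"
        using e unfolding continuous_at_eps_delta by blast
      have "dist (grad \<phi> (x, y)) 0 < e" if y: "y \<le> ln (min d r / 2)" for x y
      proof -
        have m: "min d r / 2 > 0" using d(1) r(1) by simp
        have "exp y \<le> min d r / 2" using y m by (metis exp_le_cancel_iff exp_ln)
        then have small: "norm (Wave (x, y)) < d" "norm (Wave (x, y)) < r" using m by (simp_all add: Wave_def)
        then have "Wave (x, y) \<in> below" using r(2) by (auto simp: subset_iff)
        then have "(x, y) \<in> subgraph h" by (simp add: Wave_in_below_iff)
        then show ?thesis using norm_grad d(2)[of "Wave (x, y)"] small(1) F0 by (simp add: dist_norm)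
      qed
      then show "\<forall>\<^sub>F y in at_bot. \<forall>x\<in>UNIV. dist (grad \<phi> (x, y)) 0 < e"
        unfolding eventually_at_bot_linorder by blast
    qed
  qed
  then have sol: "dirichlet_solution h \<zeta> (\<lambda>p. Re (\<Phi> (Wave p)))" by (simp add: \<phi>_def[abs_def])
  show thesis by (rule that[OF u ug \<Phi>_holo eul sol])
qed

text \<open>\<open>potential\<close> is an arbitrary solution, so every solution has to be compared
  with the constructed one. Each is the real part of an analytic function; their difference has a
  real part with zero trace, hence is an imaginary constant.\<close>

lemma dirichlet_solution_gradient:
  assumes P: "dirichlet_solution h \<zeta> P"
    and \<Phi>: "\<Phi> holomorphic_on below" "\<And>w. w \<in> below \<Longrightarrow> euler \<Phi> w = \<i> * F w"
    and sol: "dirichlet_solution h \<zeta> (\<lambda>p. Re (\<Phi> (Wave p)))"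
    and p: "p \<in> subgraph h"
  shows "pdx P p = Re (F (Wave p))" "pdy P p = - Im (F (Wave p))"
proof -
  obtain \<Psi> where \<Psi>: "\<Psi> holomorphic_on below" "\<And>p. p \<in> subgraph h \<Longrightarrow> P p = Re (\<Psi> (Wave p))"
    using P harmonic_imp_Re_Wave[of P] unfolding dirichlet_solution_def by blast
  have bv: "has_boundary_value h P \<zeta>" "has_boundary_value h (\<lambda>p. Re (\<Phi> (Wave p))) \<zeta>"
    using P sol by (auto simp: dirichlet_solution_def)
  have lim: "((\<lambda>\<epsilon>. nsq (\<lambda>x. P (x, h x - \<epsilon>) - Re (\<Phi> (Wave (x, h x - \<epsilon>))))) \<longlongrightarrow> 0) (at_right 0)"
    by (rule nsq_difference_tendsto_0[OF has_boundary_valueD(1)[OF bv(1)] has_boundary_valueD(1)[OF bv(2)]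
        has_boundary_valueD(2)[OF bv(1)] has_boundary_valueD(2)[OF bv(2)]])
  have "\<forall>\<^sub>F \<epsilon> in at_right 0. nsq (\<lambda>x. P (x, h x - \<epsilon>) - Re (\<Phi> (Wave (x, h x - \<epsilon>))))
      = nsq (\<lambda>x. Re (\<Psi> (lev (- \<epsilon>) x) - \<Phi> (lev (- \<epsilon>) x)))"
    by (intro eventually_at_rightI[of 0 1]) (auto simp: \<Psi>(2) level_in_subgraph Wave_level)
  from Lim_transform_eventually[OF lim this]
  obtain b where b: "\<And>w. w \<in> below \<Longrightarrow> \<Psi> w - \<Phi> w = \<i> * of_real b"
    using Re_boundary_zero_imp_imaginary_constant[of "\<lambda>w. \<Psi> w - \<Phi> w"] \<Psi>(1) \<Phi>(1) holomorphic_on_diff by blast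
  have "P q = Re (1 * \<Phi> (Wave q))" if "q \<in> subgraph h" for q
  proof -
    have "\<Psi> (Wave q) = \<Phi> (Wave q) + \<i> * of_real b"
      using b[of "Wave q"] that by (simp add: Wave_in_below_iff algebra_simps)
    then show ?thesis using \<Psi>(2)[OF that] by simp
  qed
  from pdx_pdy_cong[OF open_subgraph p this]
  show "pdx P p = Re (F (Wave p))" "pdy P p = - Im (F (Wave p))"
    using Re_Wave_partials[OF \<Phi>(1) p, of 1] \<Phi>(2)[of "Wave p"] p by (simp_all add: Wave_in_below_iff)
qed

text \<open>On each level the normal expression is -Im(F \<open>tang\<close>), which converges in
  L^2 because F does. This exhibits a trace, and uniqueness identifies it with the one chosen in
  \<open>DN\<close>.\<close>

lemma DN_eq:
  assumes \<zeta>: "\<zeta> \<in> L2_torus" "has_weak_deriv \<zeta> g" "sqint g"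
  obtains u where "sqint u" "(\<integral>x. (u x)\<^sup>2 * tang x \<partial>circ) = 0" "AE x in circ. Re (u x * tang x) = g x"
    "AE x in circ. DN h \<zeta> x = - Im (u x * tang x)" "DN h \<zeta> \<in> L2_torus"
proof -
  obtain u \<Phi> where u: "sqint u" "moments_vanish u" "(\<integral>x. u x * tang x \<partial>circ) = 0"
    and ug: "AE x in circ. Re (u x * tang x) = g x" and \<Phi>: "\<Phi> holomorphic_on below"
    "\<And>w. w \<in> below \<Longrightarrow> euler \<Phi> w = \<i> * Cauchy_integral u w"
    and sol: "dirichlet_solution h \<zeta> (\<lambda>p. Re (\<Phi> (Wave p)))"
    using exists_dirichlet_solution[OF \<zeta>] by blast
  let ?F = "Cauchy_integral u"
  obtain T where T: "T > 0" "\<And>x. x \<in> {0..2*pi} \<Longrightarrow> norm (tang x) \<le> T" using tang_bounded by blast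
  have F: "?F holomorphic_on below"
    by (rule Cauchy_integral_holomorphic[OF sqint_L1(1)[OF u(1)] curve_notin(1)])
  define P where "P = potential h \<zeta>"
  have P: "dirichlet_solution h \<zeta> P"
    unfolding P_def potential_def using sol by (rule someI[of "dirichlet_solution h \<zeta>"])
  define N where "N p = pdy P p - deriv h (fst p) * pdx P p" for p
  have N: "N (x, h x - \<epsilon>) = - Im (?F (lev (- \<epsilon>) x) * tang x)" if "\<epsilon> > 0" for \<epsilon> x
    using dirichlet_solution_gradient[OF P \<Phi> sol level_in_subgraph[OF that]]
    by (simp add: N_def Wave_level deriv_h_eq tang_def)
  have sut: "sqint (\<lambda>x. - Im (u x * tang x))"
    by (rule sqint_uminus[OF sqint_Im(1)[OF sqint_mult_tang[OF u(1)]]])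
  obtain n where n: "n \<in> L2_torus" "AE x in circ. n x = - Im (u x * tang x)"
    using exists_L2_torus_representative[OF sut] by blast
  have bn: "has_boundary_value h N n"
  proof (rule has_boundary_valueI[OF n(1)])
    show "(\<lambda>x. N (x, h x - \<epsilon>)) \<in> L2_torus" if "\<epsilon> > 0" for \<epsilon>
      using L2_torus_level(2)[OF F that] N[OF that] by simp
    have est: "nsq (\<lambda>x. N (x, h x - \<epsilon>) - n x) \<le> T\<^sup>2 * nsq (\<lambda>x. ?F (lev (- \<epsilon>) x) - u x)" if e: "\<epsilon> > 0" for \<epsilon>
    proof (rule sqint_dominated(2))
      show "(\<lambda>x. N (x, h x - \<epsilon>) - n x) \<in> borel_measurable circ"
        using L2_torus_sqint[OF L2_torus_diff[OF L2_torus_level(2)[OF F e] n(1)]] N[OF e] by (simp add: sqint_def)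
    next
      show "AE x in circ. norm (N (x, h x - \<epsilon>) - n x) \<le> T * norm (?F (lev (- \<epsilon>) x) - u x)"
        using n(2) AE_space
      proof eventually_elim
        case (elim x)
        have "N (x, h x - \<epsilon>) - n x = - Im ((?F (lev (- \<epsilon>) x) - u x) * tang x)"
          using elim N[OF e, of x] by (simp only: left_diff_distrib minus_complex.sel)
        also have "norm \<dots> \<le> norm ((?F (lev (- \<epsilon>) x) - u x) * tang x)"
          by (simp only: real_norm_def abs_minus_cancel abs_Im_le_cmod)
        also have "\<dots> \<le> norm (?F (lev (- \<epsilon>) x) - u x) * T"
          unfolding norm_mult using elim T(2)[of x] by (intro mult_left_mono) auto
        finally show ?case by (simp add: mult.commute)
      qed
    qed (rule sqint_diff(1)[OF sqint_level[OF F e] u(1)])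
    show "((\<lambda>\<epsilon>. nsq (\<lambda>x. N (x, h x - \<epsilon>) - n x)) \<longlongrightarrow> 0) (at_right 0)"
    proof (rule tendsto_sandwich[of "\<lambda>_. 0"])
      show "((\<lambda>\<epsilon>. T\<^sup>2 * nsq (\<lambda>x. ?F (lev (- \<epsilon>) x) - u x)) \<longlongrightarrow> 0) (at_right 0)"
        by (rule tendsto_mult_right_zero[OF Cauchy_integral_boundary_value[OF u(1,2)]])
      show "\<forall>\<^sub>F \<epsilon> in at_right 0. nsq (\<lambda>x. N (x, h x - \<epsilon>) - n x) \<le> T\<^sup>2 * nsq (\<lambda>x. ?F (lev (- \<epsilon>) x) - u x)"
        by (intro eventually_at_rightI[of 0 1]) (auto simp: est)
    qed auto
  qed
  have DN: "DN h \<zeta> = boundary_value h N"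
    by (simp add: DN_def N_def[abs_def] P_def)
  have bv: "has_boundary_value h N (DN h \<zeta>)"
    unfolding DN boundary_value_def by (rule someI[of "has_boundary_value h N", OF bn])
  have "AE x in circ. DN h \<zeta> x = n x"
    by (rule has_boundary_value_unique[OF bv bn])
  then have "AE x in circ. DN h \<zeta> x = - Im (u x * tang x)"
    using n(2) by eventually_elim simp
  moreover have "DN h \<zeta> \<in> L2_torus" using bv by (simp add: has_boundary_value_def)
  moreover have "(\<integral>x. (u x)\<^sup>2 * tang x \<partial>circ) = 0"
    using boundary_square_integral[OF u(1,2)] by (simp add: Cauchy_integral_zero u(3))
  ultimately show thesis using that[OF u(1) _ ug] by blast
qed

section \<open>The weak curvature, the pairing and the final bound\<close>

lemma curvature_AE:
  assumes q: "has_weak_deriv (angle h) q"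
  shows "AE x in circ. curvature h x = q x / norm (tang x)" and "curvature h \<in> borel_measurable circ"
proof -
  have t: "norm (tang x) = sqrt (1 + (h' x)\<^sup>2)" for x
    by (simp add: tang_def cmod_def)
  have "has_weak_deriv (\<lambda>x. sin (angle h x)) (\<lambda>x. cos (angle h x) * q x)"
    by (rule has_weak_deriv_sin[OF q])
  \<comment> \<open>The sine of the angle is the function whose derivative defines the curvature,
    and its cosine is 1 / |\<open>tang\<close>|.\<close>
  moreover have "(\<lambda>x. sin (angle h x)) = (\<lambda>x. deriv h x / sqrt (1 + (deriv h x)\<^sup>2))"
    by (simp add: angle_def sin_arctan)
  moreover have "(\<lambda>x. cos (angle h x) * q x) = (\<lambda>x. q x / norm (tang x))"
    by (simp add: angle_def cos_arctan t deriv_h_eq)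
  ultimately have w: "has_weak_deriv (\<lambda>x. deriv h x / sqrt (1 + (deriv h x)\<^sup>2)) (\<lambda>x. q x / norm (tang x))"
    by simp
  show "AE x in circ. curvature h x = q x / norm (tang x)"
    unfolding curvature_def by (rule has_weak_deriv_weak_deriv(2)[OF w])
  show "curvature h \<in> borel_measurable circ"
    unfolding curvature_def using has_weak_derivD(2)[OF has_weak_deriv_weak_deriv(1)[OF w]] by auto
qed

text \<open>The factor 1 / |\<open>tang\<close>| passes from the curvature to the normal derivative,
  where it is the weight of the first inequality of \<open>Rellich\<close>; Cauchy-Schwarz
  concludes.\<close>

lemma DN_dual_curvature_le:
  assumes q: "has_weak_deriv (angle h) q" "sqint q" and \<phi>: "\<phi> \<in> H1_torus"
  shows "\<bar>DN_dual h (curvature h) \<phi>\<bar> \<le> 2 * sqrt (nsq q) * sqrt (nsq (weak_deriv \<phi>))"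
proof -
  obtain g where g: "g \<in> L2_torus" "has_weak_deriv \<phi> g" and \<phi>L2: "\<phi> \<in> L2_torus"
    using \<phi> by (auto simp: H1_torus_def)
  note w = has_weak_deriv_weak_deriv[OF g(2)]
  have wg: "AE x in circ. g x = weak_deriv \<phi> x" using w(2) by eventually_elim simp
  have wm: "weak_deriv \<phi> \<in> borel_measurable circ" using has_weak_derivD(2)[OF w(1)] by auto
  note sw = sqint_AE_cong[OF L2_torus_sqint[OF g(1)] wm wg]
  obtain u where u: "sqint u" "(\<integral>x. (u x)\<^sup>2 * tang x \<partial>circ) = 0"
    and ug: "AE x in circ. Re (u x * tang x) = weak_deriv \<phi> x"
    and DN: "AE x in circ. DN h \<phi> x = - Im (u x * tang x)" "DN h \<phi> \<in> L2_torus"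
    using DN_eq[OF \<phi>L2 w(1) sw(1)] by blast
  define n where "n x = Im (u x * tang x) / norm (tang x)" for x
  have sut: "sqint (\<lambda>x. u x * tang x)" by (rule sqint_mult_tang[OF u(1)])
  have sn: "sqint n" unfolding n_def by (rule sqint_normal_component[OF u(1)])
  note n_meas = sqint_measurable[OF sn]
  have nn: "nsq n \<le> 4 * nsq (weak_deriv \<phi>)"
  proof -
    have "nsq (weak_deriv \<phi>) = nsq (\<lambda>x. Re (u x * tang x))"
      by (rule sqint_AE_cong(2)[OF sqint_Re(1)[OF sut] wm ug])
    then show ?thesis using Rellich(1)[OF u] by (simp add: n_def[abs_def])
  qed
  have "DN_dual h (curvature h) \<phi> = (\<integral>x. curvature h x * DN h \<phi> x \<partial>circ)"
    by (simp add: DN_dual_def torus_integral_eq)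
  also have "\<dots> = (\<integral>x. - (q x * n x) \<partial>circ)"
  proof (rule integral_cong_AE)
    show "AE x in circ. curvature h x * DN h \<phi> x = - (q x * n x)"
      using curvature_AE(1)[OF q(1)] DN(1) by eventually_elim (simp add: n_def del: times_complex.sel)
    show "(\<lambda>x. curvature h x * DN h \<phi> x) \<in> borel_measurable circ"
      using curvature_AE(2)[OF q(1)] sqint_measurable[OF L2_torus_sqint[OF DN(2)]] by measurable
    show "(\<lambda>x. - (q x * n x)) \<in> borel_measurable circ"
      using sqint_measurable[OF q(2)] n_meas by measurable
  qed
  finally have "\<bar>DN_dual h (curvature h) \<phi>\<bar> = \<bar>\<integral>x. q x * n x \<partial>circ\<bar>" by simp
  also have "\<dots> \<le> sqrt (nsq q * nsq n)"
    using sqint_mult(2)[OF q(2) sn] by simp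
  also have "\<dots> \<le> sqrt (nsq q * (4 * nsq (weak_deriv \<phi>)))"
    using nn by (intro real_sqrt_le_mono mult_left_mono) auto
  also have "\<dots> = 2 * sqrt (nsq q) * sqrt (nsq (weak_deriv \<phi>))"
    by (simp add: real_sqrt_mult)
  finally show ?thesis .
qed

end

theorem corollary1p6:
  fixes h :: "real \<Rightarrow> real"
  assumes "periodic h" and "h C1_differentiable_on UNIV"
  shows "Hminus1_norm (DN_dual h (curvature h)) \<le> 2 * L2_norm_deriv (angle h)"
proof -
  obtain h' where h': "\<And>x. (h has_vector_derivative h' x) (at x)" "continuous_on UNIV h'"
    using assms(2) by (auto simp: C1_differentiable_on_def)
  interpret periodic_graph h h'
    using assms(1) h' by unfold_locales (auto simp: has_real_derivative_iff_has_vector_derivative)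
  show ?thesis
  proof (cases "(\<exists>q. has_weak_deriv (angle h) q) \<and> weak_deriv (angle h) \<in> L2_torus")
    \<comment> \<open>Either no integrable weak derivative exists or it is not square integrable;
      both conventions make the right-hand side infinite.\<close>
    case False
    then have "L2_norm_deriv (angle h) = \<infinity>" by (auto simp: L2_norm_deriv_def L2_norm_def)
    then show ?thesis by (simp add: ennreal_mult_top)
  next
    case True
    define q where "q = weak_deriv (angle h)"
    have q: "has_weak_deriv (angle h) q" "q \<in> L2_torus"
      using True has_weak_deriv_weak_deriv(1) by (auto simp: q_def)
    have rhs: "2 * L2_norm_deriv (angle h) = ennreal (2 * sqrt (nsq q))"
      using True by (auto simp: L2_norm_deriv_def L2_norm_eq q_def ennreal_mult)
    show ?thesis
      unfolding Hminus1_norm_def rhs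
    proof (rule SUP_least)
      fix \<phi> assume "\<phi> \<in> {\<phi> \<in> H1_torus. H1_norm \<phi> \<le> 1}"
      then have \<phi>: "\<phi> \<in> H1_torus" "H1_norm \<phi> \<le> 1" by auto
      \<comment> \<open>The nonnegative first term of the squared H^1 norm leaves at most 1 for the
        derivative.\<close>
      have "nsq (weak_deriv \<phi>) \<le> nsq \<phi> + nsq (weak_deriv \<phi>)" by simp
      also have "\<dots> \<le> 1"
        using \<phi>(2) by (simp add: H1_norm_def torus_integral_eq nsq_def)
      finally have "sqrt (nsq (weak_deriv \<phi>)) \<le> 1" by simp
      then have "2 * sqrt (nsq q) * sqrt (nsq (weak_deriv \<phi>)) \<le> 2 * sqrt (nsq q) * 1"
        by (intro mult_left_mono) auto
      then show "ennreal \<bar>DN_dual h (curvature h) \<phi>\<bar> \<le> ennreal (2 * sqrt (nsq q))"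
        using DN_dual_curvature_le[OF q(1) L2_torus_sqint[OF q(2)] \<phi>(1)] by (intro ennreal_leI) simp
    qed
  qed
qed

end
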